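(* Let $1<p<\infty$, $T>0$, and let $\Theta\subset\mathbb{R}^l$ be a compact set. Let $F_0,F_1,\dots,F_k:\mathbb{R}^d\times\Theta\to\mathbb{R}^d$ be such that, for some $L>0$, $$\sup_{i=0,\dots,k}|F_i(x_1,\theta_1)-F_i(x_2,\theta_2)|_2\le L\big(|x_1-x_2|_2+|x_1+x_2|_2\,|\theta_1-\theta_2|_2\big)$$ for all $(x_1,\theta_1),(x_2,\theta_2)\in\mathbb{R}^d\times\Theta$; let $x_0:\Theta\to\mathbb{R}^d$ be continuous; let $a:\mathbb{R}^d\times\Theta\to[0,+\infty)$ be continuous; and let $f:[0,T]\times\mathbb{R}^k\to\mathbb{R}$ satisfy: (i) $f(\cdot,u)$ is measurable for every $u\in\mathbb{R}^k$; (ii) $f(t,\cdot)$ is continuous and convex for a.e. $t\in[0,T]$; (iii) there exist $c\in L^1([0,T],[0,+\infty))$ and $C>0$ such that $f(t,u)\ge C|u|_2^p-c(t)$ for a.e. $t\in[0,T]$ and every $u\in\mathbb{R}^k$; (iv) there exist $u'\in\mathbb{R}^k$ and $c'\in L^1([0,T],[0,+\infty))$ such that $|f(t,u')|\le c'(t)$ for a.e. $t\in[0,T]$. For every $N\in\mathbb{N}\cup\{+\infty\}$ let $\Theta^N\subseteq\Theta$ be a nonempty compact set, and assume $d_H(\Theta^N,\Theta^\infty)\to0$ as $N\to\infty$. Let $\mathcal{J}^N$ and the ball $\mathcal{X}\subset\mathcal{U}=L^p([0,T],\mathbb{R}^k)$, equipped with the weak topology of $L^p$, be as defined in the context, and consider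 $\mathcal{J}^N$ restricted to $\mathcal{X}$. Then $\mathcal{J}^N$ $\Gamma$-converges to $\mathcal{J}^\infty$ on $\mathcal{X}$ as $N\to\infty$, and $$\inf_{\mathcal{X}}\mathcal{J}^\infty=\lim_{N\to\infty}\inf_{\mathcal{X}}\mathcal{J}^N.$$ Moreover, if $u_N^*\in\mathcal{X}$ is a minimizer of $\mathcal{J}^N$ (on $\mathcal{X}$) for every $N\in\mathbb{N}$, then the sequence $(u_N^* )_{N\in\mathbb{N}}$ is pre-compact with respect to the weak topology of $L^p$, and any limiting point of this sequence is a minimizer of $\mathcal{J}^\infty$.
   Context: Write $F=(F_1,\dots,F_k):\mathbb{R}^d\times\Theta\to\mathbb{R}^{d\times k}$. For $u\in\mathcal{U}$ and $\theta\in\Theta$, $x_u^\theta:[0,T]\to\mathbb{R}^d$ denotes the (Carathéodory, absolutely continuous) solution of $\dot x(t)=F_0(x(t),\theta)+F(x(t),\theta)u(t)$ for a.e. $t\in[0,T]$, $x(0)=x_0(\theta)$, and $X_u(t,\theta):=x_u^\theta(t)$. For $N\in\mathbb{N}\cup\{+\infty\}$, with $\mathbb{N}=\{1,2,\dots\}$, $\mathcal{J}^N:\mathcal{U}\to\mathbb{R}\cup\{+\infty\}$ is $$\mathcal{J}^N(u):=\max_{\theta\in\Theta^N}a(X_u(T,\theta),\theta)+\int_0^Tf(t,u(t))\,dt.$$ $\mathcal{X}:=\{u\in\mathcal{U}:\|u\|_{L^p}\le\rho\}$, where $\rho>0$ is a constant such that every $u^*\in\arg\min_{\mathcal{U}}\mathcal{J}^N$,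 for every $N\in\mathbb{N}\cup\{+\infty\}$, satisfies $\|u^*\|_{L^p}\le\rho$. Equipped with the $L^p$-weak topology, $\mathcal{X}$ is a compact metrizable space. Hausdorff distance: $d_H(A,B):=\max\{\sup_{a\in A}\inf_{b\in B}|a-b|_2,\ \sup_{b\in B}\inf_{a\in A}|b-a|_2\}$. $\Gamma$-convergence: a sequence of functionals $\mathcal{F}^N:\mathcal{X}\to\mathbb{R}\cup\{+\infty\}$ on a metric space $\mathcal{X}$ $\Gamma$-converges to $\mathcal{F}:\mathcal{X}\to\mathbb{R}\cup\{+\infty\}$ if (liminf condition) for every $u\in\mathcal{X}$ and every sequence $u_N\to u$ in $\mathcal{X}$ one has $\mathcal{F}(u)\le\liminf_{N\to\infty}\mathcal{F}^N(u_N)$, and (limsup condition) for every $u\in\mathcal{X}$ there is a sequence $u_N\to u$ in $\mathcal{X}$ with $\mathcal{F}(u)\ge\limsup_{N\to\infty}\mathcal{F}^N(u_N)$. Here convergence in $\mathcal{X}$ is weak convergence in $L^p$. *)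

theory Defs
  imports "HOL-Analysis.Analysis"
begin

text \<open>
  The elements of \<open>L\<^sup>p([0,T])\<close> are represented by functions instead of a.e.-classes. Everything below
  only depends on the classes; in particular, functions that agree a.e. are topologically
  indistinguishable in \<open>weak_Lp\<close>. Measurability is Lebesgue measurability.
\<close>

definition Lp_space :: "real \<Rightarrow> real \<Rightarrow> (real \<Rightarrow> 'b::euclidean_space) set" where
  "Lp_space p T = {u. u \<in> borel_measurable (lebesgue_on {0..T}) \<and>
                      integrable (lebesgue_on {0..T}) (\<lambda>t. norm (u t) powr p)}"

definition Lp_norm :: "real \<Rightarrow> real \<Rightarrow> (real \<Rightarrow> 'b::euclidean_space) \<Rightarrow> real" where
  "Lp_norm p T u = (LINT t|lebesgue_on {0..T}. norm (u t) powr p) powr (1 / p)"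

definition Lp_ball :: "real \<Rightarrow> real \<Rightarrow> real \<Rightarrow> (real \<Rightarrow> 'b::euclidean_space) set" where
  "Lp_ball p T \<rho> = {u \<in> Lp_space p T. Lp_norm p T u \<le> \<rho>}"

text \<open>
  Continuous linear functionals on \<open>L\<^sup>p\<close>. Boundedness makes them well defined on a.e.-classes; their
  values outside \<open>Lp_space p T\<close> play no role.
\<close>

definition Lp_dual :: "real \<Rightarrow> real \<Rightarrow> ((real \<Rightarrow> 'b::euclidean_space) \<Rightarrow> real) set" where
  "Lp_dual p T = {\<phi>.
     (\<forall>u\<in>Lp_space p T. \<forall>v\<in>Lp_space p T. \<phi> (\<lambda>t. u t + v t) = \<phi> u + \<phi> v) \<and>
     (\<forall>c. \<forall>u\<in>Lp_space p T. \<phi> (\<lambda>t. c *\<^sub>R u t) = c * \<phi> u) \<and>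
     (\<exists>B. \<forall>u\<in>Lp_space p T. \<bar>\<phi> u\<bar> \<le> B * Lp_norm p T u)}"

definition weak_Lp :: "real \<Rightarrow> real \<Rightarrow> (real \<Rightarrow> 'b::euclidean_space) topology" where
  "weak_Lp p T = topology_generated_by
     {{u \<in> Lp_space p T. \<phi> u \<in> V} | \<phi> V. \<phi> \<in> Lp_dual p T \<and> open V}"

lemma topspace_weak_Lp [simp]: "topspace (weak_Lp p T) = Lp_space p T"
proof -
  have "(\<lambda>_. 0) \<in> Lp_dual p T"
    by (auto simp: Lp_dual_def intro: exI[of _ 0])
  then have "Lp_space p T \<in> {{u \<in> Lp_space p T. \<phi> u \<in> V} | \<phi> V. \<phi> \<in> Lp_dual p T \<and> open V}"
    by (intro CollectI exI[of _ "\<lambda>_. 0"] exI[of _ UNIV]) auto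
  then show ?thesis
    unfolding weak_Lp_def topology_generated_by_topspace by blast
qed

definition absolutely_continuous_fun ::
  "real \<Rightarrow> real \<Rightarrow> (real \<Rightarrow> 'b::euclidean_space) \<Rightarrow> bool" where
  "absolutely_continuous_fun l r x \<longleftrightarrow>
     (\<forall>\<epsilon>>0. \<exists>\<delta>>0. \<forall>(n::nat) a b.
        (\<forall>i<n. l \<le> a i \<and> a i \<le> b i \<and> b i \<le> r) \<and>
        disjoint_family_on (\<lambda>i. {a i<..<b i}) {..<n} \<and>
        (\<Sum>i<n. b i - a i) < \<delta> \<longrightarrow>
        (\<Sum>i<n. norm (x (b i) - x (a i))) < \<epsilon>)"

text \<open>
  \<open>F x \<theta>\<close> is the \<open>d \<times> k\<close> matrix whose columns are the fields \<open>F\<^sub>1, \<dots>, F\<^sub>k\<close> at \<open>(x, \<theta>)\<close>.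
\<close>

definition is_trajectory ::
  "real \<Rightarrow> (real^'d \<Rightarrow> real^'l \<Rightarrow> real^'d) \<Rightarrow> (real^'d \<Rightarrow> real^'l \<Rightarrow> real^'k^'d) \<Rightarrow>
   (real^'l \<Rightarrow> real^'d) \<Rightarrow> (real \<Rightarrow> real^'k) \<Rightarrow> real^'l \<Rightarrow> (real \<Rightarrow> real^'d) \<Rightarrow> bool" where
  "is_trajectory T F0 F x0 u \<theta> x \<longleftrightarrow>
     absolutely_continuous_fun 0 T x \<and> x 0 = x0 \<theta> \<and>
     (AE t in lebesgue_on {0..T}.
        (x has_vector_derivative (F0 (x t) \<theta> + F (x t) \<theta> *v u t)) (at t within {0..T}))"

text \<open>
  Solutions are unique on \<open>[0,T]\<close> but unconstrained outside; hence \<open>SOME\<close>, not \<open>THE\<close>. The values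
  are meaningful for \<open>t\<close> in \<open>[0,T]\<close>.
\<close>

definition trajectory ::
  "real \<Rightarrow> (real^'d \<Rightarrow> real^'l \<Rightarrow> real^'d) \<Rightarrow> (real^'d \<Rightarrow> real^'l \<Rightarrow> real^'k^'d) \<Rightarrow>
   (real^'l \<Rightarrow> real^'d) \<Rightarrow> (real \<Rightarrow> real^'k) \<Rightarrow> real \<Rightarrow> real^'l \<Rightarrow> real^'d" where
  "trajectory T F0 F x0 u t \<theta> = (SOME x. is_trajectory T F0 F x0 u \<theta> x) t"

text \<open>
  Lebesgue integral with values in \<open>ereal\<close>: positive part minus negative part (\<open>ennreal\<close> cuts off
  negative values). The negative part of a coercive running cost is integrable, so no difference
  \<open>\<infinity> - \<infinity>\<close> arises in \<open>minimax_cost\<close>.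
\<close>

definition ext_integral :: "'b measure \<Rightarrow> ('b \<Rightarrow> real) \<Rightarrow> ereal" where
  "ext_integral M g =
     enn2ereal (\<integral>\<^sup>+ x. ennreal (g x) \<partial>M) - enn2ereal (\<integral>\<^sup>+ x. ennreal (- g x) \<partial>M)"

text \<open>
  The maximum over the compact set of parameters is written as a supremum in \<open>ereal\<close>.
\<close>

definition minimax_cost ::
  "real \<Rightarrow> (real^'d \<Rightarrow> real^'l \<Rightarrow> real^'d) \<Rightarrow> (real^'d \<Rightarrow> real^'l \<Rightarrow> real^'k^'d) \<Rightarrow>
   (real^'l \<Rightarrow> real^'d) \<Rightarrow> (real^'d \<Rightarrow> real^'l \<Rightarrow> real) \<Rightarrow> (real \<Rightarrow> real^'k \<Rightarrow> real) \<Rightarrow>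
   (real^'l) set \<Rightarrow> (real \<Rightarrow> real^'k) \<Rightarrow> ereal" where
  "minimax_cost T F0 F x0 a f \<Theta> u =
     (SUP \<theta>\<in>\<Theta>. ereal (a (trajectory T F0 F x0 u T \<theta>) \<theta>)) +
     ext_integral (lebesgue_on {0..T}) (\<lambda>t. f t (u t))"

definition hausdorff_dist :: "'b::metric_space set \<Rightarrow> 'b set \<Rightarrow> real" where
  "hausdorff_dist A B =
     max (SUP a\<in>A. INF b\<in>B. dist a b) (SUP b\<in>B. INF a\<in>A. dist b a)"

definition Gamma_converges ::
  "'b topology \<Rightarrow> (nat \<Rightarrow> 'b \<Rightarrow> ereal) \<Rightarrow> ('b \<Rightarrow> ereal) \<Rightarrow> bool" where
  "Gamma_converges X FN G \<longleftrightarrow>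
     (\<forall>u\<in>topspace X. \<forall>v. (\<forall>n. v n \<in> topspace X) \<and> limitin X v u sequentially \<longrightarrow>
        G u \<le> liminf (\<lambda>n. FN n (v n))) \<and>
     (\<forall>u\<in>topspace X. \<exists>v. (\<forall>n. v n \<in> topspace X) \<and> limitin X v u sequentially \<and>
        limsup (\<lambda>n. FN n (v n)) \<le> G u)"

end

theory Submission
  imports Defs
begin

text \<open>
  The recovery sequence is constant, so everything rests on two continuity properties along
  \<open>u\<^sub>n \<rightharpoonup> u\<close> in the ball: the endpoints satisfy \<open>X\<^bsub>u\<^sub>n\<^esub>(T, \<theta>\<^sub>n) \<longlonglongrightarrow> X\<^sub>u(T, \<theta>)\<close> whenever
  \<open>\<theta>\<^sub>n \<longlonglongrightarrow> \<theta>\<close>, and the running cost is lower semicontinuous. For the first, the difference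
  of the trajectories is driven by \<open>\<integral>\<^sub>0\<^sup>t F(x, \<theta>)(u\<^sub>n - u)\<close>, which tends to \<open>0\<close> uniformly in \<open>t\<close>
  (pointwise by weak convergence, and equicontinuously since \<open>p > 1\<close>), and Gronwall's inequality
  applies. For the second, \<open>f(t, \<cdot>)\<close> is a supremum of countably many affine functions.

  Weak compactness of the ball is proved without describing the dual of \<open>L\<^sup>p\<close>. Nearly
  norm-minimizing elements of the midpoint hulls of the tails of a bounded sequence converge
  strongly by uniform convexity. Hence a functional cannot tell apart sequences whose primitives at
  rational times have the same limit, and the ball with its weak topology is a pullback of a compact
  set in the metrizable space of functions on the rationals.
\<close>

section \<open>Calculus of absolutely continuous functions\<close>

text \<open>The fields are Lipschitz in the state with a constant that is merely integrable in time,
  so trajectories are only absolutely continuous. Gauge integrals carry their calculus: in the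
  fundamental theorem below, integrability of the derivative is a conclusion. Existence and Gronwall
  share the weight \<open>exp (2 * M t)\<close>, with \<open>M\<close> the primitive of the
  Lipschitz constant, because integration against it contracts by 1/2 on the whole interval, however
  large \<open>M\<close> gets. Since elements of Lp are functions, the weak topology does not
  separate a.e. equal ones; closedness of the ball is therefore not a consequence of its compactness
  and is proved on its own. The running cost may be infinite, so its semicontinuity is established
  for the nonnegative integrand \<open>f + c\<close> in \<open>ennreal\<close>, and the finite
  integral of \<open>c\<close> is subtracted afterwards.\<close>

text \<open>Henstock's lemma bounds the total error of any fine partial division by
  \<open>\<epsilon> * e\<close>. A bad interval tagged at its bad point errs by more than
  \<open>\<epsilon>\<close> times its length, so disjoint ones have total length at most
  \<open>e\<close>. By Vitali's covering theorem countably many of them cover almost all bad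
  points.\<close>

lemma negligible_bad_quotient:
  fixes f :: "real \<Rightarrow> 'a::euclidean_space"
  assumes f: "f integrable_on {a..b}" and "0 < \<epsilon>"
  defines "K \<equiv> \<lambda>(x, y). {min x y..max x y :: real}"
  defines "bad \<equiv> \<lambda>x y. x \<in> {a..b} \<and> y \<in> {a..b} \<and> x \<noteq> y \<and>
    \<epsilon> * \<bar>y - x\<bar> < norm (\<bar>y - x\<bar> *\<^sub>R f x - integral (K (x, y)) f)"
  shows "negligible {x. \<forall>\<delta>>0. \<exists>y. \<bar>y - x\<bar> < \<delta> \<and> bad x y}" (is "negligible ?S")
  unfolding negligible_outer_le
proof (intro allI impI)
  fix e :: real assume "e > 0"
  then have "\<epsilon> * e > 0" using \<open>0 < \<epsilon>\<close> by simp
  have fc: "f integrable_on cbox a b" using f by simp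
  obtain \<gamma> where "gauge \<gamma>" and \<gamma>: "\<And>p. \<lbrakk>p tagged_partial_division_of (cbox a b); \<gamma> fine p\<rbrakk> \<Longrightarrow>
    sum (\<lambda>(x,k). norm (measure lborel k *\<^sub>R f x - integral k f)) p < \<epsilon> * e"
    using Henstock_lemma[OF fc \<open>\<epsilon> * e > 0\<close>] by blast
  \<comment> \<open>A pair consists of a bad point, serving as tag, and the other end of its
    interval. The gauge condition makes every finite disjoint subfamily admissible in Henstock's
    lemma.\<close>
  define I where "I = {i. bad (fst i) (snd i) \<and> K i \<subseteq> \<gamma> (fst i)}"
  define c where "c = (\<lambda>i::real\<times>real. (fst i + snd i) / 2)"
  define r where "r = (\<lambda>i::real\<times>real. \<bar>snd i - fst i\<bar> / 2)"
  have K: "cball (c i) (r i) = K i" for i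
    by (cases "fst i \<le> snd i") (simp_all add: cball_eq_atLeastAtMost c_def r_def K_def split_beta field_simps)
  obtain C where "countable C" "C \<subseteq> I"
     and disj: "pairwise (\<lambda>i j. disjnt (cball (c i) (r i)) (cball (c j) (r j))) C"
     and neg: "negligible(?S - (\<Union>i \<in> C. cball (c i) (r i)))"
  proof (rule Vitali_covering_theorem_cballs[of I r ?S c])
    show "0 < r i" if "i \<in> I" for i using that by (auto simp: I_def bad_def r_def)
    fix x d :: real assume x: "x \<in> ?S" and "0 < d"
    obtain s where "s > 0" "ball x s \<subseteq> \<gamma> x"
      using \<open>gauge \<gamma>\<close> open_contains_ball[of "\<gamma> x"] unfolding gauge_def by blast
    obtain y where y: "\<bar>y - x\<bar> < min s d" "bad x y"
      using x[unfolded mem_Collect_eq, rule_format, of "min s d"] \<open>s > 0\<close> \<open>d > 0\<close> by auto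
    have "K (x, y) \<subseteq> ball x s"
      using y by (auto simp: K_def dist_real_def)
    then have "(x, y) \<in> I" using y \<open>ball x s \<subseteq> \<gamma> x\<close> by (auto simp: I_def)
    moreover have "x \<in> cball (c (x, y)) (r (x, y))" by (simp add: K K_def)
    moreover have "r (x, y) < d" using y \<open>0 < d\<close> by (simp add: r_def)
    ultimately show "\<exists>i. i \<in> I \<and> x \<in> cball (c i) (r i) \<and> r i < d" by blast
  qed blast
  have Kcontent: "measure lebesgue (K i) = \<bar>snd i - fst i\<bar>" for i
    by (simp add: K_def split_beta min_def max_def)
  have bound: "measure lebesgue (\<Union>i\<in>F. K i) \<le> e" if F: "F \<subseteq> C" "finite F" for F
  proof -
    define p where "p = (\<lambda>i. (fst i, K i)) ` F"
    have badF: "bad (fst i) (snd i)" "K i \<subseteq> \<gamma> (fst i)" if "i \<in> F" for i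
      using that F \<open>C \<subseteq> I\<close> by (auto simp: I_def)
    have dj: "K i \<inter> K j = {}" if "i \<in> F" "j \<in> F" "i \<noteq> j" for i j
      using disj F that unfolding pairwise_def K disjnt_def by blast
    have tagK: "fst i \<in> K i" for i by (auto simp: K_def split_beta)
    have inj: "inj_on (\<lambda>i. (fst i, K i)) F"
    proof (rule inj_onI)
      fix i j assume "i \<in> F" "j \<in> F" "(fst i, K i) = (fst j, K j)"
      then show "i = j" using dj[of i j] tagK[of i] by auto
    qed
    have "p tagged_partial_division_of (cbox a b)"
      unfolding tagged_partial_division_of_def
    proof (intro conjI allI impI)
      show "finite p" using F by (simp add: p_def)
      fix x k assume "(x, k) \<in> p"
      then obtain i where i: "i \<in> F" "x = fst i" "k = K i" by (auto simp: p_def)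
      show "x \<in> k" using i tagK by simp
      show "k \<subseteq> cbox a b" using i badF[of i] by (auto simp: bad_def K_def split_beta)
      show "\<exists>a b. k = cbox a b" unfolding i by (auto simp: K_def split_beta)
    next
      fix x1 k1 x2 k2 assume *: "(x1, k1) \<in> p \<and> (x2, k2) \<in> p \<and> (x1, k1) \<noteq> (x2, k2)"
      then have "k1 \<inter> k2 = {}" by (auto simp: p_def dest: dj)
      then show "interior k1 \<inter> interior k2 = {}"
        using interior_subset[of k1] interior_subset[of k2] by blast
    qed
    moreover have "\<gamma> fine p"
      using badF by (auto simp: fine_def p_def)
    ultimately have "sum (\<lambda>(x,k). norm(measure lborel k *\<^sub>R f x - integral k f)) p < \<epsilon> * e"
      by (intro \<gamma>)
    then have *: "(\<Sum>i\<in>F. norm (measure lborel (K i) *\<^sub>R f (fst i) - integral (K i) f)) < \<epsilon> * e"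
      unfolding p_def by (subst (asm) sum.reindex[OF inj]) (simp add: o_def)
    have Kc: "measure lborel (K i) = \<bar>snd i - fst i\<bar>" for i
      by (simp add: K_def split_beta min_def max_def)
    have "\<epsilon> * measure lebesgue (\<Union>i\<in>F. K i) \<le> \<epsilon> * (\<Sum>i\<in>F. measure lebesgue (K i))"
      using \<open>\<epsilon> > 0\<close> F by (intro mult_left_mono measure_UNION_le) (auto simp: K_def split_beta)
    also have "\<dots> = (\<Sum>i\<in>F. \<epsilon> * \<bar>snd i - fst i\<bar>)"
      by (simp add: sum_distrib_left Kcontent)
    also have "\<dots> \<le> (\<Sum>i\<in>F. norm (measure lborel (K i) *\<^sub>R f (fst i) - integral (K i) f))"
      using badF by (intro sum_mono) (auto simp: bad_def Kc less_imp_le)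
    finally show ?thesis using * \<open>\<epsilon> > 0\<close> mult_less_cancel_left_pos[of \<epsilon> "measure lebesgue (\<Union>i\<in>F. K i)" e] by linarith
  qed
  have meas: "K i \<in> lmeasurable" for i by (simp add: K_def split_beta)
  define U where "U = (\<Union>i\<in>C. K i)"
  have U: "U \<in> lmeasurable" "measure lebesgue U \<le> e"
    unfolding U_def
    by (rule fmeasurable_UN_bound[OF \<open>countable C\<close> meas bound] measure_UN_bound[OF \<open>countable C\<close> meas bound]; assumption)+
  show "\<exists>T. ?S \<subseteq> T \<and> T \<in> lmeasurable \<and> measure lebesgue T \<le> e"
  proof (intro exI conjI)
    have neg: "negligible (?S - U)" using neg by (simp add: U_def K)
    show "?S \<subseteq> U \<union> (?S - U)" by auto
    show "U \<union> (?S - U) \<in> lmeasurable"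
      by (intro fmeasurable.Un negligible_imp_measurable U neg)
    have "?S - U \<in> null_sets lebesgue" using neg by (simp only: negligible_iff_null_sets)
    then have "measure lebesgue (U \<union> (?S - U)) = measure lebesgue U"
      by (intro measure_Un_null_set fmeasurableD U)
    then show "measure lebesgue (U \<union> (?S - U)) \<le> e" using U by simp
  qed
qed

text \<open>Outside the exceptional sets for \<open>\<epsilon> = 1 / Suc n\<close> the definition of
  the derivative holds directly; the ends \<open>min x y\<close> and \<open>max x y\<close> cover
  increments on both sides of \<open>x\<close> at once.\<close>

theorem indefinite_integral_has_vector_derivative_ae:
  fixes f :: "real \<Rightarrow> 'a::euclidean_space"
  assumes f: "f integrable_on {a..b}"
  obtains N where "negligible N"
    "\<And>x. x \<in> {a..b} - N \<Longrightarrow>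
      ((\<lambda>t. integral {a..t} f) has_vector_derivative f x) (at x within {a..b})"
proof -
  define bad where "bad = (\<lambda>\<epsilon> x y. x \<in> {a..b} \<and> y \<in> {a..b} \<and> x \<noteq> y \<and>
    \<epsilon> * \<bar>y - x\<bar> < norm (\<bar>y - x\<bar> *\<^sub>R f x - integral {min x y..max x y} f))"
  define N where "N = (\<Union>n::nat. {x. \<forall>\<delta>>0. \<exists>y. \<bar>y - x\<bar> < \<delta> \<and> bad (1 / Suc n) x y})"
  have "negligible N"
    unfolding N_def
  proof (rule negligible_countable_Union)
    fix S assume "S \<in> range (\<lambda>n::nat. {x. \<forall>\<delta>>0. \<exists>y. \<bar>y - x\<bar> < \<delta> \<and> bad (1 / Suc n) x y})"
    then obtain n :: nat where "S = {x. \<forall>\<delta>>0. \<exists>y. \<bar>y - x\<bar> < \<delta> \<and> bad (1 / Suc n) x y}" by auto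
    then show "negligible S"
      using negligible_bad_quotient[OF f, of "1 / Suc n"] by (simp add: bad_def)
  qed auto
  moreover have "((\<lambda>t. integral {a..t} f) has_vector_derivative f x) (at x within {a..b})"
    if x: "x \<in> {a..b} - N" for x
    unfolding has_vector_derivative_def has_derivative_within_alt
  proof (intro conjI allI impI)
    show "bounded_linear (\<lambda>h. h *\<^sub>R f x)" by (rule bounded_linear_scaleR_left)
    fix e :: real assume "e > 0"
    then obtain n :: nat where n: "1 / Suc n < e" using nat_approx_posE by blast
    obtain \<delta> where "\<delta> > 0" and \<delta>: "\<And>y. \<bar>y - x\<bar> < \<delta> \<Longrightarrow> \<not> bad (1 / Suc n) x y"
      using x by (auto simp: N_def)
    show "\<exists>d>0. \<forall>y\<in>{a..b}. norm (y - x) < d \<longrightarrow>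
        norm (integral {a..y} f - integral {a..x} f - (y - x) *\<^sub>R f x) \<le> e * norm (y - x)"
    proof (intro exI[of _ \<delta>] conjI ballI impI \<open>\<delta> > 0\<close>)
      fix y assume y: "y \<in> {a..b}" "norm (y - x) < \<delta>"
      have int: "f integrable_on {a..t}" if "t \<in> {a..b}" for t
        using f that by (auto intro: integrable_on_subinterval)
      have "norm (integral {a..y} f - integral {a..x} f - (y - x) *\<^sub>R f x) =
            norm (\<bar>y - x\<bar> *\<^sub>R f x - integral {min x y..max x y} f)"
      proof (cases "x \<le> y")
        case True
        then have "integral {a..y} f = integral {a..x} f + integral {x..y} f"
          using x y by (intro Henstock_Kurzweil_Integration.integral_combine[symmetric] int) auto
        then show ?thesis using True by (simp add: norm_minus_commute)
      next
        case False
        then have "integral {a..x} f = integral {a..y} f + integral {y..x} f"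
          using x y by (intro Henstock_Kurzweil_Integration.integral_combine[symmetric] int) auto
        then show ?thesis using False by (simp add: algebra_simps)
      qed
      also have "\<dots> \<le> 1 / Suc n * \<bar>y - x\<bar>"
        using \<delta>[of y] x y by (cases "x = y") (auto simp: bad_def not_less)
      also have "\<dots> \<le> e * norm (y - x)" using mult_right_mono[of "1 / Suc n" e "\<bar>y - x\<bar>"] n by simp
      finally show "norm (integral {a..y} f - integral {a..x} f - (y - x) *\<^sub>R f x) \<le> e * norm (y - x)" .
    qed
  qed
  ultimately show ?thesis by (rule that)
qed

section \<open>Absolute continuity and the fundamental theorem of calculus\<close>

text \<open>Curried form of the definition: its premises become separate subgoals when the
  inequality is applied by resolution.\<close>

lemma absolutely_continuous_funE:
  assumes "absolutely_continuous_fun a b x" "0 < e"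
  obtains \<delta> where "0 < \<delta>"
    "\<forall>(n::nat) c d. (\<forall>i<n. a \<le> c i \<and> c i \<le> d i \<and> d i \<le> b) \<longrightarrow>
        disjoint_family_on (\<lambda>i. {c i<..<d i}) {..<n} \<longrightarrow> (\<Sum>i<n. d i - c i) < \<delta> \<longrightarrow>
        (\<Sum>i<n. norm (x (d i) - x (c i))) < e"
proof -
  have "\<exists>\<delta>>0. \<forall>(n::nat) c d.
        (\<forall>i<n. a \<le> c i \<and> c i \<le> d i \<and> d i \<le> b) \<and>
        disjoint_family_on (\<lambda>i. {c i<..<d i}) {..<n} \<and>
        (\<Sum>i<n. d i - c i) < \<delta> \<longrightarrow>
        (\<Sum>i<n. norm (x (d i) - x (c i))) < e"
    using assms(1)[unfolded absolutely_continuous_fun_def, THEN spec, of e] assms(2) by (rule mp)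
  then show thesis
    apply (elim exE conjE)
    subgoal for \<delta> by (rule that[of \<delta>]) auto
    done
qed

lemma absolutely_continuous_funI:
  assumes "\<And>e. 0 < e \<Longrightarrow> \<exists>\<delta>>0. \<forall>(n::nat) c d.
        (\<forall>i<n. a \<le> c i \<and> c i \<le> d i \<and> d i \<le> b) \<longrightarrow>
        disjoint_family_on (\<lambda>i. {c i<..<d i}) {..<n} \<longrightarrow>
        (\<Sum>i<n. d i - c i) < \<delta> \<longrightarrow>
        (\<Sum>i<n. norm (x (d i) - x (c i))) < e"
  shows "absolutely_continuous_fun a b x"
  using assms unfolding absolutely_continuous_fun_def by (simp only: imp_conjL) blast

text \<open>Tags outside \<open>N\<close> are handled by the straddle estimate of differentiability.
  Tags in \<open>N\<close> have their intervals in an open set of small measure, where absolute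
  continuity bounds the sum of the increments.\<close>

theorem absolutely_continuous_fun_has_integral:
  fixes x :: "real \<Rightarrow> 'a::euclidean_space"
  assumes ac: "absolutely_continuous_fun a b x" and "a \<le> b" and N: "negligible N"
    and deriv: "\<And>t. t \<in> {a..b} - N \<Longrightarrow> (x has_vector_derivative x' t) (at t within {a..b})"
  shows "(x' has_integral (x b - x a)) {a..b}"
proof -
  \<comment> \<open>\<open>x'\<close> is arbitrary on \<open>N\<close>; with the value 0 there, a
    tag in \<open>N\<close> contributes exactly the increment of \<open>x\<close> to the
    error.\<close>
  define g where "g = (\<lambda>t. if t \<in> N then 0 else x' t)"
  have "(g has_integral (x b - x a)) (cbox a b)"
    unfolding has_integral
  proof (intro allI impI)
    fix e :: real assume "e > 0"
    \<comment> \<open>The summand 2 keeps the denominator positive for \<open>a = b\<close> and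
      makes \<open>e' * (b - a)\<close> strictly smaller than \<open>e / 2\<close>.\<close>
    define e' where "e' = e / (2 * (b - a) + 2)"
    have "e' > 0" using \<open>e > 0\<close> \<open>a \<le> b\<close> by (auto simp: e'_def intro!: divide_pos_pos)
    have e': "e' * (b - a) < e / 2"
      using \<open>e > 0\<close> \<open>a \<le> b\<close> by (simp add: e'_def field_simps)
    obtain \<delta> where "\<delta> > 0" and \<delta>: "\<forall>(n::nat) c d. (\<forall>i<n. a \<le> c i \<and> c i \<le> d i \<and> d i \<le> b) \<longrightarrow>
        disjoint_family_on (\<lambda>i. {c i<..<d i}) {..<n} \<longrightarrow> (\<Sum>i<n. d i - c i) < \<delta> \<longrightarrow>
        (\<Sum>i<n. norm (x (d i) - x (c i))) < e / 2"
      by (rule absolutely_continuous_funE[OF ac half_gt_zero[OF \<open>e > 0\<close>]])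
    have Nnull: "N \<in> null_sets lebesgue" using N by (simp add: negligible_iff_null_sets)
    obtain G where "open G" "N \<subseteq> G" "(G - N) \<in> lmeasurable" "emeasure lebesgue (G - N) < ennreal \<delta>"
      using sets_lebesgue_outer_open[of N \<delta>] Nnull \<open>\<delta> > 0\<close> by blast
    then have G: "G \<in> lmeasurable" "measure lebesgue G < \<delta>"
    proof -
      have eq: "emeasure lebesgue G = emeasure lebesgue (G - N)"
        using Nnull \<open>open G\<close> by (simp add: emeasure_Diff_null_set)
      show "G \<in> lmeasurable"
        using eq \<open>emeasure lebesgue (G - N) < ennreal \<delta>\<close> \<open>open G\<close>
        by (auto intro!: fmeasurableI simp: less_top[symmetric] top_unique)
      then show "measure lebesgue G < \<delta>"
        using eq \<open>emeasure lebesgue (G - N) < ennreal \<delta>\<close> \<open>\<delta> > 0\<close>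
        by (metis emeasure_eq_measure2 ennreal_less_iff measure_nonneg)
    qed
    have "\<forall>t. \<exists>d>0. t \<in> {a..b} - N \<longrightarrow>
         (\<forall>y\<in>{a..b}. norm (y-t) < d \<longrightarrow> norm (x y - x t - (y-t) *\<^sub>R x' t) \<le> e' * norm (y-t))"
    proof
      fix t
      show "\<exists>d>0. t \<in> {a..b} - N \<longrightarrow>
         (\<forall>y\<in>{a..b}. norm (y-t) < d \<longrightarrow> norm (x y - x t - (y-t) *\<^sub>R x' t) \<le> e' * norm (y-t))"
      proof (cases "t \<in> {a..b} - N")
        case True
        then show ?thesis
          using deriv[OF True, unfolded has_vector_derivative_def has_derivative_within_alt] \<open>e' > 0\<close> by blast
      next
        case False
        then show ?thesis using zero_less_one by blast
      qed
    qed
    then obtain d where d: "\<And>t. 0 < d t"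
         "\<And>t y. \<lbrakk>t \<in> {a..b} - N; y \<in> {a..b}; norm (y-t) < d t\<rbrakk>
            \<Longrightarrow> norm (x y - x t - (y-t) *\<^sub>R x' t) \<le> e' * norm (y-t)"
      by metis
    define \<gamma> where "\<gamma> = (\<lambda>t. if t \<in> N then G else ball t (d t))"
    have "gauge \<gamma>" using d(1) \<open>open G\<close> \<open>N \<subseteq> G\<close> by (auto simp: gauge_def \<gamma>_def)
    have main: "norm ((\<Sum>(t, K)\<in>p. measure lborel K *\<^sub>R g t) - (x b - x a)) < e"
      if p: "p tagged_division_of cbox a b" and fine: "\<gamma> fine p" for p
    proof -
      have "finite p" using p by blast
      have pK: "\<exists>u v. K = {u..v} \<and> u \<le> v \<and> t \<in> {u..v} \<and> a \<le> u \<and> v \<le> b" if "(t, K) \<in> p" for t K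
      proof -
        obtain u v where "K = cbox u v" using p \<open>(t, K) \<in> p\<close> by blast
        moreover have "t \<in> K" "K \<subseteq> cbox a b" using p \<open>(t, K) \<in> p\<close> by blast+
        ultimately show ?thesis by auto
      qed
      have sums: "b - a = (\<Sum>(t,K)\<in>p. Sup K - Inf K)" "x b - x a = (\<Sum>(t,K)\<in>p. x (Sup K) - x (Inf K))"
        using additive_tagged_division_1[where f= "\<lambda>x. x"] additive_tagged_division_1[where f= x]
            \<open>a \<le> b\<close> p by auto
      have KI: "Inf (snd z) \<le> Sup (snd z)" if "z \<in> p" for z
        using pK[of "fst z" "snd z"] that by auto
      define p1 where "p1 = {z\<in>p. fst z \<in> N}"
      define p2 where "p2 = {z\<in>p. fst z \<notin> N}"
      have p12: "p = p1 \<union> p2" "p1 \<inter> p2 = {}" "finite p1" "finite p2"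
        using \<open>finite p\<close> by (auto simp: p1_def p2_def)
      \<comment> \<open>The increments of \<open>x\<close> telescope over the division, so the error
        splits into one term per tagged interval.\<close>
      define \<phi> where "\<phi> = (\<lambda>(t, K). measure lborel K *\<^sub>R g t - (x (Sup K) - x (Inf K)))"
      have "(\<Sum>z\<in>p2. norm (\<phi> z)) \<le> (\<Sum>z\<in>p2. e' * (Sup (snd z) - Inf (snd z)))"
      proof (rule sum_mono)
        fix z assume "z \<in> p2"
        obtain t K where z: "z = (t, K)" by force
        have "(t, K) \<in> p" "t \<notin> N" using \<open>z \<in> p2\<close> z by (auto simp: p2_def)
        then obtain u v where uv: "K = {u..v}" "u \<le> t" "t \<le> v" "a \<le> u" "v \<le> b"
          using pK[of t K] by auto
        have "K \<subseteq> ball t (d t)" using fineD[OF fine \<open>(t, K) \<in> p\<close>] \<open>t \<notin> N\<close> by (simp add: \<gamma>_def)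
        moreover have "u \<in> K" "v \<in> K" using uv by auto
        ultimately have "u \<in> ball t (d t)" "v \<in> ball t (d t)" by blast+
        then have 1: "norm (x u - x t - (u-t) *\<^sub>R x' t) \<le> e' * norm (u-t)"
             "norm (x v - x t - (v-t) *\<^sub>R x' t) \<le> e' * norm (v-t)"
          using d(2)[of t u] d(2)[of t v] uv \<open>t \<notin> N\<close>
          by (simp_all add: dist_real_def abs_minus_commute)
        have "\<phi> z = (x u - x t - (u-t) *\<^sub>R x' t) - (x v - x t - (v-t) *\<^sub>R x' t)"
          using uv \<open>t \<notin> N\<close> by (simp add: \<phi>_def z g_def algebra_simps)
        then have "norm (\<phi> z) \<le> e' * norm (u-t) + e' * norm (v-t)"
          using 1 by (metis add_mono norm_triangle_ineq4 order_trans)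
        also have "\<dots> = e' * (Sup (snd z) - Inf (snd z))"
          using uv by (simp add: z algebra_simps)
        finally show "norm (\<phi> z) \<le> e' * (Sup (snd z) - Inf (snd z))" .
      qed
      also have "\<dots> \<le> (\<Sum>z\<in>p. e' * (Sup (snd z) - Inf (snd z)))"
        using \<open>finite p\<close> \<open>e' > 0\<close> KI by (intro sum_mono2) (auto simp: p2_def)
      also have "\<dots> = e' * (b - a)"
        by (simp add: sums(1) sum_distrib_left split_beta)
      finally have B2: "(\<Sum>z\<in>p2. norm (\<phi> z)) < e / 2" using e' by simp
      \<comment> \<open>The intervals tagged in \<open>N\<close> are numbered to match the indexed
        families in the definition of absolute continuity.\<close>
      obtain h where h: "bij_betw h {..<card p1} p1"
        using \<open>finite p1\<close> bij_betw_from_nat_into_finite by blast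
      have hp: "h i \<in> p1" if "i < card p1" for i
        using h that by (auto simp: bij_betw_def)
      have hK: "\<exists>u v. snd (h i) = {u..v} \<and> u \<le> v \<and> a \<le> u \<and> v \<le> b \<and> {u..v} \<subseteq> G" if "i < card p1" for i
      proof -
        obtain t K where z: "h i = (t, K)" by force
        have "(t, K) \<in> p" "t \<in> N" using hp[OF that] z by (auto simp: p1_def)
        then have "K \<subseteq> G" using fineD[OF fine \<open>(t, K) \<in> p\<close>] by (simp add: \<gamma>_def)
        then show ?thesis using pK[OF \<open>(t, K) \<in> p\<close>] z by auto
      qed
      have hle: "Inf (snd (h i)) \<le> Sup (snd (h i))" if "i < card p1" for i
        using hK[OF that] by auto
      define I where "I = (\<lambda>i. {Inf (snd (h i))<..<Sup (snd (h i))})"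
      have I: "I i = interior (snd (h i))" if "i < card p1" for i
        using hK[OF that] by (auto simp: I_def)
      have disj: "disjoint_family_on I {..<card p1}"
        unfolding disjoint_family_on_def
      proof (intro ballI impI)
        fix i j assume ij: "i \<in> {..<card p1}" "j \<in> {..<card p1}" "i \<noteq> j"
        then have "h i \<noteq> h j" using h by (auto simp: bij_betw_def inj_on_def)
        moreover have "h i \<in> p" "h j \<in> p" using hp ij by (auto simp: p1_def)
        ultimately have "interior (snd (h i)) \<inter> interior (snd (h j)) = {}"
          using tagged_division_ofD(5)[OF p] by (metis prod.collapse)
        then show "I i \<inter> I j = {}" using I ij by auto
      qed
      have "(\<Sum>i<card p1. Sup (snd (h i)) - Inf (snd (h i))) = (\<Sum>i<card p1. measure lebesgue (I i))"
        using hK by (intro sum.cong) (fastforce simp: I_def)+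
      also have "\<dots> = measure lebesgue (\<Union>i<card p1. I i)"
        using disj by (intro measure_finite_Union[symmetric]) (auto simp: I_def hle)
      also have "\<dots> \<le> measure lebesgue G"
      proof (rule measure_mono_fmeasurable)
        show "(\<Union>i<card p1. I i) \<subseteq> G" using hK by (fastforce simp: I_def)
      qed (auto simp: I_def G)
      finally have len: "(\<Sum>i<card p1. Sup (snd (h i)) - Inf (snd (h i))) < \<delta>" using G by simp
      have "(\<Sum>z\<in>p1. norm (\<phi> z)) = (\<Sum>z\<in>p1. norm (x (Sup (snd z)) - x (Inf (snd z))))"
        by (intro sum.cong refl) (auto simp: \<phi>_def p1_def g_def norm_minus_commute)
      also have "\<dots> = (\<Sum>i<card p1. norm (x (Sup (snd (h i))) - x (Inf (snd (h i)))))"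
        using sum.reindex_bij_betw[OF h, of "\<lambda>z. norm (x (Sup (snd z)) - x (Inf (snd z)))"] by simp
      also have "\<dots> < e / 2"
        using len disj hK by (intro \<delta>[rule_format]) (fastforce simp: I_def)+
      finally have B1: "(\<Sum>z\<in>p1. norm (\<phi> z)) < e / 2" .
      have "(\<Sum>(t, K)\<in>p. measure lborel K *\<^sub>R g t) - (x b - x a) = (\<Sum>z\<in>p. \<phi> z)"
        by (simp add: sums(2) \<phi>_def split_beta sum_subtractf)
      also have "norm \<dots> \<le> (\<Sum>z\<in>p. norm (\<phi> z))" by (rule norm_sum)
      also have "\<dots> = (\<Sum>z\<in>p1. norm (\<phi> z)) + (\<Sum>z\<in>p2. norm (\<phi> z))"
        using p12 by (simp add: sum.union_disjoint)
      also have "\<dots> < e" using B1 B2 by simp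
      finally show ?thesis .
    qed
    show "\<exists>\<gamma>. gauge \<gamma> \<and> (\<forall>\<D>. \<D> tagged_division_of cbox a b \<and> \<gamma> fine \<D> \<longrightarrow>
           norm ((\<Sum>(t, K)\<in>\<D>. measure lborel K *\<^sub>R g t) - (x b - x a)) < e)" using \<open>gauge \<gamma>\<close> main by (intro exI[of _ \<gamma>] conjI allI impI) simp_all
  qed
  then have "(g has_integral (x b - x a)) {a..b}" by (simp only: box_real)
  show ?thesis
  proof (rule has_integral_spike[OF N])
    show "(g has_integral (x b - x a)) {a..b}" by fact
    show "x' t = g t" if "t \<in> {a..b} - N" for t
      using that unfolding g_def by auto
  qed
qed

lemma absolutely_continuous_fun_subinterval:
  assumes "absolutely_continuous_fun a b x" "a \<le> c" "d \<le> b"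
  shows "absolutely_continuous_fun c d x"
proof (rule absolutely_continuous_funI)
  fix e :: real assume "e > 0"
  obtain \<delta> where "0 < \<delta>" and \<delta>:
    "\<forall>(n::nat) c d. (\<forall>i<n. a \<le> c i \<and> c i \<le> d i \<and> d i \<le> b) \<longrightarrow>
        disjoint_family_on (\<lambda>i. {c i<..<d i}) {..<n} \<longrightarrow> (\<Sum>i<n. d i - c i) < \<delta> \<longrightarrow>
        (\<Sum>i<n. norm (x (d i) - x (c i))) < e"
    by (rule absolutely_continuous_funE[OF assms(1) \<open>e > 0\<close>])
  have "(\<Sum>i<n. norm (x (g i) - x (f i))) < e"
    if "\<forall>i<n. c \<le> f i \<and> f i \<le> g i \<and> g i \<le> d" "disjoint_family_on (\<lambda>i. {f i<..<g i}) {..<n}"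
      "(\<Sum>i<n. g i - f i) < \<delta>" for n :: nat and f g
    using that(2,3) by (intro \<delta>[rule_format]) (use that(1) assms(2,3) in force)+
  then show "\<exists>\<delta>>0. \<forall>(n::nat) f g. (\<forall>i<n. c \<le> f i \<and> f i \<le> g i \<and> g i \<le> d) \<longrightarrow>
        disjoint_family_on (\<lambda>i. {f i<..<g i}) {..<n} \<longrightarrow>
        (\<Sum>i<n. g i - f i) < \<delta> \<longrightarrow> (\<Sum>i<n. norm (x (g i) - x (f i))) < e"
    using \<open>0 < \<delta>\<close> by blast
qed

lemma absolutely_continuous_fun_continuous_on:
  assumes "absolutely_continuous_fun a b x"
  shows "continuous_on {a..b} x"
  unfolding continuous_on_iff
proof (intro ballI allI impI)
  fix t e :: real assume t: "t \<in> {a..b}" and "e > 0"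
  obtain \<delta> where "0 < \<delta>" and \<delta>:
    "\<forall>(n::nat) c d. (\<forall>i<n. a \<le> c i \<and> c i \<le> d i \<and> d i \<le> b) \<longrightarrow>
        disjoint_family_on (\<lambda>i. {c i<..<d i}) {..<n} \<longrightarrow> (\<Sum>i<n. d i - c i) < \<delta> \<longrightarrow>
        (\<Sum>i<n. norm (x (d i) - x (c i))) < e"
    by (rule absolutely_continuous_funE[OF assms(1) \<open>e > 0\<close>])
  have "dist (x s) (x t) < e" if "s \<in> {a..b}" "dist s t < \<delta>" for s
    using \<delta>[rule_format, of 1 "\<lambda>_. min s t" "\<lambda>_. max s t"] that t
    by (cases "s \<le> t") (auto simp: dist_norm disjoint_family_on_def min_def max_def norm_minus_commute)
  then show "\<exists>d>0. \<forall>s\<in>{a..b}. dist s t < d \<longrightarrow> dist (x s) (x t) < e"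
    using \<open>\<delta> > 0\<close> by blast
qed

text \<open>The closed intervals may share end points, but these are negligible, so the integrals
  may be taken over the disjoint open ones.\<close>

lemma sum_integral_disjoint_le:
  fixes h :: "real \<Rightarrow> real"
  assumes h: "h integrable_on {a..b}" "\<And>t. t \<in> {a..b} \<Longrightarrow> 0 \<le> h t"
    and cd: "\<And>i. i < n \<Longrightarrow> a \<le> c i \<and> c i \<le> d i \<and> d i \<le> b"
    and disj: "disjoint_family_on (\<lambda>i. {c i<..<d i}) {..<n::nat}"
  shows "(\<Sum>i<n. integral {c i..d i} h) \<le> integral {a..b} h"
proof -
  have U: "(h has_integral (\<Sum>i<n. integral {c i..d i} h)) (\<Union>i<n. {c i<..<d i})"
  proof (rule has_integral_UN)
    fix i assume "i \<in> {..<n}"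
    then have "h integrable_on {c i..d i}"
      using cd[of i] h(1) by (auto intro: integrable_on_subinterval)
    then show "(h has_integral integral {c i..d i} h) {c i<..<d i}"
      by (simp add: has_integral_Icc_iff_Ioo[symmetric] integrable_integral)
  next
    show "pairwise (\<lambda>i j. negligible ({c i<..<d i} \<inter> {c j<..<d j})) {..<n}"
      using disj by (auto simp: disjoint_family_on_def pairwise_def)
  qed auto
  moreover have "(h has_integral integral {a..b} h) {a..b}" using h(1) by (rule integrable_integral)
  moreover have "(\<Union>i<n. {c i<..<d i}) \<subseteq> {a..b}" using cd by force
  ultimately show ?thesis using h(2) by (intro has_integral_subset_le) auto
qed

text \<open>The excess of \<open>norm (f t)\<close> over a large level \<open>k\<close> has small
  integral, by dominated convergence; the rest is bounded by \<open>k\<close> and hence controlled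
  by total length.\<close>

theorem indefinite_integral_absolutely_continuous_fun:
  fixes f :: "real \<Rightarrow> 'a::euclidean_space"
  assumes f: "f absolutely_integrable_on {a..b}"
  shows "absolutely_continuous_fun a b (\<lambda>t. integral {a..t} f)"
proof (rule absolutely_continuous_funI)
  fix e :: real assume "e > 0"
  define h where "h = (\<lambda>(k::nat) t. norm (f t) - min (norm (f t)) (real k))"
  have nf: "(\<lambda>t. norm (f t)) absolutely_integrable_on {a..b}"
    using f by (rule absolutely_integrable_norm[unfolded o_def])
  have ah: "h k absolutely_integrable_on {a..b}" for k
    unfolding h_def
    by (intro set_integral_diff absolutely_integrable_min_1 nf absolutely_integrable_on_const) auto
  have "(\<lambda>k. integral {a..b} (h k)) \<longlonglongrightarrow> integral {a..b} (\<lambda>t. 0)"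
  proof (rule dominated_convergence)
    show "h k integrable_on {a..b}" for k using ah by (simp add: set_lebesgue_integral_eq_integral)
    show "(\<lambda>t. norm (f t)) integrable_on {a..b}" using nf by (simp add: set_lebesgue_integral_eq_integral)
    show "norm (h k t) \<le> norm (f t)" for k t by (auto simp: h_def)
    fix t assume "t \<in> {a..b}"
    obtain k0 :: nat where "norm (f t) \<le> k0" using real_arch_simple by blast
    then have "\<forall>\<^sub>F k in sequentially. h k t = 0"
      unfolding h_def by (auto intro!: eventually_sequentiallyI[of k0])
    then show "(\<lambda>k. h k t) \<longlonglongrightarrow> 0" by (simp add: tendsto_eventually)
  qed
  then have "\<forall>\<^sub>F k in sequentially. integral {a..b} (h k) < e / 2"
    using \<open>e > 0\<close> by (intro order_tendstoD(2)) auto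
  then obtain k where k: "integral {a..b} (h k) < e / 2"
    by (auto simp: eventually_sequentially)
  define \<delta> where "\<delta> = e / (2 * (real k + 1))"
  have "\<delta> > 0" using \<open>e > 0\<close> by (auto simp: \<delta>_def)
  have "(\<Sum>i<n. norm (integral {a..d i} f - integral {a..c i} f)) < e"
    if cd: "\<forall>i<n. a \<le> c i \<and> c i \<le> d i \<and> d i \<le> b"
      and disj: "disjoint_family_on (\<lambda>i. {c i<..<d i}) {..<n}"
      and len: "(\<Sum>i<n. d i - c i) < \<delta>" for n :: nat and c d
  proof -
    have "norm (integral {a..d i} f - integral {a..c i} f) \<le> integral {c i..d i} (h k) + k * (d i - c i)"
      if "i < n" for i
    proof -
      have cdi: "a \<le> c i" "c i \<le> d i" "d i \<le> b" using cd that by auto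
      have int: "g integrable_on {u..v}" if "g absolutely_integrable_on {a..b}" "a \<le> u" "v \<le> b"
        for u v and g :: "real \<Rightarrow> 'c::euclidean_space"
        by (rule set_lebesgue_integral_eq_integral(1)[OF absolutely_integrable_on_subinterval[OF that(1)]])
          (use that in auto)
      have "integral {a..d i} f = integral {a..c i} f + integral {c i..d i} f"
        using cdi by (intro Henstock_Kurzweil_Integration.integral_combine[symmetric] int f) auto
      then have "norm (integral {a..d i} f - integral {a..c i} f) = norm (integral {c i..d i} f)" by simp
      also have "\<dots> \<le> integral {c i..d i} (\<lambda>t. h k t + k)"
        using cdi by (intro Henstock_Kurzweil_Integration.integral_norm_bound_integral int f
            integrable_add integrable_const_ivl ah) (auto simp: h_def)
      also have "\<dots> = integral {c i..d i} (h k) + k * (d i - c i)"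
        using cdi by (subst Henstock_Kurzweil_Integration.integral_add) (auto intro!: int ah)
      finally show ?thesis .
    qed
    then have "(\<Sum>i<n. norm (integral {a..d i} f - integral {a..c i} f))
      \<le> (\<Sum>i<n. integral {c i..d i} (h k) + k * (d i - c i))" by (intro sum_mono) auto
    also have "\<dots> = (\<Sum>i<n. integral {c i..d i} (h k)) + k * (\<Sum>i<n. d i - c i)"
      by (simp add: sum.distrib sum_distrib_left)
    also have "\<dots> \<le> integral {a..b} (h k) + k * \<delta>"
      using ah[of k] cd disj len
      by (intro add_mono mult_left_mono sum_integral_disjoint_le)
        (auto simp: h_def set_lebesgue_integral_eq_integral(1))
    also have "k * \<delta> \<le> e / 2"
      using \<open>e > 0\<close> by (simp add: \<delta>_def field_simps)
    finally show ?thesis using k by simp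
  qed
  then show "\<exists>\<delta>>0. \<forall>(n::nat) c d. (\<forall>i<n. a \<le> c i \<and> c i \<le> d i \<and> d i \<le> b) \<longrightarrow>
        disjoint_family_on (\<lambda>i. {c i<..<d i}) {..<n} \<longrightarrow> (\<Sum>i<n. d i - c i) < \<delta> \<longrightarrow>
        (\<Sum>i<n. norm (integral {a..d i} f - integral {a..c i} f)) < e"
    using \<open>\<delta> > 0\<close> by blast
qed

text \<open>Serves for Lipschitz images, namely the exponential weight, and for adding a constant to
  an indefinite integral.\<close>

lemma absolutely_continuous_fun_dominated:
  assumes "absolutely_continuous_fun a b x" "0 \<le> B"
    and le: "\<And>s t. s \<in> {a..b} \<Longrightarrow> t \<in> {a..b} \<Longrightarrow> norm (y t - y s) \<le> B * norm (x t - x s)"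
  shows "absolutely_continuous_fun a b y"
proof (rule absolutely_continuous_funI)
  fix e :: real assume "e > 0"
  then have "e / (B + 1) > 0" using assms by simp
  obtain \<delta> where "0 < \<delta>" and \<delta>:
    "\<forall>(n::nat) c d. (\<forall>i<n. a \<le> c i \<and> c i \<le> d i \<and> d i \<le> b) \<longrightarrow>
        disjoint_family_on (\<lambda>i. {c i<..<d i}) {..<n} \<longrightarrow> (\<Sum>i<n. d i - c i) < \<delta> \<longrightarrow>
        (\<Sum>i<n. norm (x (d i) - x (c i))) < e / (B + 1)"
    by (rule absolutely_continuous_funE[OF assms(1) \<open>e / (B + 1) > 0\<close>])
  have "(\<Sum>i<n. norm (y (d i) - y (c i))) < e"
    if "\<forall>i<n. a \<le> c i \<and> c i \<le> d i \<and> d i \<le> b"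
      "(\<Sum>i<n. norm (x (d i) - x (c i))) < e / (B + 1)" for n :: nat and c d
  proof -
    have "(\<Sum>i<n. norm (y (d i) - y (c i))) \<le> (\<Sum>i<n. B * norm (x (d i) - x (c i)))"
      using that(1) by (intro sum_mono le) force+
    also have "\<dots> = B * (\<Sum>i<n. norm (x (d i) - x (c i)))" by (simp add: sum_distrib_left)
    also have "\<dots> \<le> B * (e / (B + 1))" using that(2) assms(2) by (intro mult_left_mono) auto
    also have "\<dots> < e" using \<open>e > 0\<close> assms(2) by (simp add: field_simps)
    finally show ?thesis .
  qed
  then show "\<exists>\<delta>>0. \<forall>(n::nat) c d. (\<forall>i<n. a \<le> c i \<and> c i \<le> d i \<and> d i \<le> b) \<longrightarrow>
        disjoint_family_on (\<lambda>i. {c i<..<d i}) {..<n} \<longrightarrow> (\<Sum>i<n. d i - c i) < \<delta> \<longrightarrow>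
        (\<Sum>i<n. norm (y (d i) - y (c i))) < e"
    using \<open>0 < \<delta>\<close> \<delta> by blast
qed

section \<open>Exponential weights and Gronwall's inequality\<close>

text \<open>\<open>exp (2 * M t) / 2\<close> is a primitive almost everywhere, and it is absolutely
  continuous because the exponential is Lipschitz on the range of \<open>M\<close>. The 2 in the
  exponent produces the factor 1/2 on which the contraction arguments rest.\<close>

lemma has_integral_exp_weight:
  fixes m :: "real \<Rightarrow> real"
  assumes m: "m absolutely_integrable_on {a..b}" "\<And>t. t \<in> {a..b} \<Longrightarrow> 0 \<le> m t" and t: "t \<in> {a..b}"
  defines "M \<equiv> \<lambda>t. integral {a..t} m"
  shows "((\<lambda>s. m s * exp (2 * M s)) has_integral (exp (2 * M t) - 1) / 2) {a..t}"
proof -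
  have mi: "m integrable_on {a..b}" using m by (simp add: set_lebesgue_integral_eq_integral(1))
  obtain N where N: "negligible N" "\<And>x. x \<in> {a..b} - N \<Longrightarrow> (M has_vector_derivative m x) (at x within {a..b})"
    using indefinite_integral_has_vector_derivative_ae[OF mi] unfolding M_def by metis
  have acM: "absolutely_continuous_fun a b M"
    unfolding M_def by (rule indefinite_integral_absolutely_continuous_fun[OF m(1)])
  have Mle: "M s \<le> M b" if "s \<in> {a..b}" for s
    unfolding M_def using that m(2) by (intro integral_subset_le integrable_on_subinterval[OF mi] mi) auto
  have "absolutely_continuous_fun a b (\<lambda>t. exp (2 * M t) / 2)"
  proof (rule absolutely_continuous_fun_dominated[OF acM])
    show "0 \<le> exp (2 * M b)" by simp
    have aux: "\<bar>exp (2 * v) / 2 - exp (2 * u) / 2\<bar> \<le> exp (2 * M b) * \<bar>v - u\<bar>" if "u \<le> M b" "v \<le> M b" for u v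
    proof -
      have "norm (exp (2 * v) / 2 - exp (2 * u) / 2) \<le> exp (2 * M b) * norm (v - u)"
      proof (rule field_differentiable_bound)
        show "convex {..M b}" by simp
        fix z assume "z \<in> {..M b}"
        show "((\<lambda>z. exp (2 * z) / 2) has_field_derivative exp (2 * z)) (at z within {..M b})"
          by (auto intro!: derivative_eq_intros)
        show "norm (exp (2 * z)) \<le> exp (2 * M b)" using \<open>z \<in> _\<close> by simp
      qed (use that in auto)
      then show ?thesis by simp
    qed
    show "norm (exp (2 * M t) / 2 - exp (2 * M s) / 2) \<le> exp (2 * M b) * norm (M t - M s)"
      if "s \<in> {a..b}" "t \<in> {a..b}" for s t
      using aux[OF Mle Mle, OF that] by simp
  qed
  then have ac: "absolutely_continuous_fun a t (\<lambda>t. exp (2 * M t) / 2)"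
    by (rule absolutely_continuous_fun_subinterval) (use t in auto)
  have "((\<lambda>s. m s * exp (2 * M s)) has_integral (exp (2 * M t) / 2 - exp (2 * M a) / 2)) {a..t}"
  proof (rule absolutely_continuous_fun_has_integral[OF ac _ N(1)])
    fix s assume s: "s \<in> {a..t} - N"
    have "s \<in> {a..b} - N" "{a..t} \<subseteq> {a..b}" using s t by auto
    then have "(M has_vector_derivative m s) (at s within {a..t})"
      using has_vector_derivative_within_subset N(2) by blast
    then have M': "(M has_real_derivative m s) (at s within {a..t})"
      by (simp only: has_real_derivative_iff_has_vector_derivative)
    have "((\<lambda>t. exp (2 * M t) / 2) has_real_derivative m s * exp (2 * M s)) (at s within {a..t})"
      by (rule derivative_eq_intros M' refl | simp)+
    then show "((\<lambda>t. exp (2 * M t) / 2) has_vector_derivative m s * exp (2 * M s)) (at s within {a..t})"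
      by (simp add: has_real_derivative_iff_has_vector_derivative)
  qed (use t in auto)
  moreover have "M a = 0" by (simp add: M_def)
  ultimately show ?thesis by (simp add: diff_divide_distrib)
qed

lemma absolutely_integrable_on_mult_continuous:
  fixes m :: "real \<Rightarrow> real" and e :: "real \<Rightarrow> 'a::euclidean_space"
  assumes "m absolutely_integrable_on {a..b}" "continuous_on {a..b} e"
  shows "(\<lambda>s. m s *\<^sub>R e s) absolutely_integrable_on {a..b}"
proof -
  have "bounded_bilinear (\<lambda>(x::'a) (r::real). r *\<^sub>R x)"
    by (rule bounded_bilinear.flip[OF bounded_bilinear_scaleR])
  then have "bilinear (\<lambda>(x::'a) (r::real). r *\<^sub>R x)"
    by (simp add: bilinear_conv_bounded_bilinear)
  from absolutely_integrable_bounded_measurable_product[OF this _ _ _ assms(1), of e]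
  show ?thesis using assms(2)
    by (simp add: continuous_imp_measurable_on_sets_lebesgue compact_imp_bounded compact_continuous_image)
qed

text \<open>Let \<open>S\<close> be the maximum of \<open>e t * exp (- (2 * M t))\<close>, attained
  at \<open>s\<close>. The integral inequality at \<open>s\<close> bounds
  \<open>S * exp (2 * M s)\<close> by \<open>K\<close> plus less than half of itself when
  \<open>S\<close> is positive, which forces \<open>S \<le> K\<close>. The exponent is twice the
  sharp one.\<close>

lemma Gronwall_integrable_kernel:
  fixes e m :: "real \<Rightarrow> real"
  assumes m: "m absolutely_integrable_on {a..b}" "\<And>t. t \<in> {a..b} \<Longrightarrow> 0 \<le> m t"
    and e: "continuous_on {a..b} e"
    and le: "\<And>t. t \<in> {a..b} \<Longrightarrow> e t \<le> K + integral {a..t} (\<lambda>s. m s * e s)"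
    and "0 \<le> K" and t: "t \<in> {a..b}"
  shows "e t \<le> K * exp (2 * integral {a..t} m)"
proof -
  define M where "M = (\<lambda>t. integral {a..t} m)"
  have mi: "m integrable_on {a..b}" using m by (simp add: set_lebesgue_integral_eq_integral(1))
  have M0: "0 \<le> M s" if "s \<in> {a..b}" for s
    unfolding M_def using that m(2) by (intro integral_nonneg integrable_on_subinterval[OF mi]) auto
  have "continuous_on {a..b} M"
    unfolding M_def by (rule indefinite_integral_continuous_1[OF mi])
  then have "continuous_on {a..b} (\<lambda>t. e t * exp (- (2 * M t)))" by (intro continuous_intros e)
  moreover have "{a..b} \<noteq> {}" using t by auto
  ultimately obtain s where s: "s \<in> {a..b}"
    and max: "\<And>t. t \<in> {a..b} \<Longrightarrow> e t * exp (- (2 * M t)) \<le> e s * exp (- (2 * M s))"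
    using continuous_attains_sup[OF compact_Icc, of a b "\<lambda>t. e t * exp (- (2 * M t))"] by blast
  define S where "S = e s * exp (- (2 * M s))"
  have eS: "e r \<le> S * exp (2 * M r)" if "r \<in> {a..b}" for r
    using max[OF that] by (simp add: S_def exp_minus field_simps)
  have W: "((\<lambda>r. m r * exp (2 * M r)) has_integral (exp (2 * M s) - 1) / 2) {a..s}"
    unfolding M_def by (rule has_integral_exp_weight[OF m s])
  have "e s \<le> K + integral {a..s} (\<lambda>r. m r * e r)" by (rule le[OF s])
  also have "integral {a..s} (\<lambda>r. m r * e r) \<le> integral {a..s} (\<lambda>r. S * (m r * exp (2 * M r)))"
  proof (rule integral_le)
    have "(\<lambda>r. m r *\<^sub>R e r) absolutely_integrable_on {a..s}"
      using s by (intro absolutely_integrable_on_mult_continuous absolutely_integrable_on_subinterval[OF m(1)]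
          continuous_on_subset[OF e]) auto
    then show "(\<lambda>r. m r * e r) integrable_on {a..s}" by (simp add: set_lebesgue_integral_eq_integral(1))
    show "(\<lambda>r. S * (m r * exp (2 * M r))) integrable_on {a..s}"
      using W by (intro integrable_on_mult_right) blast
    show "m r * e r \<le> S * (m r * exp (2 * M r))" if "r \<in> {a..s}" for r
      using mult_left_mono[OF eS m(2), of r] that s by (simp add: mult_ac)
  qed
  also have "\<dots> = S * ((exp (2 * M s) - 1) / 2)"
    using W by (simp add: integral_unique)
  finally have "e s \<le> K + S * ((exp (2 * M s) - 1) / 2)" by simp
  moreover have "e s = S * exp (2 * M s)" by (simp add: S_def exp_minus)
  ultimately have *: "S * (1 + exp (2 * M s)) \<le> 2 * K" by (simp add: field_simps)
  \<comment> \<open>\<open>e\<close> has no sign, so \<open>S\<close> may be negative; the claim is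
    then immediate from \<open>0 \<le> K\<close>.\<close>
  have "S \<le> K"
  proof (cases "0 \<le> S")
    case True
    then have "S * 2 \<le> S * (1 + exp (2 * M s))" using M0[OF s] by (intro mult_left_mono) auto
    then show ?thesis using * by simp
  qed (use \<open>0 \<le> K\<close> in simp)
  then have "S * exp (2 * M t) \<le> K * exp (2 * M t)" by simp
  with eS[OF t] show ?thesis unfolding M_def by (rule order_trans)
qed

section \<open>Caratheodory equations\<close>

text \<open>Picard iteration in the norm \<open>sup norm (x t) * exp (- (2 * M t))\<close>, where
  one step halves distances on the whole interval. Integrability of \<open>f\<close> along
  continuous curves stands for the usual measurability conditions.\<close>

theorem Caratheodory_existence:
  fixes f :: "real \<Rightarrow> 'a::euclidean_space \<Rightarrow> 'a"
  assumes "a \<le> b"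
    and m: "m absolutely_integrable_on {a..b}" "\<And>t. t \<in> {a..b} \<Longrightarrow> 0 \<le> m t"
    and f: "\<And>x. continuous_on {a..b} x \<Longrightarrow> (\<lambda>t. f t (x t)) absolutely_integrable_on {a..b}"
    and lip: "\<And>t x y. t \<in> {a..b} \<Longrightarrow> norm (f t x - f t y) \<le> m t * norm (x - y)"
  obtains x where "continuous_on {a..b} x"
    "\<And>t. t \<in> {a..b} \<Longrightarrow> x t = c + integral {a..t} (\<lambda>s. f s (x s))"
proof -
  define M where "M = (\<lambda>t. integral {a..t} m)"
  have mi: "m integrable_on {a..b}" using m by (simp add: set_lebesgue_integral_eq_integral(1))
  have W: "((\<lambda>r. m r * exp (2 * M r)) has_integral (exp (2 * M t) - 1) / 2) {a..t}" if "t \<in> {a..b}" for t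
    unfolding M_def by (rule has_integral_exp_weight[OF m that])
  have contM: "continuous_on {a..b} M"
    unfolding M_def by (rule indefinite_integral_continuous_1[OF mi])
  have Mle: "M s \<le> M b" if "s \<in> {a..b}" for s
    unfolding M_def using that m(2) by (intro integral_subset_le integrable_on_subinterval[OF mi] mi) auto
  have M0: "0 \<le> M s" if "s \<in> {a..b}" for s
    unfolding M_def using that m(2) by (intro integral_nonneg integrable_on_subinterval[OF mi]) auto
  define P where "P = (\<lambda>x t. c + integral {a..t} (\<lambda>s. f s (x s)))"
  have fi: "(\<lambda>s. f s (x s)) integrable_on {a..t}" if "continuous_on {a..b} x" "t \<in> {a..b}" for x t
    using that by (intro set_lebesgue_integral_eq_integral(1) absolutely_integrable_on_subinterval[OF f]) auto
  have contP: "continuous_on {a..b} (P x)" if "continuous_on {a..b} x" for x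
    unfolding P_def using fi[OF that, of b] \<open>a \<le> b\<close>
    by (intro continuous_intros indefinite_integral_continuous_1) auto
  \<comment> \<open>\<open>K\<close> is a bound in the weighted norm; the weight integrates to at
    most half of itself, so the bound is halved.\<close>
  have step: "norm (P x t - P y t) \<le> K / 2 * exp (2 * M t)"
    if x: "continuous_on {a..b} x" and y: "continuous_on {a..b} y" and "0 \<le> K" and t: "t \<in> {a..b}"
      and le: "\<And>s. s \<in> {a..b} \<Longrightarrow> norm (x s - y s) \<le> K * exp (2 * M s)" for x y t K
  proof -
    have "P x t - P y t = integral {a..t} (\<lambda>s. f s (x s) - f s (y s))"
      using fi[OF x t] fi[OF y t] by (simp add: P_def Henstock_Kurzweil_Integration.integral_diff)
    also have "norm \<dots> \<le> integral {a..t} (\<lambda>s. K * (m s * exp (2 * M s)))"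
    proof (rule Henstock_Kurzweil_Integration.integral_norm_bound_integral)
      show "(\<lambda>s. f s (x s) - f s (y s)) integrable_on {a..t}"
        by (intro integrable_diff fi x y t)
      show "(\<lambda>s. K * (m s * exp (2 * M s))) integrable_on {a..t}"
        using W[OF t] by (intro integrable_on_mult_right) blast
      fix s assume "s \<in> {a..t}"
      then have s: "s \<in> {a..b}" using t by auto
      have "norm (f s (x s) - f s (y s)) \<le> m s * norm (x s - y s)" by (rule lip[OF s])
      also have "\<dots> \<le> m s * (K * exp (2 * M s))" by (intro mult_left_mono le m s)
      finally show "norm (f s (x s) - f s (y s)) \<le> K * (m s * exp (2 * M s))" by (simp add: mult_ac)
    qed
    also have "\<dots> = K * ((exp (2 * M t) - 1) / 2)"
      using W[OF t] by (simp add: integral_unique)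
    also have "\<dots> \<le> K / 2 * exp (2 * M t)" using \<open>0 \<le> K\<close> by (simp add: algebra_simps)
    finally show ?thesis .
  qed
  define X where "X = (\<lambda>n. (P ^^ n) (\<lambda>_. c))"
  have XSuc: "X (Suc n) = P (X n)" for n by (simp add: X_def)
  have contX: "continuous_on {a..b} (X n)" for n
    by (induction n) (simp_all add: XSuc contP, simp add: X_def)
  have "bounded ((\<lambda>t. X 1 t - X 0 t) ` {a..b})"
    by (intro compact_imp_bounded compact_continuous_image continuous_intros contX) auto
  then obtain K where "K > 0" and K: "\<And>t. t \<in> {a..b} \<Longrightarrow> norm (X 1 t - X 0 t) \<le> K"
    unfolding bounded_pos by auto
  have diff: "norm (X (Suc n) t - X n t) \<le> K / 2 ^ n * exp (2 * M t)" if "t \<in> {a..b}" for n t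
    using that
  proof (induction n arbitrary: t)
    case 0
    have "K * 1 \<le> K * exp (2 * M t)" using \<open>K > 0\<close> M0[OF 0] by (intro mult_left_mono) auto
    then show ?case using K[OF 0] by simp
  next
    case (Suc n)
    have "norm (P (X (Suc n)) t - P (X n) t) \<le> K / 2 ^ n / 2 * exp (2 * M t)"
      using \<open>K > 0\<close> by (intro step contX Suc) auto
    then show ?case by (simp add: XSuc mult.commute)
  qed
  \<comment> \<open>The increments telescope and are dominated by a geometric series, as the weight
    is at most \<open>exp (2 * M b)\<close>.\<close>
  define D where "D = (\<lambda>n t. X (Suc n) t - X n t)"
  have "uniform_limit {a..b} (\<lambda>n t. \<Sum>i<n. D i t) (\<lambda>t. \<Sum>i. D i t) sequentially"
  proof (rule Weierstrass_m_test)
    show "norm (D n t) \<le> K * exp (2 * M b) * (1 / 2) ^ n" if "t \<in> {a..b}" for n t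
    proof -
      have "norm (D n t) \<le> K / 2 ^ n * exp (2 * M t)" unfolding D_def by (rule diff[OF that])
      also have "\<dots> \<le> K / 2 ^ n * exp (2 * M b)" using \<open>K > 0\<close> Mle[OF that] by (intro mult_left_mono) auto
      finally show ?thesis by (simp add: power_one_over field_simps)
    qed
    show "summable (\<lambda>n. K * exp (2 * M b) * (1 / 2) ^ n)" by (intro summable_mult summable_geometric) simp
  qed
  moreover have "(\<Sum>i<n. D i t) = X n t - X 0 t" for n t
    unfolding D_def by (rule sum_lessThan_telescope)
  ultimately have ul: "uniform_limit {a..b} (\<lambda>n t. X n t - X 0 t) (\<lambda>t. \<Sum>i. D i t) sequentially" by simp
  define x where "x = (\<lambda>t. X 0 t + (\<Sum>i. D i t))"
  have "uniform_limit {a..b} (\<lambda>n t. X 0 t + (X n t - X 0 t)) x sequentially"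
    unfolding x_def by (intro uniform_limit_intros ul)
  then have ul: "uniform_limit {a..b} X x sequentially" by simp
  have contx: "continuous_on {a..b} x"
    by (rule uniform_limit_theorem[OF _ ul]) (auto simp: contX)
  have "x t = P x t" if t: "t \<in> {a..b}" for t
  proof -
    have lim: "(\<lambda>n. X (Suc n) t) \<longlonglongrightarrow> x t"
      using tendsto_uniform_limitI[OF ul t] by (rule LIMSEQ_Suc)
    have "(\<lambda>n. X (Suc n) t) \<longlonglongrightarrow> P x t"
    proof (rule metric_LIMSEQ_I)
      fix r :: real assume "r > 0"
      define \<epsilon> where "\<epsilon> = r / exp (2 * M t)"
      have "\<epsilon> > 0" using \<open>r > 0\<close> by (simp add: \<epsilon>_def)
      then obtain n0 where n0: "\<And>n s. n \<ge> n0 \<Longrightarrow> s \<in> {a..b} \<Longrightarrow> dist (X n s) (x s) < \<epsilon>"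
        using uniform_limitD[OF ul \<open>\<epsilon> > 0\<close>] unfolding eventually_sequentially by blast
      have "dist (X (Suc n) t) (P x t) < r" if "n \<ge> n0" for n
      proof -
        have "norm (P (X n) t - P x t) \<le> \<epsilon> / 2 * exp (2 * M t)"
        proof (rule step[OF contX contx _ t])
          fix s assume s: "s \<in> {a..b}"
          have "norm (X n s - x s) \<le> \<epsilon> * 1" using n0[OF that s] by (simp add: dist_norm)
          also have "\<dots> \<le> \<epsilon> * exp (2 * M s)" using \<open>\<epsilon> > 0\<close> M0[OF s] by (intro mult_left_mono) auto
          finally show "norm (X n s - x s) \<le> \<epsilon> * exp (2 * M s)" .
        qed (use \<open>\<epsilon> > 0\<close> in simp)
        also have "\<dots> < r" using \<open>r > 0\<close> by (simp add: \<epsilon>_def)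
        finally show ?thesis by (simp add: XSuc dist_norm)
      qed
      then show "\<exists>n0. \<forall>n\<ge>n0. dist (X (Suc n) t) (P x t) < r" by blast
    qed
    then show ?thesis using lim LIMSEQ_unique by blast
  qed
  then show ?thesis using contx by (intro that[of x]) (simp_all add: P_def)
qed

section \<open>Uniform convexity and completeness of Lp\<close>

text \<open>Scaling by the midpoint reduces the claim to
  \<open>2 < (1 + h) powr p + (1 - h) powr p\<close>, whose right side has positive derivative in
  \<open>h\<close> and equals 2 at \<open>h = 0\<close>.\<close>

lemma powr_midpoint_strict:
  fixes x y p :: real
  assumes "1 < p" "0 \<le> x" "0 \<le> y" "x \<noteq> y"
  shows "((x + y) / 2) powr p < (x powr p + y powr p) / 2"
proof -
  have key: "2 < (1 + h) powr p + (1 - h) powr p" if h: "0 < h" "h \<le> 1" for h :: real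
  proof -
    have "(1 + 0) powr p + (1 - 0) powr p < (1 + h) powr p + (1 - h) powr p"
    proof (rule DERIV_pos_imp_increasing_open[OF h(1)])
      fix z assume z: "0 < z" "z < h"
      have "((\<lambda>z. (1 + z) powr p + (1 - z) powr p) has_real_derivative
          p * ((1 + z) powr (p - 1) - (1 - z) powr (p - 1))) (at z)"
        using z h by (auto intro!: derivative_eq_intros simp: algebra_simps powr_diff)
      moreover have "(1 - z) powr (p - 1) < (1 + z) powr (p - 1)"
        using z h assms(1) by (intro powr_less_mono2) auto
      ultimately show "\<exists>D. ((\<lambda>z. (1 + z) powr p + (1 - z) powr p) has_real_derivative D) (at z) \<and> 0 < D"
        using assms(1) by (intro exI conjI) (assumption, simp)
    next
      show "continuous_on {0..h} (\<lambda>z. (1 + z) powr p + (1 - z) powr p)"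
        using h assms(1) by (intro continuous_on_add continuous_on_powr' continuous_intros) auto
    qed
    then show ?thesis by simp
  qed
  have wlog: "((x + y) / 2) powr p < (x powr p + y powr p) / 2" if xy: "0 \<le> x" "x < y" for x y
  proof -
    define m where "m = (x + y) / 2"
    \<comment> \<open>Half the difference relative to the midpoint: the two numbers are
      \<open>m * (1 + h)\<close> and \<open>m * (1 - h)\<close>.\<close>
    define h where "h = (y - x) / (x + y)"
    have "m > 0" "0 < h" "h \<le> 1" using xy by (auto simp: m_def h_def field_simps)
    have "m * (1 + h) = y" "m * (1 - h) = x" using xy by (auto simp: m_def h_def field_simps)
    then have "y powr p = m powr p * (1 + h) powr p" "x powr p = m powr p * (1 - h) powr p"
      using \<open>m > 0\<close> \<open>h \<le> 1\<close> \<open>0 < h\<close> by (metis powr_mult)+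
    moreover have "m powr p * 2 < m powr p * ((1 + h) powr p + (1 - h) powr p)"
      using key[OF \<open>0 < h\<close> \<open>h \<le> 1\<close>] \<open>m > 0\<close> by (intro mult_strict_left_mono) auto
    ultimately show ?thesis by (simp add: m_def[symmetric] algebra_simps)
  qed
  show ?thesis
    using assms wlog[of x y] wlog[of y x] by (cases "x < y") (auto simp: add.commute)
qed

text \<open>Strictness has two sources: for equal norms the strict triangle inequality of an inner
  product space, for different norms the strict convexity of the power.\<close>

lemma norm_powr_midpoint_strict:
  fixes a b :: "'a::real_inner"
  assumes "1 < p" "a \<noteq> b"
  shows "norm ((1/2) *\<^sub>R (a + b)) powr p < (norm a powr p + norm b powr p) / 2"
proof (cases "norm a = norm b")
  case True
  have "norm (a + b) \<noteq> norm a + norm b"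
  proof
    assume "norm (a + b) = norm a + norm b"
    then have "norm a *\<^sub>R b = norm b *\<^sub>R a" by (simp add: norm_triangle_eq)
    with True \<open>a \<noteq> b\<close> show False by auto
  qed
  then have "norm (a + b) < norm a + norm b" by (metis norm_triangle_ineq order_le_less)
  then have "norm ((1/2) *\<^sub>R (a + b)) < norm a" using True by simp
  then have "norm ((1/2) *\<^sub>R (a + b)) powr p < norm a powr p" using assms by (intro powr_less_mono2) auto
  then show ?thesis using True by simp
next
  case False
  have "norm ((1/2) *\<^sub>R (a + b)) \<le> (norm a + norm b) / 2"
    using norm_triangle_ineq[of a b] by simp
  then have "norm ((1/2) *\<^sub>R (a + b)) powr p \<le> ((norm a + norm b) / 2) powr p"
    using assms by (intro powr_mono2) auto
  also have "\<dots> < (norm a powr p + norm b powr p) / 2"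
    using assms False by (intro powr_midpoint_strict) auto
  finally show ?thesis .
qed

lemma norm_powr_midpoint:
  fixes a b :: "'a::real_inner"
  assumes "1 < p"
  shows "norm ((1/2) *\<^sub>R (a + b)) powr p \<le> (norm a powr p + norm b powr p) / 2"
  using norm_powr_midpoint_strict[OF assms, of a b] by (cases "a = b") (auto simp: scaleR_2[symmetric])

text \<open>A quantitative form of strict convexity, obtained by homogeneity from compactness of the
  set \<open>norm a powr p + norm b powr p = 1\<close>.\<close>

lemma norm_powr_uniformly_convex:
  assumes "1 < p" "0 < \<epsilon>"
  obtains K where "0 \<le> K"
    "\<And>a b :: 'a::euclidean_space. norm (a - b) powr p \<le> \<epsilon> * (norm a powr p + norm b powr p) +
       K * ((norm a powr p + norm b powr p) / 2 - norm ((1/2) *\<^sub>R (a + b)) powr p)"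
proof -
  define s where "s = (\<lambda>(a::'a, b::'a). norm a powr p + norm b powr p)"
  define \<Delta> where "\<Delta> = (\<lambda>(a::'a, b::'a). (norm a powr p + norm b powr p) / 2 - norm ((1/2) *\<^sub>R (a + b)) powr p)"
  define d where "d = (\<lambda>(a::'a, b::'a). norm (a - b) powr p)"
  \<comment> \<open>On \<open>A\<close> the two vectors differ, so \<open>\<Delta>\<close> has a
    positive minimum there; elsewhere on \<open>s z = 1\<close> the term \<open>\<epsilon>\<close>
    alone suffices.\<close>
  define A where "A = {z. s z = 1 \<and> \<epsilon> \<le> d z}"
  have cont: "continuous_on UNIV s" "continuous_on UNIV \<Delta>" "continuous_on UNIV d"
    unfolding s_def \<Delta>_def d_def split_beta
    using assms(1) by (auto intro!: continuous_intros continuous_on_powr')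
  have "closed A"
    unfolding A_def Collect_conj_eq using cont by (intro closed_Int closed_Collect_eq closed_Collect_le continuous_on_const) auto
  moreover have "A \<subseteq> cball 0 1 \<times> cball 0 1"
  proof clarify
    have le1: "norm v \<le> 1" if "norm v powr p \<le> 1" for v :: 'a
    proof (rule ccontr)
      assume "\<not> norm v \<le> 1"
      then have "1 powr p < norm v powr p" using assms(1) by (intro powr_less_mono2) auto
      then show False using that by simp
    qed
    fix a b :: 'a assume "(a, b) \<in> A"
    then have "norm a powr p + norm b powr p = 1" by (simp add: A_def s_def)
    moreover have "0 \<le> norm a powr p" "0 \<le> norm b powr p" by simp_all
    ultimately have "norm a powr p \<le> 1" "norm b powr p \<le> 1" by linarith+
    then show "a \<in> cball 0 1 \<and> b \<in> cball 0 1" using le1 by simp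
  qed
  ultimately have "compact A"
    by (metis bounded_Times bounded_cball bounded_subset compact_eq_bounded_closed)
  have \<Delta>0: "0 \<le> \<Delta> z" for z
    using norm_powr_midpoint[OF assms(1)] by (auto simp: \<Delta>_def split_beta)
  obtain K where "0 \<le> K" and K: "\<And>z. s z = 1 \<Longrightarrow> d z \<le> \<epsilon> + K * \<Delta> z"
  proof (cases "A = {}")
    case True
    have "d z \<le> \<epsilon> + 0 * \<Delta> z" if "s z = 1" for z
    proof -
      have "z \<notin> A" using True by simp
      then show ?thesis using that by (simp add: A_def)
    qed
    then show ?thesis using that[of 0] by blast
  next
    case False
    obtain z0 where z0: "z0 \<in> A" "\<And>z. z \<in> A \<Longrightarrow> \<Delta> z0 \<le> \<Delta> z"
      using continuous_attains_inf[OF \<open>compact A\<close> False continuous_on_subset[OF cont(2) subset_UNIV]] by auto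
    obtain z1 where z1: "z1 \<in> A" "\<And>z. z \<in> A \<Longrightarrow> d z \<le> d z1"
      using continuous_attains_sup[OF \<open>compact A\<close> False continuous_on_subset[OF cont(3) subset_UNIV]] by auto
    have "fst z0 \<noteq> snd z0" using z0(1) assms by (auto simp: A_def d_def split_beta)
    then have pos: "\<Delta> z0 > 0"
      using norm_powr_midpoint_strict[OF assms(1)] by (simp add: \<Delta>_def split_beta)
    have d0: "0 \<le> d z" for z by (simp add: d_def split_beta)
    \<comment> \<open>The constant is the maximum of \<open>d\<close> on \<open>A\<close> divided by
      the minimum of \<open>\<Delta>\<close> on \<open>A\<close>.\<close>
    have "d z \<le> \<epsilon> + d z1 / \<Delta> z0 * \<Delta> z" if "s z = 1" for z
    proof (cases "z \<in> A")
      case True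
      have "d z \<le> d z1 / \<Delta> z0 * \<Delta> z0" using z1 True pos by simp
      also have "\<dots> \<le> d z1 / \<Delta> z0 * \<Delta> z" using z0 True pos d0 by (intro mult_left_mono) auto
      finally show ?thesis using assms by simp
    next
      case False
      then have "d z < \<epsilon>" using that by (auto simp: A_def)
      moreover have "0 \<le> d z1 / \<Delta> z0 * \<Delta> z" using d0 pos \<Delta>0 by (intro mult_nonneg_nonneg) auto
      ultimately show ?thesis by simp
    qed
    then show ?thesis using that[of "d z1 / \<Delta> z0"] d0 pos by auto
  qed
  have "d z \<le> \<epsilon> * s z + K * \<Delta> z" for z
  proof (cases "s z = 0")
    case True
    then have "norm (fst z) powr p = 0" "norm (snd z) powr p = 0"
      using powr_ge_zero[of "norm (fst z)" p] powr_ge_zero[of "norm (snd z)" p]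
      unfolding s_def split_beta by linarith+
    then have "z = (0, 0)" by (simp add: prod_eq_iff)
    then show ?thesis by (simp add: d_def s_def \<Delta>_def)
  next
    case False
    then have "s z > 0" by (simp add: s_def split_beta order_less_le)
    \<comment> \<open>\<open>s\<close>, \<open>d\<close> and \<open>\<Delta>\<close> are homogeneous
      of degree \<open>p\<close>; dividing by \<open>r\<close> normalizes \<open>s\<close> to
      1.\<close>
    define r where "r = s z powr (1 / p)"
    have r: "r > 0" "r powr p = s z" using \<open>s z > 0\<close> assms(1) by (auto simp: r_def powr_powr)
    define w where "w = (fst z /\<^sub>R r, snd z /\<^sub>R r)"
    have z: "fst z = r *\<^sub>R fst w" "snd z = r *\<^sub>R snd w" using r by (simp_all add: w_def)
    have hom: "norm (r *\<^sub>R v) powr p = s z * norm v powr p" for v :: 'a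
      using r by (simp add: powr_mult)
    have "s z = s z * s w" using hom[of "fst w"] hom[of "snd w"]
      by (simp add: s_def split_beta z algebra_simps)
    then have "s w = 1" using \<open>s z > 0\<close> by simp
    have "d z = s z * d w"
      using hom[of "fst w - snd w"] by (simp add: d_def split_beta z scaleR_diff_right)
    moreover have "\<Delta> z = s z * \<Delta> w"
      using hom[of "fst w"] hom[of "snd w"] hom[of "(1/2) *\<^sub>R (fst w + snd w)"]
      by (simp add: \<Delta>_def split_beta z scaleR_add_right algebra_simps)
    ultimately show ?thesis
      using mult_left_mono[OF K[OF \<open>s w = 1\<close>], of "s z"] \<open>s z > 0\<close> by (simp add: algebra_simps)
  qed
  then show ?thesis using \<open>0 \<le> K\<close> by (intro that[of K]) (auto simp: d_def s_def \<Delta>_def)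
qed

text \<open>If \<open>x > s\<close>, write \<open>x = x powr (1 - p) * x powr p\<close>; the
  exponent \<open>1 - p\<close> is not positive, so the first factor grows when \<open>s\<close>
  replaces \<open>x\<close>. After integration the free \<open>s\<close> balances measure against
  p-th powers.\<close>

lemma le_add_powr:
  fixes x s p :: real
  assumes "1 \<le> p" "0 < s" "0 \<le> x"
  shows "x \<le> s + s powr (1 - p) * x powr p"
proof (cases "x \<le> s")
  case True
  then show ?thesis by (simp add: add_increasing2)
next
  case False
  then have "s powr (p - 1) \<le> x powr (p - 1)" using assms by (intro powr_mono2) auto
  then have "1 \<le> s powr (1 - p) * x powr (p - 1)"
    using assms mult_left_mono[of "s powr (p - 1)" "x powr (p - 1)" "s powr (1 - p)"]
    by (simp flip: powr_add)
  then have "x * 1 \<le> x * (s powr (1 - p) * x powr (p - 1))" using assms by (intro mult_left_mono) auto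
  also have "\<dots> = s powr (1 - p) * x powr p" using assms False by (simp add: powr_diff)
  finally show ?thesis using assms by simp
qed

section \<open>Lp on an interval through p-th powers of norms\<close>

locale Lp_interval =
  fixes p T :: real
  assumes p: "1 < p" and T: "0 < T"
begin

abbreviation "M \<equiv> lebesgue_on {0..T}"

text \<open>The p-th power instead of the norm: pointwise inequalities integrate directly, and
  convexity of the power at midpoints replaces Minkowski's inequality.\<close>

definition Lp_pow :: "(real \<Rightarrow> 'b::euclidean_space) \<Rightarrow> real" where
  "Lp_pow u = (LINT t|M. norm (u t) powr p)"

sublocale finite_measure M
  by (rule finite_measure_lebesgue_on) simp

lemma measure_space_M: "measure M (space M) = T"
  using T by (simp add: measure_restrict_space)

lemma Lp_pow_nonneg: "0 \<le> Lp_pow u"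
  unfolding Lp_pow_def by (rule Bochner_Integration.integral_nonneg) simp

lemma Lp_norm_eq: "Lp_norm p T u = Lp_pow u powr (1 / p)"
  by (simp add: Lp_norm_def Lp_pow_def)

lemma Lp_norm_powr: "Lp_norm p T u powr p = Lp_pow u"
  using p Lp_pow_nonneg[of u] by (simp add: Lp_norm_eq powr_powr)

lemma Lp_norm_nonneg: "0 \<le> Lp_norm p T u"
  by (simp add: Lp_norm_eq)

lemma Lp_norm_le_iff: "0 \<le> \<rho> \<Longrightarrow> Lp_norm p T u \<le> \<rho> \<longleftrightarrow> Lp_pow u \<le> \<rho> powr p"
  using p Lp_norm_nonneg[of u] powr_mono2[of p "Lp_norm p T u" \<rho>] powr_less_mono2[of p \<rho> "Lp_norm p T u"]
  unfolding Lp_norm_powr by (auto simp: not_le[symmetric])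

lemma Lp_measurable: "u \<in> Lp_space p T \<Longrightarrow> u \<in> borel_measurable M"
  and Lp_integrable_powr: "u \<in> Lp_space p T \<Longrightarrow> integrable M (\<lambda>t. norm (u t) powr p)"
  by (simp_all add: Lp_space_def)

lemma Lp_AE_cong:
  assumes "u \<in> Lp_space p T" "v \<in> borel_measurable M" "AE t in M. u t = v t"
  shows "v \<in> Lp_space p T" and "Lp_pow v = Lp_pow u"
proof -
  have [measurable]: "u \<in> borel_measurable M" "v \<in> borel_measurable M" using assms Lp_measurable by auto
  have ae: "AE t in M. norm (u t) powr p = norm (v t) powr p" using assms(3) by auto
  have "integrable M (\<lambda>t. norm (v t) powr p)"
    using Lp_integrable_powr[OF assms(1)] by (rule integrable_cong_AE_imp) (use ae in \<open>auto\<close>)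
  then show "v \<in> Lp_space p T" using assms(2) by (simp add: Lp_space_def)
  show "Lp_pow v = Lp_pow u" unfolding Lp_pow_def by (rule integral_cong_AE) (use ae in auto)
qed

lemma Lp_midpoint:
  assumes "u \<in> Lp_space p T" "v \<in> Lp_space p T"
  shows "(\<lambda>t. (1/2) *\<^sub>R (u t + v t)) \<in> Lp_space p T"
    and "Lp_pow (\<lambda>t. (1/2) *\<^sub>R (u t + v t)) \<le> (Lp_pow u + Lp_pow v) / 2"
proof -
  have [measurable]: "u \<in> borel_measurable M" "v \<in> borel_measurable M" using assms Lp_measurable by auto
  have i: "integrable M (\<lambda>t. (norm (u t) powr p + norm (v t) powr p) / 2)"
    using assms by (intro integrable_divide_zero Bochner_Integration.integrable_add Lp_integrable_powr)
  have j: "integrable M (\<lambda>t. norm ((1/2) *\<^sub>R (u t + v t)) powr p)"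
    by (rule Bochner_Integration.integrable_bound[OF i])
      (use norm_powr_midpoint[OF p] in \<open>auto intro!: AE_I2 order_trans[OF _ abs_ge_self]\<close>)
  then show "(\<lambda>t. (1/2) *\<^sub>R (u t + v t)) \<in> Lp_space p T" by (simp add: Lp_space_def)
  have "Lp_pow (\<lambda>t. (1/2) *\<^sub>R (u t + v t)) \<le> (LINT t|M. (norm (u t) powr p + norm (v t) powr p) / 2)"
    unfolding Lp_pow_def by (rule Bochner_Integration.integral_mono[OF j i]) (rule norm_powr_midpoint[OF p])
  also have "\<dots> = (Lp_pow u + Lp_pow v) / 2"
    unfolding Lp_pow_def using assms by (simp add: Lp_integrable_powr Bochner_Integration.integral_add)
  finally show "Lp_pow (\<lambda>t. (1/2) *\<^sub>R (u t + v t)) \<le> (Lp_pow u + Lp_pow v) / 2" .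
qed

lemma Lp_scaleR:
  assumes "u \<in> Lp_space p T"
  shows "(\<lambda>t. c *\<^sub>R u t) \<in> Lp_space p T" and "Lp_pow (\<lambda>t. c *\<^sub>R u t) = \<bar>c\<bar> powr p * Lp_pow u"
  using assms Lp_measurable[OF assms] by (auto simp: Lp_space_def Lp_pow_def powr_mult)

lemma Lp_add:
  assumes "u \<in> Lp_space p T" "v \<in> Lp_space p T"
  shows "(\<lambda>t. u t + v t) \<in> Lp_space p T"
  using Lp_scaleR(1)[OF Lp_midpoint(1)[OF assms], of 2] by simp

lemma Lp_diff:
  assumes "u \<in> Lp_space p T" "v \<in> Lp_space p T"
  shows "(\<lambda>t. u t - v t) \<in> Lp_space p T"
  using Lp_add[OF assms(1) Lp_scaleR(1)[OF assms(2), of "-1"]] by simp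

lemma Lp_pow_minus_commute: "Lp_pow (\<lambda>t. u t - v t) = Lp_pow (\<lambda>t. v t - u t)"
  by (simp add: Lp_pow_def norm_minus_commute)

lemma Lp_zero: "(\<lambda>t. 0) \<in> Lp_space p T"
  by (simp add: Lp_space_def)

lemma Lp_integrable:
  assumes "u \<in> Lp_space p T"
  shows "integrable M u"
proof -
  have [measurable]: "u \<in> borel_measurable M" using assms Lp_measurable by auto
  have "integrable M (\<lambda>t. 1 + norm (u t) powr p)"
    using assms by (intro Bochner_Integration.integrable_add Lp_integrable_powr) auto
  then show ?thesis
  proof (rule Bochner_Integration.integrable_bound)
    have "norm (u t) \<le> 1 + norm (u t) powr p" for t
      using le_add_powr[of p 1 "norm (u t)"] p by simp
    then show "AE t in M. norm (u t) \<le> norm (1 + norm (u t) powr p)"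
      by (intro AE_I2) (auto intro: order_trans[OF _ abs_ge_self])
  qed simp
qed

text \<open>This takes the place of Hoelder's inequality.\<close>

lemma Lp_integral_norm_le:
  assumes "u \<in> Lp_space p T" "0 < s" "A \<in> sets M"
  shows "(LINT t|M. indicator A t * norm (u t)) \<le> s * measure M A + s powr (1 - p) * Lp_pow u"
proof -
  have int: "integrable M (\<lambda>t. norm (u t))" using Lp_integrable[OF assms(1)] by simp
  have intA: "integrable M (indicat_real A)"
    using assms(3) sets.Int_space_eq2[OF assms(3)] emeasure_finite
    by (simp add: integrable_indicator_iff less_top[symmetric])
  have int2: "integrable M (\<lambda>t. s * indicator A t + s powr (1 - p) * norm (u t) powr p)"
    by (intro Bochner_Integration.integrable_add integrable_mult_right intA Lp_integrable_powr assms)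
  have "(LINT t|M. indicator A t * norm (u t)) \<le> (LINT t|M. s * indicator A t + s powr (1 - p) * norm (u t) powr p)"
  proof (rule Bochner_Integration.integral_mono[OF _ int2])
    show "integrable M (\<lambda>t. indicator A t * norm (u t))"
      using integrable_mult_indicator[OF assms(3) int] by simp
    show "indicator A t * norm (u t) \<le> s * indicator A t + s powr (1 - p) * norm (u t) powr p" for t
      using le_add_powr[of p s "norm (u t)"] p assms(2) by (auto simp: indicator_def)
  qed
  also have "\<dots> = s * measure M A + s powr (1 - p) * Lp_pow u"
    using assms(3) intA Lp_integrable_powr[OF assms(1)] sets.Int_space_eq2[OF assms(3)]
    by (subst Bochner_Integration.integral_add) (simp_all add: Lp_pow_def)
  finally show ?thesis .
qed

lemma Lp_L1_norm_le:
  assumes "u \<in> Lp_space p T" "0 < s"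
  shows "(LINT t|M. norm (u t)) \<le> s * T + s powr (1 - p) * Lp_pow u"
proof -
  have "(LINT t|M. norm (u t)) = (LINT t|M. indicator {0..T} t * norm (u t))"
    by (rule Bochner_Integration.integral_cong) auto
  then show ?thesis using Lp_integral_norm_le[OF assms, of "{0..T}"] T
    by (simp add: measure_restrict_space)
qed

text \<open>Fatou's lemma for p-th powers. An eventual bound is the form available in the Cauchy
  argument, where early terms of the subsequence are not controlled.\<close>

lemma Lp_Fatou:
  assumes v: "\<And>k. v k \<in> Lp_space p T" and w: "w \<in> borel_measurable M"
    and lim: "AE t in M. (\<lambda>k. v k t) \<longlonglongrightarrow> w t"
    and bound: "\<forall>\<^sub>F k in sequentially. Lp_pow (v k) \<le> C"
  shows "w \<in> Lp_space p T" and "Lp_pow w \<le> C"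
proof -
  have [measurable]: "v k \<in> borel_measurable M" for k using v Lp_measurable by auto
  note w[measurable]
  obtain k where "Lp_pow (v k) \<le> C" using bound by (auto simp: eventually_sequentially)
  then have C: "0 \<le> C" using Lp_pow_nonneg order_trans by blast
  have "(\<integral>\<^sup>+ t. ennreal (norm (w t) powr p) \<partial>M) = (\<integral>\<^sup>+ t. liminf (\<lambda>k. ennreal (norm (v k t) powr p)) \<partial>M)"
  proof (rule nn_integral_cong_AE, use lim in eventually_elim)
    fix t assume "(\<lambda>k. v k t) \<longlonglongrightarrow> w t"
    then have "(\<lambda>k. ennreal (norm (v k t) powr p)) \<longlonglongrightarrow> ennreal (norm (w t) powr p)"
      using p by (intro tendsto_intros tendsto_ennrealI tendsto_powr') auto
    then show "ennreal (norm (w t) powr p) = liminf (\<lambda>k. ennreal (norm (v k t) powr p))"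
      by (rule lim_imp_Liminf[OF trivial_limit_sequentially, symmetric])
  qed
  also have "\<dots> \<le> liminf (\<lambda>k. \<integral>\<^sup>+ t. ennreal (norm (v k t) powr p) \<partial>M)"
    by (rule nn_integral_liminf) simp
  also have "\<dots> = liminf (\<lambda>k. ennreal (Lp_pow (v k)))"
    unfolding Lp_pow_def by (subst nn_integral_eq_integral) (auto intro: Lp_integrable_powr v)
  also have "\<dots> \<le> liminf (\<lambda>k. ennreal C)"
    by (rule Liminf_mono) (use bound in \<open>auto elim!: eventually_mono intro: ennreal_leI\<close>)
  finally have le: "(\<integral>\<^sup>+ t. ennreal (norm (w t) powr p) \<partial>M) \<le> ennreal C" by (simp add: Liminf_const)
  have int: "integrable M (\<lambda>t. norm (w t) powr p)"
    by (rule integrableI_bounded) (use le in \<open>auto intro: order_le_less_trans\<close>)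
  then show "w \<in> Lp_space p T" by (simp add: Lp_space_def)
  have "ennreal (Lp_pow w) = (\<integral>\<^sup>+ t. ennreal (norm (w t) powr p) \<partial>M)"
    unfolding Lp_pow_def by (rule nn_integral_eq_integral[symmetric, OF int]) simp
  with le have "ennreal (Lp_pow w) \<le> ennreal C" by (simp only:)
  with C show "Lp_pow w \<le> C" by (simp add: ennreal_le_iff)
qed

text \<open>Riesz-Fischer: a fast subsequence has increments with summable integrals and so
  converges almost everywhere; Fatou's lemma turns the Cauchy condition into convergence. The last
  clause keeps the limit in the ball.\<close>

theorem Lp_complete:
  assumes u: "\<And>n. u n \<in> Lp_space p T"
    and cauchy: "\<And>e. 0 < e \<Longrightarrow> \<exists>n0. \<forall>m\<ge>n0. \<forall>n\<ge>n0. Lp_pow (\<lambda>t. u m t - u n t) \<le> e"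
  obtains w where "w \<in> Lp_space p T" "(\<lambda>n. Lp_pow (\<lambda>t. u n t - w t)) \<longlonglongrightarrow> 0"
    "\<And>C. (\<And>n. Lp_pow (u n) \<le> C) \<Longrightarrow> Lp_pow w \<le> C"
proof -
  have [measurable]: "u n \<in> borel_measurable M" for n using u Lp_measurable by auto
  \<comment> \<open>The threshold fits \<open>s = (1/2) ^ k\<close> in \<open>Lp_L1_norm_le\<close>:
    both terms there become multiples of \<open>(1/2) ^ k\<close>.\<close>
  have "\<forall>k::nat. \<exists>n0. \<forall>m\<ge>n0. \<forall>n\<ge>n0. Lp_pow (\<lambda>t. u m t - u n t) \<le> ((1/2) ^ k) powr p"
    by (intro allI cauchy) simp
  then obtain g where g: "\<And>k m n. m \<ge> g k \<Longrightarrow> n \<ge> g k \<Longrightarrow> Lp_pow (\<lambda>t. u m t - u n t) \<le> ((1/2) ^ k) powr p"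
    by metis
  \<comment> \<open>Summing the thresholds makes \<open>r\<close> strictly increasing while
    \<open>r k\<close> stays above \<open>g k\<close>.\<close>
  define r where "r = (\<lambda>k. (\<Sum>i\<le>k. g i) + k)"
  have rg: "g k \<le> r k" for k unfolding r_def by (simp add: member_le_sum trans_le_add1)
  have "strict_mono r" unfolding strict_mono_Suc_iff by (simp add: r_def)
  then have r: "r k \<ge> k" "r k \<le> r (Suc k)" for k
    by (simp_all add: seq_suble strict_mono_less_eq)
  define d where "d = (\<lambda>k t. u (r (Suc k)) t - u (r k) t)"
  have d: "d k \<in> Lp_space p T" for k unfolding d_def by (intro Lp_diff u)
  have [measurable]: "d k \<in> borel_measurable M" for k using d Lp_measurable by auto
  have dint: "(LINT t|M. norm (d k t)) \<le> (1/2) ^ k * (T + 1)" for k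
  proof -
    have "(LINT t|M. norm (d k t)) \<le> (1/2) ^ k * T + ((1/2) ^ k) powr (1 - p) * Lp_pow (d k)"
      by (rule Lp_L1_norm_le[OF d]) simp
    also have "\<dots> \<le> (1/2) ^ k * T + ((1/2) ^ k) powr (1 - p) * ((1/2) ^ k) powr p"
      unfolding d_def using rg[of k] r[of k] by (intro add_left_mono mult_left_mono g[of k]) auto
    also have "\<dots> = (1/2) ^ k * (T + 1)" by (simp add: algebra_simps flip: powr_add)
    finally show ?thesis .
  qed
  have "(\<integral>\<^sup>+ t. (\<Sum>k. ennreal (norm (d k t))) \<partial>M) = (\<Sum>k. \<integral>\<^sup>+ t. ennreal (norm (d k t)) \<partial>M)"
    by (rule nn_integral_suminf) simp
  also have "\<dots> = (\<Sum>k. ennreal (LINT t|M. norm (d k t)))"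
    using Lp_integrable[OF d] by (subst nn_integral_eq_integral) auto
  also have "\<dots> \<le> (\<Sum>k. ennreal ((1/2) ^ k * (T + 1)))"
    by (intro suminf_le ennreal_leI dint) auto
  also have "\<dots> < \<infinity>"
  proof -
    have "summable (\<lambda>k. (1/2 :: real) ^ k * (T + 1))" by (intro summable_mult2 summable_geometric) simp
    then show ?thesis using T by (subst suminf_ennreal2) (auto simp: less_top[symmetric])
  qed
  finally have fin: "(\<integral>\<^sup>+ t. (\<Sum>k. ennreal (norm (d k t))) \<partial>M) \<noteq> \<infinity>" by simp
  have "AE t in M. (\<Sum>k. ennreal (norm (d k t))) \<noteq> \<infinity>"
    by (rule nn_integral_PInf_AE[OF _ fin]) simp
  then have conv: "AE t in M. convergent (\<lambda>k. u (r k) t)"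
  proof eventually_elim
    fix t assume "(\<Sum>k. ennreal (norm (d k t))) \<noteq> \<infinity>"
    then have "summable (\<lambda>k. norm (d k t))" by (intro summable_suminf_not_top) auto
    then have "summable (\<lambda>k. d k t)" by (rule summable_norm_cancel)
    then have "convergent (\<lambda>k. \<Sum>i<k. d i t)" by (simp add: summable_iff_convergent)
    moreover have "(\<Sum>i<k. d i t) = u (r k) t - u (r 0) t" for k
      unfolding d_def by (rule sum_lessThan_telescope)
    ultimately have "convergent (\<lambda>k. (u (r k) t - u (r 0) t) + u (r 0) t)"
      by (intro convergent_add convergent_const) simp
    then show "convergent (\<lambda>k. u (r k) t)" by simp
  qed
  define w where "w = (\<lambda>t. lim (\<lambda>k. u (r k) t))"
  have [measurable]: "w \<in> borel_measurable M" unfolding w_def by measurable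
  have lim: "AE t in M. (\<lambda>k. u (r k) t) \<longlonglongrightarrow> w t"
    using conv by eventually_elim (simp add: w_def convergent_LIMSEQ_iff)
  have ev: "\<forall>\<^sub>F k in sequentially. Lp_pow (\<lambda>t. u n t - u (r k) t) \<le> e"
    if "\<forall>m\<ge>n0. \<forall>n\<ge>n0. Lp_pow (\<lambda>t. u m t - u n t) \<le> e" "n \<ge> n0" for n n0 e
    using that r(1) by (intro eventually_sequentiallyI[of n0]) (meson order_trans)
  \<comment> \<open>For fixed \<open>n\<close> the other index tends to infinity along the
    subsequence.\<close>
  have near: "(\<lambda>t. u n t - w t) \<in> Lp_space p T \<and> Lp_pow (\<lambda>t. u n t - w t) \<le> e"
    if "\<forall>m\<ge>n0. \<forall>n\<ge>n0. Lp_pow (\<lambda>t. u m t - u n t) \<le> e" "n \<ge> n0" for n n0 e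
  proof -
    have l: "AE t in M. (\<lambda>k. u n t - u (r k) t) \<longlonglongrightarrow> u n t - w t"
      using lim by eventually_elim (intro tendsto_intros)
    show ?thesis
      using Lp_Fatou[of "\<lambda>k t. u n t - u (r k) t" "\<lambda>t. u n t - w t", OF Lp_diff[OF u u] _ l ev[OF that]] by simp
  qed
  obtain n0 where "\<forall>m\<ge>n0. \<forall>n\<ge>n0. Lp_pow (\<lambda>t. u m t - u n t) \<le> 1" using cauchy[of 1] by auto
  from near[OF this order_refl] have "(\<lambda>t. u n0 t - w t) \<in> Lp_space p T" ..
  from Lp_diff[OF u[of n0] this] have "w \<in> Lp_space p T" by simp
  moreover have "(\<lambda>n. Lp_pow (\<lambda>t. u n t - w t)) \<longlonglongrightarrow> 0"
  proof (rule LIMSEQ_I)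
    fix e :: real assume "e > 0"
    then obtain n0 where n0: "\<forall>m\<ge>n0. \<forall>n\<ge>n0. Lp_pow (\<lambda>t. u m t - u n t) \<le> e / 2" using cauchy[of "e / 2"] by auto
    have "norm (Lp_pow (\<lambda>t. u n t - w t) - 0) < e" if "n \<ge> n0" for n
      using near[OF n0 that] Lp_pow_nonneg[of "\<lambda>t. u n t - w t"] \<open>e > 0\<close> by simp
    then show "\<exists>n0. \<forall>n\<ge>n0. norm (Lp_pow (\<lambda>t. u n t - w t) - 0) < e" by blast
  qed
  moreover have "Lp_pow w \<le> C" if "\<And>n. Lp_pow (u n) \<le> C" for C
    using that by (intro Lp_Fatou(2)[OF u[of "r k" for k] _ lim]) auto
  ultimately show ?thesis by (rule that)
qed

end

section \<open>Weak compactness of balls in Lp\<close>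

text \<open>The dyadic convex combinations of \<open>U\<close>: midpoints are the only combinations
  that the uniform convexity estimate compares.\<close>

inductive_set midpoint_hull :: "(real \<Rightarrow> 'b::real_vector) set \<Rightarrow> (real \<Rightarrow> 'b) set" for U where
  base: "u \<in> U \<Longrightarrow> u \<in> midpoint_hull U"
| midpoint: "v \<in> midpoint_hull U \<Longrightarrow> w \<in> midpoint_hull U \<Longrightarrow>
    (\<lambda>t. (1/2) *\<^sub>R (v t + w t)) \<in> midpoint_hull U"

lemma midpoint_hull_mono:
  assumes "U \<subseteq> V"
  shows "midpoint_hull U \<subseteq> midpoint_hull V"
proof
  fix u assume "u \<in> midpoint_hull U"
  then show "u \<in> midpoint_hull V"
    by induction (use assms in \<open>auto intro: midpoint_hull.intros\<close>)
qed

context Lp_interval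
begin

lemma midpoint_hull_Lp:
  assumes "u \<in> midpoint_hull U" "\<And>u. u \<in> U \<Longrightarrow> u \<in> Lp_space p T \<and> Lp_pow u \<le> R"
  shows "u \<in> Lp_space p T \<and> Lp_pow u \<le> R"
  using assms(1)
proof induction
  case (midpoint v w)
  then show ?case using Lp_midpoint[of v w] by simp
qed (use assms(2) in auto)

text \<open>A substitute for Mazur's lemma that needs no separation theorem: nearly minimizing \<open>Lp_pow\<close> over
  the hulls of the tails gives a Cauchy sequence, by uniform convexity.\<close>

theorem midpoint_hull_strong_convergence:
  assumes u: "\<And>n. u n \<in> Lp_space p T" "\<And>n. Lp_pow (u n) \<le> R"
  obtains y w where "w \<in> Lp_space p T" "Lp_pow w \<le> R" "\<forall>n. y n \<in> midpoint_hull (u ` {n..})"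
    "\<forall>n. y n \<in> Lp_space p T" "(\<lambda>n. Lp_pow (\<lambda>t. y n t - w t)) \<longlonglongrightarrow> 0"
proof -
  define H where "H = (\<lambda>n. midpoint_hull (u ` {n..}))"
  have H: "v \<in> Lp_space p T" "Lp_pow v \<le> R" if "v \<in> H n" for v n
    using midpoint_hull_Lp[OF that[unfolded H_def], of R] u by auto
  have Hmono: "H n \<subseteq> H m" if "m \<le> n" for m n
    unfolding H_def by (rule midpoint_hull_mono) (use that in auto)
  have Hne: "H n \<noteq> {}" for n using midpoint_hull.base[of "u n" "u ` {n..}"] by (auto simp: H_def)
  \<comment> \<open>The hulls shrink, so these infima increase; they are bounded by
    \<open>R\<close>, and their convergence is what makes near-minimizers a Cauchy sequence.\<close>
  define i where "i = (\<lambda>n. INF v\<in>H n. Lp_pow v)"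
  have bdd: "bdd_below (Lp_pow ` H n)" for n by (rule bdd_belowI[of _ 0]) (auto simp: Lp_pow_nonneg)
  have i_le: "i n \<le> Lp_pow v" if "v \<in> H n" for v n unfolding i_def by (intro cINF_lower bdd that)
  have "incseq i"
    unfolding i_def using Hmono by (intro incseq_SucI cINF_superset_mono bdd Hne) auto
  have iR: "i n \<le> R" for n using Hne[of n] i_le[of _ n] H(2)[of _ n] by (meson ex_in_conv order_trans)
  have "convergent i"
    using \<open>incseq i\<close> iR by (intro Bseq_mono_convergent incseq_bounded)
      (auto simp: incseq_def monoD intro: incseqD)
  then have iC: "Cauchy i" by (rule convergent_Cauchy)
  have "\<exists>v\<in>H n. Lp_pow v < i n + inverse (Suc n)" for n
    using cINF_less_iff[OF Hne bdd, of n "i n + inverse (Suc n)"] by (simp add: i_def)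
  then obtain y where yH: "\<And>n. y n \<in> H n" and y: "\<And>n. Lp_pow (y n) < i n + inverse (Suc n)" by metis
  have yL: "y n \<in> Lp_space p T" for n using H yH by blast
  have "\<exists>n0. \<forall>m\<ge>n0. \<forall>n\<ge>n0. Lp_pow (\<lambda>t. y m t - y n t) \<le> e" if "e > 0" for e
  proof -
    have "R \<ge> 0" using Lp_pow_nonneg u(2) order_trans by blast
    \<comment> \<open>Together with \<open>\<delta>\<close> below this makes
      \<open>\<epsilon> * (R + R)\<close> and \<open>K * (2 * \<delta>)\<close> at most
      \<open>e / 2\<close> each.\<close>
    define \<epsilon> where "\<epsilon> = e / (4 * R + 1)"
    have "\<epsilon> > 0" using \<open>e > 0\<close> \<open>R \<ge> 0\<close> by (simp add: \<epsilon>_def)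
    obtain K where "0 \<le> K" and K: "\<And>a b :: 'a. norm (a - b) powr p \<le> \<epsilon> * (norm a powr p + norm b powr p) +
       K * ((norm a powr p + norm b powr p) / 2 - norm ((1/2) *\<^sub>R (a + b)) powr p)"
      using norm_powr_uniformly_convex[OF p \<open>\<epsilon> > 0\<close>] by blast
    define \<delta> where "\<delta> = e / (4 * K + 1)"
    have "\<delta> > 0" using \<open>e > 0\<close> \<open>K \<ge> 0\<close> by (simp add: \<delta>_def)
    obtain n1 where n1: "\<And>m n. m \<ge> n1 \<Longrightarrow> n \<ge> n1 \<Longrightarrow> dist (i m) (i n) < \<delta>"
      using iC \<open>\<delta> > 0\<close> unfolding Cauchy_def by blast
    obtain n2 :: nat where n2: "inverse (Suc n2) < \<delta>" using reals_Archimedean[OF \<open>\<delta> > 0\<close>] by blast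
    have main: "Lp_pow (\<lambda>t. y m t - y n t) \<le> e" if mn: "max n1 n2 \<le> n" "n \<le> m" for m n
    proof -
      have [measurable]: "y k \<in> borel_measurable M" for k using yL Lp_measurable by auto
      have iy: "integrable M (\<lambda>t. norm (y k t) powr p)" for k by (rule Lp_integrable_powr[OF yL])
      have imid: "integrable M (\<lambda>t. norm ((1/2) *\<^sub>R (y m t + y n t)) powr p)"
        by (rule Lp_integrable_powr[OF Lp_midpoint(1)[OF yL yL]])
      define mid where "mid = (\<lambda>t. (1/2) *\<^sub>R (y m t + y n t))"
      \<comment> \<open>Membership in the larger hull bounds the p-th power of the midpoint below by
        \<open>i n\<close>, while those of \<open>y m\<close> and \<open>y n\<close> are close to
        \<open>i n\<close>: the convexity defect is small.\<close>
      have "mid \<in> H n"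
        using yH[of n] yH[of m] Hmono[OF mn(2)] unfolding mid_def H_def by (auto intro: midpoint_hull.midpoint)
      then have midle: "i n \<le> Lp_pow mid" by (rule i_le)
      have "Lp_pow (\<lambda>t. y m t - y n t) \<le> (LINT t|M. \<epsilon> * (norm (y m t) powr p + norm (y n t) powr p) +
         K * ((norm (y m t) powr p + norm (y n t) powr p) / 2 - norm ((1/2) *\<^sub>R (y m t + y n t)) powr p))"
        unfolding Lp_pow_def
        by (intro Bochner_Integration.integral_mono K Bochner_Integration.integrable_add integrable_mult_right
            Bochner_Integration.integrable_diff integrable_divide_zero iy imid
            Lp_integrable_powr[OF Lp_diff[OF yL yL]])
      also have "\<dots> = \<epsilon> * (Lp_pow (y m) + Lp_pow (y n)) + K * ((Lp_pow (y m) + Lp_pow (y n)) / 2 - Lp_pow mid)"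
        using imid unfolding Lp_pow_def mid_def by (simp add: iy)
      also have "\<dots> \<le> \<epsilon> * (R + R) + K * (2 * \<delta>)"
      proof (intro add_mono mult_left_mono)
        have "i m < i n + \<delta>" using n1[of m n] mn by (auto simp: dist_real_def)
        moreover have "Lp_pow (y k) < i k + \<delta>" if "k \<ge> n2" for k
        proof -
          have "inverse (real (Suc k)) \<le> inverse (real (Suc n2))"
            using that by (intro le_imp_inverse_le) auto
          then have "inverse (real (Suc k)) < \<delta>" using n2 by (rule order_le_less_trans)
          with y[of k] show ?thesis by (meson add_strict_left_mono order_less_trans)
        qed
        then have "Lp_pow (y m) < i m + \<delta>" "Lp_pow (y n) < i n + \<delta>" using mn by auto
        ultimately show "(Lp_pow (y m) + Lp_pow (y n)) / 2 - Lp_pow mid \<le> 2 * \<delta>"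
          using midle \<open>\<delta> > 0\<close> by argo
      qed (use H(2) yH \<open>0 \<le> K\<close> \<open>\<epsilon> > 0\<close> in auto)
      also have "\<dots> \<le> e / 2 + e / 2"
      proof (intro add_mono)
        show "\<epsilon> * (R + R) \<le> e / 2" using \<open>R \<ge> 0\<close> \<open>e > 0\<close> by (simp add: \<epsilon>_def field_simps)
        show "K * (2 * \<delta>) \<le> e / 2" using \<open>K \<ge> 0\<close> \<open>e > 0\<close> by (simp add: \<delta>_def field_simps)
      qed
      finally show ?thesis by simp
    qed
    have "Lp_pow (\<lambda>t. y m t - y n t) \<le> e" if "max n1 n2 \<le> n" "max n1 n2 \<le> m" for m n
      using main[OF that(1), of m] main[OF that(2), of n] Lp_pow_minus_commute[of "y m" "y n"]
      by (cases "n \<le> m") auto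
    then show ?thesis by blast
  qed
  from Lp_complete[OF yL this] obtain w
    where w: "w \<in> Lp_space p T" "(\<lambda>n. Lp_pow (\<lambda>t. y n t - w t)) \<longlonglongrightarrow> 0"
      "\<And>C. (\<And>n. Lp_pow (y n) \<le> C) \<Longrightarrow> Lp_pow w \<le> C" by blast
  have "Lp_pow w \<le> R" by (rule w(3)) (rule H(2)[OF yH])
  show ?thesis
    by (rule that[OF w(1) \<open>Lp_pow w \<le> R\<close> _ _ w(2)]) (use yL yH in \<open>simp_all add: H_def\<close>)
qed

end

lemma AE_lebesgue_on_negligible:
  assumes "negligible Z" "S \<in> sets lebesgue" "\<And>t. t \<in> S - Z \<Longrightarrow> P t"
  shows "AE t in lebesgue_on S. P t"
proof -
  have "AE t in lebesgue. t \<notin> Z"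
    using assms(1) by (intro AE_not_in) (simp add: negligible_iff_null_sets)
  then show ?thesis
    using assms(2,3) by (subst AE_restrict_space_iff) auto
qed

section \<open>Integrals over subintervals and bounded functionals on Lp\<close>

context Lp_interval
begin

lemma borel_measurable_indicator_Icc: "indicat_real {a..b} \<in> borel_measurable M"
  by (intro measurable_restrict_space1 borel_measurable_indicator) simp

lemma integrable_indicator_Icc:
  fixes u :: "real \<Rightarrow> 'b::euclidean_space"
  assumes "integrable M u"
  shows "integrable M (\<lambda>t. indicat_real {a..b} t *\<^sub>R u t)"
proof (rule Bochner_Integration.integrable_bound[OF assms])
  show "(\<lambda>t. indicat_real {a..b} t *\<^sub>R u t) \<in> borel_measurable M"
    by (intro borel_measurable_scaleR borel_measurable_indicator_Icc borel_measurable_integrable assms)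
qed (auto simp: indicator_def)

lemma LINT_eq_integral:
  fixes u :: "real \<Rightarrow> 'b::euclidean_space"
  assumes "integrable M u" "0 \<le> a" "b \<le> T"
  shows "(LINT t|M. indicat_real {a..b} t *\<^sub>R u t) = integral {a..b} u"
proof -
  have "integrable M (\<lambda>t. indicat_real {a..b} t *\<^sub>R u t)"
    by (rule integrable_indicator_Icc[OF assms(1)])
  then have "(LINT t|M. indicat_real {a..b} t *\<^sub>R u t) = integral {0..T} (\<lambda>t. indicat_real {a..b} t *\<^sub>R u t)"
    by (rule lebesgue_integral_eq_integral) simp
  also have "\<dots> = integral {0..T} (\<lambda>t. if t \<in> {a..b} then u t else 0)"
    by (intro Henstock_Kurzweil_Integration.integral_cong) (auto simp: indicator_def)
  also have "\<dots> = integral ({a..b} \<inter> {0..T}) u" by (rule integral_restrict_Int)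
  also have "{a..b} \<inter> {0..T} = {a..b}" using assms by auto
  finally show ?thesis .
qed

lemma integrable_iff_absolutely_integrable:
  fixes u :: "real \<Rightarrow> 'b::euclidean_space"
  shows "integrable M u \<longleftrightarrow> u absolutely_integrable_on {0..T}"
  unfolding set_integrable_def by (subst integrable_restrict_space) auto

text \<open>The primitive is continuous and vanishes at rational times, hence on the open interval,
  while its derivative is \<open>u\<close> almost everywhere. End points are discarded so that
  derivatives are two-sided and unique.\<close>

lemma AE_eq_0_if_integral_eq_0:
  fixes u :: "real \<Rightarrow> 'b::euclidean_space"
  assumes u: "integrable M u" and zero: "\<And>s. s \<in> \<rat> \<Longrightarrow> 0 \<le> s \<Longrightarrow> s \<le> T \<Longrightarrow> integral {0..s} u = 0"
  shows "AE t in M. u t = 0"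
proof -
  have ui: "u integrable_on {0..T}" using u by (simp add: integrable_on_lebesgue_on)
  define G where "G = (\<lambda>t. integral {0..t} u)"
  have contG: "continuous_on {0..T} G" unfolding G_def by (rule indefinite_integral_continuous_1[OF ui])
  have G0: "G t = 0" if t: "t \<in> {0<..<T}" for t
  proof (rule ccontr)
    assume "G t \<noteq> 0"
    then obtain \<delta> where "\<delta> > 0" and \<delta>: "\<And>s. s \<in> {0..T} \<Longrightarrow> dist s t < \<delta> \<Longrightarrow> dist (G s) (G t) < norm (G t)"
      using contG[unfolded continuous_on_iff, rule_format, of t "norm (G t)"] t by auto
    obtain s where s: "s \<in> \<rat>" "max 0 (t - \<delta>) < s" "s < t"
      using Rats_dense_in_real[of "max 0 (t - \<delta>)" t] t \<open>\<delta> > 0\<close> by auto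
    then have "dist (G s) (G t) < norm (G t)" using t by (intro \<delta>) (auto simp: dist_real_def)
    moreover have "G s = 0" unfolding G_def using s t by (intro zero) auto
    ultimately show False by simp
  qed
  obtain Z where Z: "negligible Z" "\<And>x. x \<in> {0..T} - Z \<Longrightarrow> (G has_vector_derivative u x) (at x within {0..T})"
    using indefinite_integral_has_vector_derivative_ae[OF ui] unfolding G_def by blast
  have "negligible (Z \<union> {0, T})" using Z(1) by (intro negligible_Un) auto
  then show ?thesis
  proof (rule AE_lebesgue_on_negligible)
    fix t assume t: "t \<in> {0..T} - (Z \<union> {0, T})"
    then have t': "t \<in> {0<..<T}" by auto
    have "(G has_vector_derivative u t) (at t within {0<..<T})"
      by (rule has_vector_derivative_within_subset[OF Z(2)]) (use t in auto)
    then have "(G has_vector_derivative u t) (at t)"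
      using t' by (simp add: at_within_open[of t "{0<..<T}"])
    moreover have "(G has_vector_derivative 0) (at t)"
      by (rule has_vector_derivative_transform_within_open[of "\<lambda>_. 0" 0 t "{0<..<T}"])
        (use t' G0 in auto)
    ultimately show "u t = 0" by (rule vector_derivative_unique_at)
  qed simp
qed

lemma Lp_dualD:
  assumes "\<phi> \<in> Lp_dual p T"
  shows "u \<in> Lp_space p T \<Longrightarrow> v \<in> Lp_space p T \<Longrightarrow> \<phi> (\<lambda>t. u t + v t) = \<phi> u + \<phi> v"
    and "u \<in> Lp_space p T \<Longrightarrow> \<phi> (\<lambda>t. c *\<^sub>R u t) = c * \<phi> u"
    and "\<exists>B. \<forall>u\<in>Lp_space p T. \<bar>\<phi> u\<bar> \<le> B * Lp_norm p T u"
  using assms by (auto simp: Lp_dual_def)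

lemma Lp_dual_diff:
  assumes "\<phi> \<in> Lp_dual p T" "u \<in> Lp_space p T" "v \<in> Lp_space p T"
  shows "\<phi> (\<lambda>t. u t - v t) = \<phi> u - \<phi> v"
  using Lp_dualD(1)[OF assms(1,2) Lp_scaleR(1)[OF assms(3), of "-1"]] Lp_dualD(2)[OF assms(1,3), of "-1"]
  by simp

lemma Lp_dual_uminus:
  assumes "\<phi> \<in> Lp_dual p T"
  shows "(\<lambda>u. - \<phi> u) \<in> Lp_dual p T"
  using assms by (simp add: Lp_dual_def)

lemma Lp_dual_tendsto:
  assumes \<phi>: "\<phi> \<in> Lp_dual p T" and "\<And>n. y n \<in> Lp_space p T" "w \<in> Lp_space p T"
    and lim: "(\<lambda>n. Lp_pow (\<lambda>t. y n t - w t)) \<longlonglongrightarrow> 0"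
  shows "(\<lambda>n. \<phi> (y n)) \<longlonglongrightarrow> \<phi> w"
proof -
  obtain B where B: "\<And>u. u \<in> Lp_space p T \<Longrightarrow> \<bar>\<phi> u\<bar> \<le> B * Lp_norm p T u"
    using Lp_dualD(3)[OF \<phi>] by blast
  have "(\<lambda>n. Lp_pow (\<lambda>t. y n t - w t) powr (1 / p)) \<longlonglongrightarrow> 0 powr (1 / p)"
    using p Lp_pow_nonneg by (intro tendsto_powr' lim tendsto_const) (auto intro!: always_eventually)
  then have "(\<lambda>n. B * Lp_norm p T (\<lambda>t. y n t - w t)) \<longlonglongrightarrow> 0"
    using p by (auto simp: Lp_norm_eq intro: tendsto_mult_right_zero)
  then have "(\<lambda>n. \<phi> (y n) - \<phi> w) \<longlonglongrightarrow> 0"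
  proof (rule Lim_null_comparison[rotated])
    show "\<forall>\<^sub>F n in sequentially. norm (\<phi> (y n) - \<phi> w) \<le> B * Lp_norm p T (\<lambda>t. y n t - w t)"
      using B[OF Lp_diff] assms Lp_dual_diff[OF \<phi>] by (intro always_eventually) auto
  qed
  then show ?thesis by (simp add: LIM_zero_iff)
qed

text \<open>The difference has norm 0, so boundedness makes \<open>\<phi>\<close> vanish on
  it.\<close>

lemma Lp_dual_AE_cong:
  assumes \<phi>: "\<phi> \<in> Lp_dual p T" and uv: "u \<in> Lp_space p T" "v \<in> Lp_space p T" and "AE t in M. u t = v t"
  shows "\<phi> u = \<phi> v"
proof -
  have "AE t in M. 0 = u t - v t" using assms(4) by eventually_elim simp
  then have "Lp_pow (\<lambda>t. u t - v t) = Lp_pow (\<lambda>t. 0 :: 'a)"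
    using Lp_AE_cong(2)[OF Lp_zero Lp_measurable[OF Lp_diff[OF uv]]] by blast
  then have "Lp_norm p T (\<lambda>t. u t - v t) = 0" using p by (simp add: Lp_norm_eq Lp_pow_def)
  then have "\<phi> (\<lambda>t. u t - v t) = 0"
    using Lp_dualD(3)[OF \<phi>] Lp_diff[OF uv] by fastforce
  then show ?thesis using Lp_dual_diff[OF \<phi> uv] by simp
qed

text \<open>These functionals test weak convergence for rational primitives, control terms and
  affine minorants. Their bound comes from \<open>Lp_L1_norm_le\<close> with \<open>s\<close> equal
  to the norm of \<open>u\<close>.\<close>

lemma Lp_dual_integral:
  fixes g :: "real \<Rightarrow> 'b::euclidean_space"
  assumes g: "g \<in> borel_measurable M" "\<And>t. t \<in> {0..T} \<Longrightarrow> norm (g t) \<le> B"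
  shows "(\<lambda>u. LINT t|M. g t \<bullet> u t) \<in> Lp_dual p T"
    and "u \<in> Lp_space p T \<Longrightarrow> integrable M (\<lambda>t. g t \<bullet> u t)"
proof -
  have B: "0 \<le> B" using g(2)[of 0] T by (auto intro: order_trans[OF norm_ge_zero])
  have le: "norm (g t \<bullet> u t) \<le> B * norm (u t)" if "t \<in> {0..T}" for u t
    using Cauchy_Schwarz_ineq2[of "g t" "u t"] mult_right_mono[OF g(2)[OF that], of "norm (u t)"] by simp
  have int: "integrable M (\<lambda>t. g t \<bullet> u t)" if u: "u \<in> Lp_space p T" for u
  proof (rule Bochner_Integration.integrable_bound)
    show "integrable M (\<lambda>t. B * norm (u t))" using Lp_integrable[OF u] by simp
    show "(\<lambda>t. g t \<bullet> u t) \<in> borel_measurable M" using g Lp_measurable[OF u] by simp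
    show "AE t in M. norm (g t \<bullet> u t) \<le> norm (B * norm (u t))"
      using le B by (intro AE_I2) simp
  qed
  then show "u \<in> Lp_space p T \<Longrightarrow> integrable M (\<lambda>t. g t \<bullet> u t)" by blast
  have bound: "\<bar>LINT t|M. g t \<bullet> u t\<bar> \<le> (B * (T + 1)) * Lp_norm p T u" if u: "u \<in> Lp_space p T" for u
  proof -
    have L: "(LINT t|M. norm (u t)) \<le> (T + 1) * Lp_norm p T u"
    \<comment> \<open>A zero norm is not an admissible \<open>s\<close>; arbitrarily small values
      \<open>e / T\<close> take its place.\<close>
    proof (cases "Lp_norm p T u = 0")
      case True
      then have "Lp_pow u = 0" using p by (simp add: Lp_norm_powr[symmetric])
      have "(LINT t|M. norm (u t)) \<le> 0"
      proof (rule field_le_epsilon)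
        fix e :: real assume "e > 0"
        then show "(LINT t|M. norm (u t)) \<le> 0 + e"
          using Lp_L1_norm_le[OF u, of "e / T"] T \<open>Lp_pow u = 0\<close> by simp
      qed
      then show ?thesis using True by simp
    next
      case False
      define s where "s = Lp_norm p T u"
      have s: "s > 0" using False Lp_norm_nonneg[of u] by (simp add: s_def)
      have "(LINT t|M. norm (u t)) \<le> s * T + s powr (1 - p) * s powr p"
        using Lp_L1_norm_le[OF u s] by (simp add: s_def Lp_norm_powr)
      then show ?thesis using s by (simp add: s_def[symmetric] algebra_simps flip: powr_add)
    qed
    have "\<bar>LINT t|M. g t \<bullet> u t\<bar> \<le> (LINT t|M. B * norm (u t))"
      using Bochner_Integration.integral_norm_bound_integral[OF int[OF u], of "\<lambda>t. B * norm (u t)"]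
        Lp_integrable[OF u] le by simp
    also have "\<dots> = B * (LINT t|M. norm (u t))" by simp
    also have "\<dots> \<le> B * ((T + 1) * Lp_norm p T u)" by (intro mult_left_mono L B)
    finally show ?thesis by (simp add: mult_ac)
  qed
  show "(\<lambda>u. LINT t|M. g t \<bullet> u t) \<in> Lp_dual p T"
    unfolding Lp_dual_def
  proof (intro CollectI conjI ballI allI exI)
    fix u v :: "real \<Rightarrow> 'b" assume "u \<in> Lp_space p T" "v \<in> Lp_space p T"
    then show "(LINT t|M. g t \<bullet> (u t + v t)) = (LINT t|M. g t \<bullet> u t) + (LINT t|M. g t \<bullet> v t)"
      by (simp add: inner_add_right int)
  qed (use bound in auto)
qed

section \<open>Primitives at rational times as coordinates on the ball\<close>

text \<open>A countable index set makes the product topology on \<open>rat \<Rightarrow> 'b\<close>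
  metrizable. Negative indices give 0 and those beyond \<open>T\<close> the full integral, so all of
  \<open>rat\<close> can be used.\<close>

definition rat_primitive :: "(real \<Rightarrow> 'b::euclidean_space) \<Rightarrow> rat \<Rightarrow> 'b" where
  "rat_primitive u q = (LINT t|M. indicat_real {0..of_rat q} t *\<^sub>R u t)"

lemma rat_primitive_dual:
  fixes i :: "'b::euclidean_space"
  shows "(\<lambda>u. LINT t|M. (indicat_real {0..of_rat q} t *\<^sub>R i) \<bullet> u t) \<in> Lp_dual p T"
  by (rule Lp_dual_integral(1)[of _ "norm i"], intro borel_measurable_scaleR borel_measurable_indicator_Icc borel_measurable_const)
    (auto simp: indicator_def)

lemma rat_primitive_inner:
  assumes "u \<in> Lp_space p T"
  shows "rat_primitive u q \<bullet> i = (LINT t|M. (indicat_real {0..of_rat q} t *\<^sub>R i) \<bullet> u t)"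
proof -
  have "integrable M (\<lambda>t. indicat_real {0..of_rat q} t *\<^sub>R u t)"
    by (rule integrable_indicator_Icc[OF Lp_integrable[OF assms]])
  then show ?thesis
    unfolding rat_primitive_def by (subst integral_inner_left[symmetric]) (auto simp: inner_commute)
qed

lemma rat_primitive_inject:
  assumes "u \<in> Lp_space p T" "v \<in> Lp_space p T" "rat_primitive u = rat_primitive v"
  shows "AE t in M. u t = v t"
proof -
  have d: "integrable M (\<lambda>t. u t - v t)" by (rule Lp_integrable[OF Lp_diff[OF assms(1,2)]])
  have "AE t in M. u t - v t = 0"
  proof (rule AE_eq_0_if_integral_eq_0[OF d])
    fix s assume s: "s \<in> \<rat>" "0 \<le> s" "s \<le> T"
    then obtain q where q: "s = of_rat q" by (auto elim: Rats_cases)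
    have i: "integrable M (\<lambda>t. indicat_real {0..s} t *\<^sub>R w t)" if "w \<in> Lp_space p T" for w :: "real \<Rightarrow> 'a"
      by (rule integrable_indicator_Icc[OF Lp_integrable[OF that]])
    have "integral {0..s} (\<lambda>t. u t - v t) = (LINT t|M. indicat_real {0..s} t *\<^sub>R (u t - v t))"
      by (rule LINT_eq_integral[OF d order_refl s(3), symmetric])
    also have "\<dots> = rat_primitive u q - rat_primitive v q"
      unfolding rat_primitive_def q[symmetric] using i assms(1,2) by (simp add: scaleR_diff_right)
    finally show "integral {0..s} (\<lambda>t. u t - v t) = 0" using assms(3) by simp
  qed
  then show ?thesis by eventually_elim simp
qed

text \<open>Half-spaces are closed under midpoints; upper bounds follow by applying this to
  \<open>- \<phi>\<close>.\<close>

lemma midpoint_hull_dual_bound: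
  assumes "\<phi> \<in> Lp_dual p T" "v \<in> midpoint_hull U" "U \<subseteq> Lp_space p T" "\<And>u. u \<in> U \<Longrightarrow> c \<le> \<phi> u"
  shows "c \<le> \<phi> v"
proof -
  have "v \<in> Lp_space p T \<and> c \<le> \<phi> v"
    using assms(2)
  proof induction
    case (midpoint v w)
    then have "\<phi> (\<lambda>t. (1/2) *\<^sub>R (v t + w t)) = (1/2) * (\<phi> v + \<phi> w)"
      using Lp_dualD(1)[OF assms(1), of v w] Lp_dualD(2)[OF assms(1) Lp_add, of v w "1/2"] by simp
    then show ?case using midpoint Lp_midpoint(1) by auto
  qed (use assms(3,4) in auto)
  then show ?thesis by simp
qed

lemma midpoint_hull_dual_tendsto:
  assumes \<phi>: "\<phi> \<in> Lp_dual p T" and u: "\<And>n. u n \<in> Lp_space p T"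
    and y: "\<And>n. y n \<in> midpoint_hull (u ` {n..})" and lim: "(\<lambda>n. \<phi> (u n)) \<longlonglongrightarrow> l"
  shows "(\<lambda>n. \<phi> (y n)) \<longlonglongrightarrow> l"
proof (rule LIMSEQ_I)
  fix e :: real assume "e > 0"
  then obtain n0 where n0: "\<And>n. n \<ge> n0 \<Longrightarrow> \<bar>\<phi> (u n) - l\<bar> < e / 2"
    using LIMSEQ_D[OF lim, of "e / 2"] by auto
  have "norm (\<phi> (y n) - l) < e" if "n \<ge> n0" for n
  proof -
    have b: "l - e / 2 \<le> \<phi> (u k) \<and> - l - e / 2 \<le> - \<phi> (u k)" if "k \<ge> n" for k
      using n0[of k] that \<open>n \<ge> n0\<close> by linarith
    have "l - e / 2 \<le> \<phi> (y n)"
      by (rule midpoint_hull_dual_bound[OF \<phi> y]) (use u b in auto)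
    moreover have "- l - e / 2 \<le> - \<phi> (y n)"
      by (rule midpoint_hull_dual_bound[OF Lp_dual_uminus[OF \<phi>] y]) (use u b in auto)
    ultimately show ?thesis using \<open>e > 0\<close> by (simp add: abs_less_iff)
  qed
  then show "\<exists>n0. \<forall>n\<ge>n0. norm (\<phi> (y n) - l) < e" by blast
qed

text \<open>On a ball, convergence of the primitives at rational times already determines the weak limit.
  A functional violating this would, by passing to midpoint hulls of a subsequence, separate two
  elements of the ball with the same primitive.\<close>

theorem Lp_weak_limit:
  assumes u: "\<And>n. u n \<in> Lp_space p T" "\<And>n. Lp_pow (u n) \<le> R"
    and lim: "\<And>q. (\<lambda>n. rat_primitive (u n) q) \<longlonglongrightarrow> e q"
  obtains w where "w \<in> Lp_space p T" "Lp_pow w \<le> R" "rat_primitive w = e"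
    "\<And>\<phi>. \<phi> \<in> Lp_dual p T \<Longrightarrow> (\<lambda>n. \<phi> (u n)) \<longlonglongrightarrow> \<phi> w"
proof -
  \<comment> \<open>Every subsequence has hull elements converging strongly to some
    \<open>w\<close>. Limits of functionals survive on hulls of tails, so the primitive of
    \<open>w\<close> must be \<open>e\<close>.\<close>
  have sub: "\<exists>w y. w \<in> Lp_space p T \<and> Lp_pow w \<le> R \<and> rat_primitive w = e \<and>
      (\<forall>n. y n \<in> midpoint_hull ((u \<circ> s) ` {n..})) \<and> (\<forall>\<phi>\<in>Lp_dual p T. (\<lambda>n. \<phi> (y n)) \<longlonglongrightarrow> \<phi> w)"
    if s: "strict_mono s" for s
  proof -
    have us: "(u \<circ> s) n \<in> Lp_space p T" "Lp_pow ((u \<circ> s) n) \<le> R" for n using u by auto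
    obtain y w where w: "w \<in> Lp_space p T" "Lp_pow w \<le> R" and y: "\<forall>n. y n \<in> midpoint_hull ((u \<circ> s) ` {n..})"
      "\<forall>n. y n \<in> Lp_space p T" "(\<lambda>n. Lp_pow (\<lambda>t. y n t - w t)) \<longlonglongrightarrow> 0"
      by (rule midpoint_hull_strong_convergence[of "u \<circ> s" R, OF us])
    have conv: "(\<lambda>n. \<phi> (y n)) \<longlonglongrightarrow> \<phi> w" if "\<phi> \<in> Lp_dual p T" for \<phi>
      by (rule Lp_dual_tendsto[OF that spec[OF y(2)] w(1) y(3)])
    have "rat_primitive w q = e q" for q
    proof (rule euclidean_eqI)
      fix i :: 'a assume "i \<in> Basis"
      define \<phi> where "\<phi> = (\<lambda>u. LINT t|M. (indicat_real {0..of_rat q} t *\<^sub>R i) \<bullet> u t)"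
      have \<phi>: "\<phi> \<in> Lp_dual p T" unfolding \<phi>_def by (rule rat_primitive_dual)
      have \<phi>_eq: "\<phi> v = rat_primitive v q \<bullet> i" if "v \<in> Lp_space p T" for v using rat_primitive_inner[OF that] by (simp add: \<phi>_def)
      have "(\<lambda>n. rat_primitive (u n) q \<bullet> i) \<longlonglongrightarrow> e q \<bullet> i" by (intro tendsto_intros lim)
      then have "(\<lambda>n. \<phi> (u n)) \<longlonglongrightarrow> e q \<bullet> i" using \<phi>_eq[OF u(1)] by simp
      then have "(\<lambda>n. \<phi> ((u \<circ> s) n)) \<longlonglongrightarrow> e q \<bullet> i"
        using LIMSEQ_subseq_LIMSEQ[OF _ s, of "\<lambda>n. \<phi> (u n)"] by (simp add: o_def)
      then have "(\<lambda>n. \<phi> (y n)) \<longlonglongrightarrow> e q \<bullet> i"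
        by (rule midpoint_hull_dual_tendsto[OF \<phi> us(1) spec[OF y(1)]])
      then have "\<phi> w = e q \<bullet> i" using conv[OF \<phi>] LIMSEQ_unique by blast
      then show "rat_primitive w q \<bullet> i = e q \<bullet> i" using \<phi>_eq[OF w(1)] by simp
    qed
    then have "rat_primitive w = e" by (rule ext)
    then show ?thesis using w y(1) conv by blast
  qed
  obtain w where w: "w \<in> Lp_space p T" "Lp_pow w \<le> R" "rat_primitive w = e"
    using sub[OF strict_mono_id] by blast
  \<comment> \<open>One-sided bounds suffice because \<open>- \<phi>\<close> is a functional as
    well.\<close>
  have upper: "\<forall>\<^sub>F n in sequentially. \<phi> (u n) < \<phi> w + \<epsilon>" if \<phi>: "\<phi> \<in> Lp_dual p T" and "\<epsilon> > 0" for \<phi> \<epsilon>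
  proof (rule ccontr)
    assume "\<not> (\<forall>\<^sub>F n in sequentially. \<phi> (u n) < \<phi> w + \<epsilon>)"
    then have "\<exists>\<^sub>F n in sequentially. \<phi> w + \<epsilon> \<le> \<phi> (u n)"
      by (simp add: frequently_def not_le)
    then have "infinite {n. \<phi> w + \<epsilon> \<le> \<phi> (u n)}"
      by (simp add: frequently_cofinite[symmetric] cofinite_eq_sequentially)
    then obtain s :: "nat \<Rightarrow> nat" where s: "strict_mono s" "\<And>n. \<phi> w + \<epsilon> \<le> \<phi> (u (s n))"
      using infinite_enumerate by blast
    obtain w' y where w': "w' \<in> Lp_space p T" "rat_primitive w' = e"
      and y: "\<And>n. y n \<in> midpoint_hull ((u \<circ> s) ` {n..})" "(\<lambda>n. \<phi> (y n)) \<longlonglongrightarrow> \<phi> w'"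
      using sub[OF s(1)] \<phi> by blast
    have "\<phi> w + \<epsilon> \<le> \<phi> (y n)" for n
      by (rule midpoint_hull_dual_bound[OF \<phi> y(1)]) (use u s in auto)
    then have "\<phi> w + \<epsilon> \<le> \<phi> w'" using y(2) by (intro LIMSEQ_le_const[of _ _ "\<phi> w + \<epsilon>"]) auto
    moreover have "\<phi> w' = \<phi> w"
      using w w' by (intro Lp_dual_AE_cong[OF \<phi>] rat_primitive_inject) auto
    ultimately show False using \<open>\<epsilon> > 0\<close> by simp
  qed
  have "(\<lambda>n. \<phi> (u n)) \<longlonglongrightarrow> \<phi> w" if \<phi>: "\<phi> \<in> Lp_dual p T" for \<phi>
  proof (rule tendstoI)
    fix \<epsilon> :: real assume "\<epsilon> > 0"
    show "\<forall>\<^sub>F n in sequentially. dist (\<phi> (u n)) (\<phi> w) < \<epsilon>"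
      using upper[OF \<phi> \<open>\<epsilon> > 0\<close>] upper[OF Lp_dual_uminus[OF \<phi>] \<open>\<epsilon> > 0\<close>]
      by eventually_elim (simp add: dist_real_def abs_less_iff)
  qed
  then show ?thesis using that w by blast
qed

section \<open>The weak topology on balls\<close>

lemma continuous_map_Lp_dual:
  assumes "\<phi> \<in> Lp_dual p T"
  shows "continuous_map (weak_Lp p T) euclideanreal \<phi>"
  unfolding continuous_map_def
proof (intro conjI allI impI)
  fix V :: "real set" assume "openin euclideanreal V"
  then show "openin (weak_Lp p T) {u \<in> topspace (weak_Lp p T). \<phi> u \<in> V}"
    using assms unfolding weak_Lp_def[of p T] topspace_weak_Lp[unfolded weak_Lp_def]
    by (intro topology_generated_by_Basis) auto
qed auto

text \<open>The converse is an induction over the generation of the topology, in which only the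
  subbasic sets involve a functional.\<close>

lemma limitin_weak_Lp_iff:
  assumes "\<And>n. u n \<in> Lp_space p T"
  shows "limitin (weak_Lp p T) u w sequentially \<longleftrightarrow>
    w \<in> Lp_space p T \<and> (\<forall>\<phi>\<in>Lp_dual p T. (\<lambda>n. \<phi> (u n)) \<longlonglongrightarrow> \<phi> w)" (is "?l \<longleftrightarrow> ?r")
proof
  assume l: ?l
  then show ?r
    using continuous_map_limit[OF continuous_map_Lp_dual l] limitin_topspace[OF l] by (auto simp: o_def)
next
  assume r: ?r
  have "w \<in> U \<longrightarrow> (\<forall>\<^sub>F n in sequentially. u n \<in> U)" if "openin (weak_Lp p T) U" for U
    using that[unfolded weak_Lp_def openin_topology_generated_by_iff]
  proof induction
    case (Int a b)
    then show ?case by (auto elim: eventually_elim2)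
  next
    case (UN K)
    then show ?case by (fastforce elim: eventually_mono)
  next
    case (Basis s)
    then obtain \<phi> V where s: "s = {u \<in> Lp_space p T. \<phi> u \<in> V}" "\<phi> \<in> Lp_dual p T" "open V" by blast
    have "(\<lambda>n. \<phi> (u n)) \<longlonglongrightarrow> \<phi> w" using r s(2) by blast
    then have "\<forall>\<^sub>F n in sequentially. \<phi> (u n) \<in> V" if "\<phi> w \<in> V"
      using s(3) that by (rule topological_tendstoD)
    then show ?case using assms s(1) by auto
  qed simp
  then show ?l using r by (simp add: limitin_def)
qed

definition Lp_pow_ball :: "real \<Rightarrow> (real \<Rightarrow> 'b::euclidean_space) set" where
  "Lp_pow_ball R = {u \<in> Lp_space p T. Lp_pow u \<le> R}"

lemma rat_primitive_bound:
  assumes "u \<in> Lp_pow_ball R"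
  shows "norm (rat_primitive u q) \<le> T + R"
proof -
  have u: "u \<in> Lp_space p T" "Lp_pow u \<le> R" using assms by (auto simp: Lp_pow_ball_def)
  have "norm (rat_primitive u q) \<le> (LINT t|M. norm (u t))"
    unfolding rat_primitive_def using Lp_integrable[OF u(1)]
    by (intro Bochner_Integration.integral_norm_bound_integral integrable_indicator_Icc) (auto simp: indicator_def)
  also have "\<dots> \<le> T + R" using Lp_L1_norm_le[OF u(1), of 1] u(2) by simp
  finally show ?thesis .
qed

lemma Lp_ball_weak_limit:
  assumes "\<And>n. u n \<in> Lp_pow_ball R" "(\<lambda>n. rat_primitive (u n)) \<longlonglongrightarrow> e"
  obtains w where "w \<in> Lp_pow_ball R" "rat_primitive w = e" "\<forall>\<phi>\<in>Lp_dual p T. (\<lambda>n. \<phi> (u n)) \<longlonglongrightarrow> \<phi> w"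
proof -
  have "(\<lambda>n. rat_primitive (u n) q) \<longlonglongrightarrow> e q" for q
  proof -
    have "isCont (\<lambda>x :: rat \<Rightarrow> 'a. x q) e"
      using iffD1[OF continuous_on_eq_continuous_at[OF open_UNIV] continuous_on_product_coordinates] by blast
    then show ?thesis using assms(2) by (rule isCont_tendsto_compose)
  qed
  moreover have "u n \<in> Lp_space p T" "Lp_pow (u n) \<le> R" for n
    using assms(1)[of n] by (auto simp: Lp_pow_ball_def)
  ultimately obtain w where "w \<in> Lp_space p T" "Lp_pow w \<le> R" "rat_primitive w = e"
    "\<And>\<phi>. \<phi> \<in> Lp_dual p T \<Longrightarrow> (\<lambda>n. \<phi> (u n)) \<longlonglongrightarrow> \<phi> w"
    using Lp_weak_limit[of u R e] by blast
  then show ?thesis using that by (simp add: Lp_pow_ball_def)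
qed

text \<open>The target is metrizable, so sequences suffice, and \<open>Lp_ball_weak_limit\<close>
  supplies a weak limit in the ball. Applied to the ball itself and to the part of it outside a
  subbasic open set.\<close>

lemma closed_rat_primitive_image:
  fixes A :: "(real \<Rightarrow> 'b::euclidean_space) set"
  assumes "A \<subseteq> Lp_pow_ball R"
    and A: "\<And>u w. (\<And>n. u n \<in> A) \<Longrightarrow> w \<in> Lp_pow_ball R \<Longrightarrow>
      \<forall>\<phi>\<in>Lp_dual p T. (\<lambda>n. \<phi> (u n)) \<longlonglongrightarrow> \<phi> w \<Longrightarrow> w \<in> A"
  shows "closed (rat_primitive ` A)"
  unfolding closed_sequential_limits
proof (intro allI impI; elim conjE)
  fix x :: "nat \<Rightarrow> rat \<Rightarrow> 'b" and e assume x: "\<forall>n. x n \<in> rat_primitive ` A" "x \<longlonglongrightarrow> e"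
  then obtain u where u: "\<And>n. u n \<in> A" "\<And>n. x n = rat_primitive (u n)" unfolding image_iff by metis
  obtain w where w: "w \<in> Lp_pow_ball R" "rat_primitive w = e" "\<forall>\<phi>\<in>Lp_dual p T. (\<lambda>n. \<phi> (u n)) \<longlonglongrightarrow> \<phi> w"
    by (rule Lp_ball_weak_limit[of u R e]) (use u assms(1) x(2) in \<open>auto simp: u(2)[abs_def, symmetric]\<close>)
  have "w \<in> A" by (rule A[OF u(1) w(1) w(3)])
  then show "e \<in> rat_primitive ` A" using w(2) by blast
qed

text \<open>The primitives are bounded by \<open>T + R\<close>, so their set is closed in a product
  of compact balls, which is compact by Tychonoff's theorem.\<close>

lemma compact_rat_primitive_ball: "compact (rat_primitive ` (Lp_pow_ball R :: (real \<Rightarrow> 'b::euclidean_space) set))"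
proof -
  have "compactin (product_topology (\<lambda>_. euclidean) UNIV) (PiE (UNIV :: rat set) (\<lambda>_. cball (0 :: 'b) (T + R)))"
    by (subst compactin_PiE) auto
  then have "compact (PiE (UNIV :: rat set) (\<lambda>_. cball (0 :: 'b) (T + R)))"
    by (simp add: euclidean_product_topology)
  moreover have "closed (rat_primitive ` (Lp_pow_ball R :: (real \<Rightarrow> 'b) set))" by (rule closed_rat_primitive_image) auto
  moreover have "rat_primitive ` Lp_pow_ball R \<subseteq> PiE (UNIV :: rat set) (\<lambda>_. cball (0 :: 'b) (T + R))"
    using rat_primitive_bound by (auto simp: PiE_def)
  ultimately show ?thesis
    using compact_Int_closed by (metis inf.absorb_iff2)
qed

lemma rat_primitive_eq_dual_eq:
  assumes "\<phi> \<in> Lp_dual p T" "u \<in> Lp_space p T" "v \<in> Lp_space p T" "rat_primitive u = rat_primitive v"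
  shows "\<phi> u = \<phi> v"
  using Lp_dual_AE_cong[OF assms(1-3)] rat_primitive_inject[OF assms(2-4)] by blast

text \<open>For a subbasic set the image of its complement in the ball is closed. Equal primitives
  give equal values of \<open>\<phi>\<close>, so this image misses that of the set itself, although
  \<open>rat_primitive\<close> is not injective on functions.\<close>

lemma weakly_open_in_ball:
  fixes U :: "(real \<Rightarrow> 'b::euclidean_space) set"
  assumes "openin (weak_Lp p T) U"
  shows "\<exists>G. open G \<and> (\<forall>u\<in>Lp_pow_ball R. u \<in> U \<longleftrightarrow> rat_primitive u \<in> G)"
  using assms[unfolded weak_Lp_def openin_topology_generated_by_iff]
proof induction
  case Empty
  then show ?case by (intro exI[of _ "{}"]) auto
next
  case (Int a b)
  then obtain G H where "open G" "\<forall>u\<in>Lp_pow_ball R. u \<in> a \<longleftrightarrow> rat_primitive u \<in> G"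
    "open H" "\<forall>u\<in>Lp_pow_ball R. u \<in> b \<longleftrightarrow> rat_primitive u \<in> H" by blast
  then show ?case by (intro exI[of _ "G \<inter> H"]) auto
next
  case (UN K)
  then obtain G where "\<And>k. k \<in> K \<Longrightarrow> open (G k) \<and> (\<forall>u\<in>Lp_pow_ball R. u \<in> k \<longleftrightarrow> rat_primitive u \<in> G k)" by metis
  then show ?case by (intro exI[of _ "\<Union>k\<in>K. G k"]) auto
next
  case (Basis s)
  then obtain \<phi> V where s: "s = {u \<in> Lp_space p T. \<phi> u \<in> V}" "\<phi> \<in> Lp_dual p T" "open V" by blast
  define A where "A = {u \<in> Lp_pow_ball R. \<phi> u \<notin> V}"
  have "closed (rat_primitive ` A)"
  proof (rule closed_rat_primitive_image)
    fix u w assume u: "\<And>n. u n \<in> A" and w: "w \<in> Lp_pow_ball R" "\<forall>\<phi>\<in>Lp_dual p T. (\<lambda>n. \<phi> (u n)) \<longlonglongrightarrow> \<phi> w"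
    have "\<phi> w \<in> - V"
      by (rule Lim_in_closed_set[of _ "\<lambda>n. \<phi> (u n)" sequentially])
        (use s u w in \<open>auto simp: A_def closed_Compl\<close>)
    then show "w \<in> A" using w by (simp add: A_def)
  qed (auto simp: A_def)
  moreover have "u \<in> s \<longleftrightarrow> rat_primitive u \<in> - rat_primitive ` A" if u: "u \<in> Lp_pow_ball R" for u
  proof -
    have "\<phi> u = \<phi> v" if "rat_primitive u = rat_primitive v" "v \<in> A" for v
      using that u by (intro rat_primitive_eq_dual_eq[OF s(2)]) (auto simp: A_def Lp_pow_ball_def)
    moreover have "u \<in> A \<longleftrightarrow> u \<notin> s" using u by (auto simp: A_def s Lp_pow_ball_def)
    ultimately show ?thesis using u by (auto simp: A_def s Lp_pow_ball_def)
  qed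
  ultimately show ?case by (intro exI[of _ "- rat_primitive ` A"]) (auto simp: open_Compl)
qed

text \<open>Open covers are transported to the compact set of primitives, and finite subcovers
  back.\<close>

theorem compactin_weak_ball: "compactin (weak_Lp p T) (Lp_pow_ball R)"
  unfolding compactin_def
proof (intro conjI allI impI; (elim conjE)?)
  show "Lp_pow_ball R \<subseteq> topspace (weak_Lp p T)" by (auto simp: Lp_pow_ball_def)
  fix \<U> :: "(real \<Rightarrow> 'a) set set"
  assume op: "\<forall>U\<in>\<U>. openin (weak_Lp p T) U" and cov: "Lp_pow_ball R \<subseteq> \<Union>\<U>"
  have "\<forall>U\<in>\<U>. \<exists>G. open G \<and> (\<forall>u\<in>Lp_pow_ball R. u \<in> U \<longleftrightarrow> rat_primitive u \<in> G)"
    using op weakly_open_in_ball by blast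
  then obtain G where G: "\<And>U. U \<in> \<U> \<Longrightarrow> open (G U)"
    "\<And>U u. U \<in> \<U> \<Longrightarrow> u \<in> Lp_pow_ball R \<Longrightarrow> u \<in> U \<longleftrightarrow> rat_primitive u \<in> G U" by metis
  obtain \<F> where \<F>: "\<F> \<subseteq> \<U>" "finite \<F>" "rat_primitive ` Lp_pow_ball R \<subseteq> (\<Union>U\<in>\<F>. G U)"
  proof (rule compactE_image[OF compact_rat_primitive_ball[of R], of \<U> G])
    show "rat_primitive ` Lp_pow_ball R \<subseteq> (\<Union>U\<in>\<U>. G U)" using cov G(2) by blast
  qed (use G(1) in auto)
  have "Lp_pow_ball R \<subseteq> \<Union>\<F>" using \<F>(1,3) G(2) by blast
  then show "\<exists>\<F>. finite \<F> \<and> \<F> \<subseteq> \<U> \<and> Lp_pow_ball R \<subseteq> \<Union>\<F>" using \<F> by blast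
qed

text \<open>\<open>rat_primitive\<close> is weakly continuous and its image of the ball is compact,
  hence closed. The preimage of that image is no larger than the ball: equal primitives mean a.e.
  equality, which preserves \<open>Lp_pow\<close>.\<close>

theorem closedin_weak_ball: "closedin (weak_Lp p T) (Lp_pow_ball R :: (real \<Rightarrow> 'b::euclidean_space) set)"
proof -
  have "continuous_map (weak_Lp p T) euclidean (\<lambda>u :: real \<Rightarrow> 'b. rat_primitive u q)" for q
    unfolding continuous_map_atin limitin_canonical_iff
  proof (intro ballI, subst tendsto_componentwise_iff, intro ballI)
    fix u :: "real \<Rightarrow> 'b" and i :: 'b assume u: "u \<in> topspace (weak_Lp p T)"
    define \<phi> where "\<phi> = (\<lambda>u. LINT t|M. (indicat_real {0..of_rat q} t *\<^sub>R i) \<bullet> u t)"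
    have "continuous_map (weak_Lp p T) euclideanreal \<phi>"
      unfolding \<phi>_def by (rule continuous_map_Lp_dual[OF rat_primitive_dual])
    then have "continuous_map (weak_Lp p T) euclideanreal (\<lambda>u. rat_primitive u q \<bullet> i)"
      by (rule continuous_map_eq) (simp add: \<phi>_def rat_primitive_inner)
    then show "((\<lambda>u. rat_primitive u q \<bullet> i) \<longlongrightarrow> rat_primitive u q \<bullet> i) (atin (weak_Lp p T) u)"
      using u by (simp only: continuous_map_atin limitin_canonical_iff)
  qed
  then have "continuous_map (weak_Lp p T) euclidean (rat_primitive :: (real \<Rightarrow> 'b) \<Rightarrow> _)"
    unfolding euclidean_product_topology[symmetric] continuous_map_componentwise_UNIV by blast
  moreover have "closedin euclidean (rat_primitive ` (Lp_pow_ball R :: (real \<Rightarrow> 'b) set))"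
    using compact_rat_primitive_ball compact_imp_closed by auto
  ultimately have "closedin (weak_Lp p T) {u \<in> topspace (weak_Lp p T). rat_primitive u \<in> rat_primitive ` (Lp_pow_ball R :: (real \<Rightarrow> 'b) set)}"
    by (rule closedin_continuous_map_preimage)
  also have "{u \<in> topspace (weak_Lp p T). rat_primitive u \<in> rat_primitive ` (Lp_pow_ball R :: (real \<Rightarrow> 'b) set)} = Lp_pow_ball R"
  proof safe
    fix u v :: "real \<Rightarrow> 'b" assume u: "u \<in> topspace (weak_Lp p T)" "rat_primitive u = rat_primitive v" "v \<in> Lp_pow_ball R"
    then have "AE t in M. v t = u t" by (intro rat_primitive_inject) (auto simp: Lp_pow_ball_def)
    then have "Lp_pow u = Lp_pow v"
      using u by (intro Lp_AE_cong(2)) (auto simp: Lp_pow_ball_def Lp_measurable)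
    then show "u \<in> Lp_pow_ball R" using u by (simp add: Lp_pow_ball_def)
  qed (auto simp: Lp_pow_ball_def)
  finally show ?thesis .
qed

theorem weak_ball_sequentially_compact:
  fixes u :: "nat \<Rightarrow> real \<Rightarrow> 'b::euclidean_space"
  assumes "\<And>n. u n \<in> Lp_pow_ball R"
  obtains w r where "w \<in> Lp_pow_ball R" "strict_mono r" "limitin (weak_Lp p T) (u \<circ> r) w sequentially"
proof -
  have "seq_compact (rat_primitive ` (Lp_pow_ball R :: (real \<Rightarrow> 'b) set))"
    using compact_rat_primitive_ball by (rule compact_imp_seq_compact)
  moreover have "\<forall>n. rat_primitive (u n) \<in> rat_primitive ` Lp_pow_ball R" using assms by blast
  ultimately obtain e and r :: "nat \<Rightarrow> nat" where r: "strict_mono r" "((\<lambda>n. rat_primitive (u n)) \<circ> r) \<longlonglongrightarrow> e"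
    unfolding seq_compact_def by metis
  obtain w where w: "w \<in> Lp_pow_ball R" "\<forall>\<phi>\<in>Lp_dual p T. (\<lambda>n. \<phi> ((u \<circ> r) n)) \<longlonglongrightarrow> \<phi> w"
    by (rule Lp_ball_weak_limit[of "u \<circ> r" R e]) (use r assms in \<open>auto simp: o_def\<close>)
  then have "limitin (weak_Lp p T) (u \<circ> r) w sequentially"
    using assms by (subst limitin_weak_Lp_iff) (auto simp: Lp_pow_ball_def)
  then show ?thesis using that w r by blast
qed

end

lemma (in Lp_interval) Lp_ball_eq: "0 \<le> \<rho> \<Longrightarrow> Lp_ball p T \<rho> = Lp_pow_ball (\<rho> powr p)"
  by (auto simp: Lp_ball_def Lp_pow_ball_def Lp_norm_le_iff)

section \<open>Weak lower semicontinuity of convex integrals\<close>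

lemma borel_measurable_lebesgue_on_AE:
  fixes f g :: "'a::euclidean_space \<Rightarrow> 'b::euclidean_space"
  assumes "S \<in> sets lebesgue" "f \<in> borel_measurable (lebesgue_on S)" "AE x in lebesgue_on S. f x = g x"
  shows "g \<in> borel_measurable (lebesgue_on S)"
proof -
  have "(\<lambda>x. if x \<in> S then f x else 0) \<in> borel_measurable lebesgue"
    using assms(1,2) by (simp add: borel_measurable_if)
  moreover have "AE x in lebesgue. (if x \<in> S then f x else 0) = (if x \<in> S then g x else 0)"
    using assms(1,3) by (subst (asm) AE_restrict_space_iff) auto
  ultimately have "(\<lambda>x. if x \<in> S then g x else 0) \<in> borel_measurable lebesgue"
    by (rule borel_measurable_AE)
  then show ?thesis using assms(1) by (simp add: borel_measurable_if)
qed

text \<open>A simple function in place of \<open>u\<close> takes finitely many values. Continuity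
  passes to the limit at almost every \<open>t\<close>, and completeness of Lebesgue measure absorbs
  the exceptional times.\<close>

lemma Caratheodory_borel_measurable:
  fixes f :: "'a::euclidean_space \<Rightarrow> 'b::euclidean_space \<Rightarrow> real"
  assumes S: "S \<in> sets lebesgue" and f: "\<And>v. (\<lambda>t. f t v) \<in> borel_measurable (lebesgue_on S)"
    and cont: "AE t in lebesgue_on S. continuous_on UNIV (f t)"
    and u: "u \<in> borel_measurable (lebesgue_on S)"
  shows "(\<lambda>t. f t (u t)) \<in> borel_measurable (lebesgue_on S)"
proof -
  obtain s where s: "\<And>i. simple_function (lebesgue_on S) (s i)"
    "\<And>t. t \<in> space (lebesgue_on S) \<Longrightarrow> (\<lambda>i. s i t) \<longlonglongrightarrow> u t"
    using borel_measurable_implies_sequence_metric[OF u, of 0] by blast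
  have m: "(\<lambda>t. f t (s i t)) \<in> borel_measurable (lebesgue_on S)" for i
  proof (rule measurable_compose_countable'[where f = "\<lambda>v t. f t v" and g = "s i" and I = "s i ` space (lebesgue_on S)"])
    show "s i \<in> measurable (lebesgue_on S) (count_space (s i ` space (lebesgue_on S)))"
      by (intro measurable_count_space_eq2[THEN iffD2] simple_functionD(1)[OF s(1)] conjI ballI simple_functionD(2)[OF s(1)]) auto
    show "countable (s i ` space (lebesgue_on S))"
      by (rule countable_finite[OF simple_functionD(1)[OF s(1)]])
  qed (rule f)
  have conv: "AE t in lebesgue_on S. (\<lambda>i. f t (s i t)) \<longlonglongrightarrow> f t (u t)"
    using cont AE_space
  proof eventually_elim
    fix t assume "continuous_on UNIV (f t)" "t \<in> space (lebesgue_on S)"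
    then show "(\<lambda>i. f t (s i t)) \<longlonglongrightarrow> f t (u t)"
      using s(2) by (auto intro: continuous_on_tendsto_compose)
  qed
  have "(\<lambda>t. lim (\<lambda>i. f t (s i t))) \<in> borel_measurable (lebesgue_on S)"
    using m by (intro borel_measurable_lim_metric)
  moreover have "AE t in lebesgue_on S. lim (\<lambda>i. f t (s i t)) = f t (u t)"
    using conv by eventually_elim (rule limI)
  ultimately show ?thesis by (rule borel_measurable_lebesgue_on_AE[OF S])
qed

text \<open>Coercivity makes the conjugate \<open>g\<close> finite everywhere, hence continuous,
  being convex. Separating a point below the graph from the epigraph gives one good slope, and
  continuity of \<open>g\<close> lets it move into the dense set \<open>B\<close>.\<close>

lemma coercive_convex_affine_minorant:
  fixes f :: "'a::euclidean_space \<Rightarrow> real"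
  assumes conv: "convex_on UNIV f" and "0 < C" "1 < p" and coer: "\<And>w. C * norm w powr p - c \<le> f w"
    and dense: "\<And>X. open X \<Longrightarrow> X \<noteq> {} \<Longrightarrow> \<exists>d\<in>B. d \<in> X" and "0 < \<epsilon>"
  obtains \<alpha> \<beta> where "\<alpha> \<in> \<rat>" "\<beta> \<in> B" "\<And>w. \<alpha> + \<beta> \<bullet> w \<le> f w" "f v - \<epsilon> \<le> \<alpha> + \<beta> \<bullet> v"
proof -
  have contf: "continuous_on UNIV f" by (rule convex_on_continuous[OF open_UNIV conv])
  define g where "g = (\<lambda>\<beta>. SUP w. \<beta> \<bullet> w - f w)"
  then have g_eq: "g \<beta> = (SUP w. \<beta> \<bullet> w - f w)" for \<beta> by simp
  have bdd: "bdd_above (range (\<lambda>w. \<beta> \<bullet> w - f w))" for \<beta>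
  proof -
    \<comment> \<open>Solves \<open>(norm \<beta> + 1) * s powr (1 - p) = C\<close>, so that the
      coercive term absorbs the linear one.\<close>
    define s where "s = ((norm \<beta> + 1) / C) powr (1 / (p - 1))"
    have "s > 0" using \<open>0 < C\<close> by (simp add: s_def powr_gt_zero add_nonneg_eq_0_iff)
    have "s powr (p - 1) = (norm \<beta> + 1) / C" using \<open>1 < p\<close> \<open>0 < C\<close> by (simp add: s_def powr_powr)
    moreover have "s powr (1 - p) = inverse (s powr (p - 1))" by (simp flip: powr_minus)
    ultimately have "s powr (1 - p) = C / (norm \<beta> + 1)" by simp
    moreover have "norm \<beta> + 1 > 0" by (simp add: add_nonneg_pos)
    ultimately have sp: "norm \<beta> * s powr (1 - p) \<le> C" using \<open>0 < C\<close>
      by (simp add: pos_divide_le_eq algebra_simps)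
    have "\<beta> \<bullet> w - f w \<le> norm \<beta> * s + c" for w
    proof -
      have "\<beta> \<bullet> w \<le> norm \<beta> * norm w" by (rule norm_cauchy_schwarz)
      also have "\<dots> \<le> norm \<beta> * (s + s powr (1 - p) * norm w powr p)"
        using le_add_powr[of p s "norm w"] \<open>1 < p\<close> \<open>s > 0\<close> by (intro mult_left_mono) auto
      also have "\<dots> \<le> norm \<beta> * s + C * norm w powr p"
        using mult_right_mono[OF sp, of "norm w powr p"] by (simp add: algebra_simps)
      finally show ?thesis using coer[of w] by simp
    qed
    then show ?thesis by (intro bdd_aboveI[of _ "norm \<beta> * s + c"]) auto
  qed
  have g_ge: "\<beta> \<bullet> w - f w \<le> g \<beta>" for \<beta> w unfolding g_def by (rule cSUP_upper[OF UNIV_I bdd])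
  have "convex_on UNIV g"
  proof (rule convex_onI)
    fix t :: real and x y :: 'a assume t: "0 < t" "t < 1"
    show "g ((1 - t) *\<^sub>R x + t *\<^sub>R y) \<le> (1 - t) * g x + t * g y"
      unfolding g_eq[of "(1 - t) *\<^sub>R x + t *\<^sub>R y"]
    proof (rule cSUP_least)
      fix w
      have "((1 - t) *\<^sub>R x + t *\<^sub>R y) \<bullet> w - f w = (1 - t) * (x \<bullet> w - f w) + t * (y \<bullet> w - f w)"
        by (simp add: inner_add_left algebra_simps)
      also have "\<dots> \<le> (1 - t) * g x + t * g y"
        using t g_ge by (intro add_mono mult_left_mono) auto
      finally show "((1 - t) *\<^sub>R x + t *\<^sub>R y) \<bullet> w - f w \<le> (1 - t) * g x + t * g y" .
    qed simp
  qed simp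
  then have contg: "continuous_on UNIV g" by (rule convex_on_continuous[OF open_UNIV])
  have "convex (epigraph UNIV f)" using conv by (rule convex_epigraphI)
  moreover have "closed (epigraph UNIV f)"
    unfolding epigraph_def using contf
    by (auto intro!: closed_Collect_le continuous_intros continuous_on_compose2[OF contf])
  moreover have "(v, f v - \<epsilon> / 3) \<notin> epigraph UNIV f" using \<open>0 < \<epsilon>\<close> by (simp add: mem_epigraph)
  ultimately obtain a b where ab: "a \<bullet> (v, f v - \<epsilon> / 3) < b" "\<And>x. x \<in> epigraph UNIV f \<Longrightarrow> b < a \<bullet> x"
    using separating_hyperplane_closed_point by metis
  obtain a1 a2 where a: "a = (a1, a2)" by force
  have sep: "b < a1 \<bullet> w + a2 * f w" for w using ab(2)[of "(w, f w)"] by (simp add: mem_epigraph a)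
  have "a1 \<bullet> v + a2 * (f v - \<epsilon> / 3) < b" using ab(1) by (simp add: a)
  \<comment> \<open>The point below the graph and the graph point over the same \<open>v\<close> lie
    on different sides, so the hyperplane is not vertical.\<close>
  with sep[of v] have "a2 * (\<epsilon> / 3) > 0" by (simp add: algebra_simps)
  then have "a2 > 0" using \<open>0 < \<epsilon>\<close> by (simp add: zero_less_mult_iff)
  define \<beta>0 where "\<beta>0 = - (a1 /\<^sub>R a2)"
  have "g \<beta>0 \<le> - b / a2"
    unfolding g_def
  proof (rule cSUP_least)
    fix w
    show "\<beta>0 \<bullet> w - f w \<le> - b / a2"
    proof -
      have "(a1 \<bullet> w + a2 * f w) / a2 = (a1 \<bullet> w) / a2 + f w"
        using \<open>a2 > 0\<close> by (simp add: add_divide_distrib)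
      with divide_strict_right_mono[OF sep[of w] \<open>a2 > 0\<close>] have "b / a2 < (a1 \<bullet> w) / a2 + f w"
        by (simp only:)
      moreover have "\<beta>0 \<bullet> w = - ((a1 \<bullet> w) / a2)" by (simp add: \<beta>0_def divide_inverse mult.commute)
      ultimately show ?thesis by simp
    qed
  qed simp
  moreover have "f v - \<epsilon> / 3 < \<beta>0 \<bullet> v + b / a2"
    using ab(1) \<open>a2 > 0\<close> by (simp add: a \<beta>0_def field_simps)
  ultimately have "\<beta>0 \<in> {\<beta>. f v - \<epsilon> / 3 < \<beta> \<bullet> v - g \<beta>}" by simp
  moreover have "open {\<beta>. f v - \<epsilon> / 3 < \<beta> \<bullet> v - g \<beta>}"
    using contg by (intro open_Collect_less continuous_intros)
  ultimately obtain \<beta> where \<beta>: "\<beta> \<in> B" "f v - \<epsilon> / 3 < \<beta> \<bullet> v - g \<beta>" using dense by blast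
  obtain \<alpha> where \<alpha>: "\<alpha> \<in> \<rat>" "- g \<beta> - \<epsilon> / 3 < \<alpha>" "\<alpha> < - g \<beta>"
    using Rats_dense_in_real[of "- g \<beta> - \<epsilon> / 3" "- g \<beta>"] \<open>0 < \<epsilon>\<close> by auto
  show ?thesis
  proof (rule that[OF \<alpha>(1) \<beta>(1)])
    show "\<alpha> + \<beta> \<bullet> w \<le> f w" for w using g_ge[of \<beta> w] \<alpha> by simp
    show "f v - \<epsilon> \<le> \<alpha> + \<beta> \<bullet> v" using \<alpha> \<beta> \<open>0 < \<epsilon>\<close> by simp
  qed
qed

text \<open>Where \<open>- c t \<le> h t\<close>, \<open>ennreal (h t + c t) + ennreal (- h t) =
  ennreal (h t) + ennreal (c t)\<close>; this integrates without subtraction. The integral of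
  \<open>ennreal (- h t)\<close> is finite by domination, so it can then be moved across.\<close>

lemma ext_integral_add:
  assumes h: "h \<in> borel_measurable M" and c: "integrable M c" "\<And>t. t \<in> space M \<Longrightarrow> 0 \<le> c t"
    and le: "AE t in M. - c t \<le> h t"
  shows "ext_integral M h = enn2ereal (\<integral>\<^sup>+ t. ennreal (h t + c t) \<partial>M) - ereal (\<integral>t. c t \<partial>M)"
proof -
  note [measurable] = h borel_measurable_integrable[OF c(1)]
  define A where "A = (\<integral>\<^sup>+ t. ennreal (h t + c t) \<partial>M)"
  define I1 where "I1 = (\<integral>\<^sup>+ t. ennreal (h t) \<partial>M)"
  define I2 where "I2 = (\<integral>\<^sup>+ t. ennreal (- h t) \<partial>M)"
  have c0: "(\<integral>\<^sup>+ t. ennreal (c t) \<partial>M) = ennreal (\<integral>t. c t \<partial>M)"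
    using c by (intro nn_integral_eq_integral) auto
  have "0 \<le> (\<integral>t. c t \<partial>M)" using c(2) by (intro Bochner_Integration.integral_nonneg)
  have "A + I2 = (\<integral>\<^sup>+ t. ennreal (h t + c t) + ennreal (- h t) \<partial>M)"
    unfolding A_def I2_def by (rule nn_integral_add[symmetric]) auto
  also have "\<dots> = (\<integral>\<^sup>+ t. ennreal (h t) + ennreal (c t) \<partial>M)"
  proof (rule nn_integral_cong_AE, use le AE_space in eventually_elim)
    fix t assume t: "- c t \<le> h t" "t \<in> space M"
    show "ennreal (h t + c t) + ennreal (- h t) = ennreal (h t) + ennreal (c t)"
      using t c(2)[of t] by (cases "0 \<le> h t") (auto simp: ennreal_neg ennreal_plus[symmetric] simp del: ennreal_plus)
  qed
  also have "\<dots> = I1 + ennreal (\<integral>t. c t \<partial>M)"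
    unfolding I1_def c0[symmetric] by (rule nn_integral_add) auto
  finally have eq: "A + I2 = I1 + ennreal (\<integral>t. c t \<partial>M)" .
  have "I2 \<le> (\<integral>\<^sup>+ t. ennreal (c t) \<partial>M)"
    unfolding I2_def by (rule nn_integral_mono_AE, use le in eventually_elim) (auto intro: ennreal_leI)
  then have "I2 \<noteq> top" unfolding c0 by (metis ennreal_neq_top top_unique)
  then obtain r where r: "I2 = ennreal r" "0 \<le> r" by (cases I2) auto
  have "enn2ereal A + ereal r = enn2ereal I1 + ereal (\<integral>t. c t \<partial>M)"
    using arg_cong[OF eq, of enn2ereal] r \<open>0 \<le> (\<integral>t. c t \<partial>M)\<close> by (simp add: plus_ennreal.rep_eq)
  then have "enn2ereal I1 - ereal r = enn2ereal A - ereal (\<integral>t. c t \<partial>M)"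
    by (cases "enn2ereal A"; cases "enn2ereal I1") auto
  then show ?thesis unfolding ext_integral_def I1_def[symmetric] I2_def[symmetric] A_def[symmetric] using r by simp
qed

lemma ennreal_integral_le_nn_integral:
  assumes "integrable M k" "AE t in M. k t \<le> h t"
  shows "ennreal (\<integral>t. k t \<partial>M) \<le> (\<integral>\<^sup>+ t. ennreal (h t) \<partial>M)"
proof -
  have "ennreal (\<integral>t. k t \<partial>M) \<le> ennreal (\<integral>t. max 0 (k t) \<partial>M)"
    using assms(1) by (intro ennreal_leI Bochner_Integration.integral_mono) auto
  also have "\<dots> = (\<integral>\<^sup>+ t. ennreal (max 0 (k t)) \<partial>M)"
    using assms(1) by (intro nn_integral_eq_integral[symmetric]) auto
  also have "\<dots> \<le> (\<integral>\<^sup>+ t. ennreal (h t) \<partial>M)"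
    by (rule nn_integral_mono_AE, use assms(2) in eventually_elim)
      (auto simp: max_def ennreal_leI)
  finally show ?thesis .
qed

context Lp_interval
begin

text \<open>The integrand is bounded below by countably many affine functions. Choosing measurably a
  nearly optimal one at \<open>u t\<close> among the first \<open>m\<close> gives a bounded slope, which weak convergence can
  be tested against.\<close>

theorem convex_integral_weak_lsc:
  fixes f :: "real \<Rightarrow> 'b::euclidean_space \<Rightarrow> real"
  assumes f_meas: "\<And>v. (\<lambda>t. f t v) \<in> borel_measurable M"
    and f_conv: "AE t in M. continuous_on UNIV (f t) \<and> convex_on UNIV (f t)"
    and c: "integrable M c" "\<And>t. t \<in> {0..T} \<Longrightarrow> 0 \<le> c t" and "0 < C"
    and coer: "AE t in M. \<forall>v. C * norm v powr p - c t \<le> f t v"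
    and u: "u \<in> Lp_space p T" and v: "\<And>n. v n \<in> Lp_space p T"
    and weak: "\<And>\<phi>. \<phi> \<in> Lp_dual p T \<Longrightarrow> (\<lambda>n. \<phi> (v n)) \<longlonglongrightarrow> \<phi> u"
  shows "(\<integral>\<^sup>+ t. ennreal (f t (u t) + c t) \<partial>M) \<le> liminf (\<lambda>n. \<integral>\<^sup>+ t. ennreal (f t (v n t) + c t) \<partial>M)"
proof (rule ennreal_le_epsilon)
  fix e :: real assume "0 < e"
  \<comment> \<open>An error of \<open>\<epsilon>\<close> at every time integrates to
    \<open>e\<close>.\<close>
  define \<epsilon> where "\<epsilon> = e / T"
  have "0 < \<epsilon>" using \<open>0 < e\<close> T by (simp add: \<epsilon>_def)
  have cont: "AE t in M. continuous_on UNIV (f t)" using f_conv by eventually_elim simp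
  have meas: "(\<lambda>t. f t (w t)) \<in> borel_measurable M" if "w \<in> Lp_space p T" for w
    by (rule Caratheodory_borel_measurable[OF _ f_meas cont Lp_measurable[OF that]]) simp
  note [measurable] = f_meas Lp_measurable[OF u] Lp_measurable[OF v] borel_measurable_integrable[OF c(1)]
    meas[OF u] meas[OF v]
  obtain B :: "'b set" where B: "countable B" "\<And>X. open X \<Longrightarrow> X \<noteq> {} \<Longrightarrow> \<exists>d\<in>B. d \<in> X"
    by (rule countable_dense_setE) blast
  define P where "P = (\<rat> :: real set) \<times> B"
  obtain b where "b \<in> B" using B(2)[of UNIV] by auto
  then have P: "countable P" "P \<noteq> {}"
    using B(1) countable_rat by (auto simp: P_def intro!: exI[of _ "(0, b)"])
  define pr where "pr = from_nat_into P"
  define \<alpha> where "\<alpha> = (\<lambda>j. fst (pr j))"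
  define \<beta> where "\<beta> = (\<lambda>j. snd (pr j))"
  \<comment> \<open>The times at which the \<open>j\<close>-th affine function is a minorant and
    nearly touches at \<open>u t\<close>. Testing on the countable \<open>B\<close> keeps this set
    measurable; continuity later extends the inequality to all \<open>w\<close>.\<close>
  define En where "En = (\<lambda>j. {t \<in> space M. (\<forall>w\<in>B. \<alpha> j + \<beta> j \<bullet> w \<le> f t w) \<and> f t (u t) - \<epsilon> \<le> \<alpha> j + \<beta> j \<bullet> u t})"
  have En_sets: "En j \<in> sets M" for j
    unfolding En_def using B(1) by measurable
  \<comment> \<open>Disjointing selects, measurably, the first index that works at each
    time.\<close>
  define D where "D = disjointed En"
  have D_sets[measurable]: "D j \<in> sets M" for j
    using sets.range_disjointed_sets[of En M] En_sets unfolding D_def by auto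
  have D_disj: "j = k" if "t \<in> D j" "t \<in> D k" for j k t
    using disjoint_family_disjointed[of En] that unfolding D_def disjoint_family_on_def by blast
  have UD: "(\<Union>j. D j) = (\<Union>j. En j)" unfolding D_def by (rule UN_disjointed_eq)
  have DE: "D j \<subseteq> En j" for j unfolding D_def by (rule disjointed_subset)
  have cover: "AE t in M. t \<in> (\<Union>j. D j)"
    using f_conv coer AE_space
  proof eventually_elim
    fix t assume t: "continuous_on UNIV (f t) \<and> convex_on UNIV (f t)"
      "\<forall>v. C * norm v powr p - c t \<le> f t v" "t \<in> space M"
    obtain \<alpha>' \<beta>' where ab: "\<alpha>' \<in> \<rat>" "\<beta>' \<in> B" "\<And>w. \<alpha>' + \<beta>' \<bullet> w \<le> f t w" "f t (u t) - \<epsilon> \<le> \<alpha>' + \<beta>' \<bullet> u t"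
      using coercive_convex_affine_minorant[of "f t" C p "c t" B \<epsilon> "u t"] t B(2) p \<open>0 < C\<close> \<open>0 < \<epsilon>\<close> by blast
    obtain j where "pr j = (\<alpha>', \<beta>')"
      using from_nat_into_surj[OF P(1), of "(\<alpha>', \<beta>')"] ab(1,2) by (auto simp: P_def pr_def)
    then have "t \<in> En j" using ab t(3) by (simp add: En_def \<alpha>_def \<beta>_def)
    then show "t \<in> (\<Union>j. D j)" unfolding UD by blast
  qed
  \<comment> \<open>With finitely many indices the offset \<open>A m\<close> and the slope
    \<open>g m\<close> are bounded; both vanish off \<open>S m\<close>.\<close>
  define S where "S = (\<lambda>m. \<Union>j\<le>m. D j)"
  have S_sets[measurable]: "S m \<in> sets M" for m unfolding S_def by measurable
  define A where "A = (\<lambda>m t. \<Sum>j\<le>m. indicat_real (D j) t * \<alpha> j)"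
  define g where "g = (\<lambda>m t. \<Sum>j\<le>m. indicat_real (D j) t *\<^sub>R \<beta> j)"
  have val: "A m t = \<alpha> j \<and> g m t = \<beta> j" if "t \<in> D j" "j \<le> m" for m j t
  proof -
    have "t \<in> D k \<longleftrightarrow> k = j" for k using D_disj[OF that(1), of k] that(1) by blast
    then have ind: "indicat_real (D k) t = (if k = j then 1 else 0)" for k by (simp only: indicator_def of_bool_def)
    have "A m t = (\<Sum>k\<le>m. if k = j then \<alpha> k else 0)" unfolding A_def ind by (intro sum.cong) auto
    moreover have "g m t = (\<Sum>k\<le>m. if k = j then \<beta> k else 0)" unfolding g_def ind by (intro sum.cong) auto
    ultimately show ?thesis using that(2) by simp
  qed
  have g0: "g m t = 0" if "t \<notin> S m" for m t
    unfolding g_def using that by (intro sum.neutral) (auto simp: S_def indicator_def)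
  have g_meas[measurable]: "g m \<in> borel_measurable M" for m unfolding g_def by measurable
  have A_meas[measurable]: "A m \<in> borel_measurable M" for m unfolding A_def by measurable
  have g_bd: "norm (g m t) \<le> (\<Sum>j\<le>m. norm (\<beta> j))" for m t
    unfolding g_def by (rule order_trans[OF norm_sum], rule sum_mono) (simp add: indicator_def)
  have A_bd: "norm (A m t) \<le> (\<Sum>j\<le>m. \<bar>\<alpha> j\<bar>)" for m t
    unfolding A_def by (rule order_trans[OF norm_sum], rule sum_mono) (simp add: indicator_def)
  have g_int: "integrable M (\<lambda>t. g m t \<bullet> w t)" if "w \<in> Lp_space p T" for m w
    using Lp_dual_integral(2)[OF g_meas g_bd that] .
  have g_lim: "(\<lambda>n. LINT t|M. g m t \<bullet> v n t) \<longlonglongrightarrow> (LINT t|M. g m t \<bullet> u t)" for m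
    using weak[OF Lp_dual_integral(1)[OF g_meas g_bd]] .
  have minorant: "AE t in M. t \<in> S m \<longrightarrow> (\<forall>w. A m t + g m t \<bullet> w \<le> f t w) \<and> f t (u t) - \<epsilon> \<le> A m t + g m t \<bullet> u t" for m
    using cont
  proof eventually_elim
    fix t assume t: "continuous_on UNIV (f t)"
    show "t \<in> S m \<longrightarrow> (\<forall>w. A m t + g m t \<bullet> w \<le> f t w) \<and> f t (u t) - \<epsilon> \<le> A m t + g m t \<bullet> u t"
    proof
      assume "t \<in> S m"
      then obtain j where j: "t \<in> D j" "j \<le> m" by (auto simp: S_def)
      then have tE: "t \<in> En j" using DE by blast
      have "\<alpha> j + \<beta> j \<bullet> w \<le> f t w" for w
      proof (rule ccontr)
        assume "\<not> \<alpha> j + \<beta> j \<bullet> w \<le> f t w"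
        then have "w \<in> {w. f t w < \<alpha> j + \<beta> j \<bullet> w}" by simp
        moreover have "open {w. f t w < \<alpha> j + \<beta> j \<bullet> w}"
          using t by (intro open_Collect_less continuous_intros)
        ultimately obtain d where "d \<in> B" "f t d < \<alpha> j + \<beta> j \<bullet> d" using B(2) by blast
        then show False using tE by (force simp: En_def)
      qed
      then show "(\<forall>w. A m t + g m t \<bullet> w \<le> f t w) \<and> f t (u t) - \<epsilon> \<le> A m t + g m t \<bullet> u t"
        using val[OF j] tE by (simp add: En_def)
    qed
  qed
  have pos: "AE t in M. \<forall>w. 0 \<le> f t w + c t"
    using coer
  proof eventually_elim
    fix t assume *: "\<forall>v. C * norm v powr p - c t \<le> f t v"
    show "\<forall>w. 0 \<le> f t w + c t"
    proof
      fix w :: 'b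
      have "0 \<le> C * norm w powr p" using \<open>0 < C\<close> by simp
      then show "0 \<le> f t w + c t" using *[rule_format, of w] by linarith
    qed
  qed
  have local: "(\<integral>\<^sup>+ t. indicator (S m) t * ennreal (f t (u t) + c t) \<partial>M)
      \<le> liminf (\<lambda>n. \<integral>\<^sup>+ t. ennreal (f t (v n t) + c t) \<partial>M) + ennreal e" for m
  proof -
    \<comment> \<open>On \<open>S m\<close> the minorant bounds \<open>f t (u t)\<close> above up to
      \<open>\<epsilon>\<close>, so this part is integrable even if the whole cost is
      infinite.\<close>
    have int1: "integrable M (\<lambda>t. indicat_real (S m) t * (f t (u t) + c t))"
    proof (rule Bochner_Integration.integrable_bound)
      show "integrable M (\<lambda>t. ((\<Sum>j\<le>m. \<bar>\<alpha> j\<bar>) + \<epsilon>) + (\<bar>g m t \<bullet> u t\<bar> + c t))"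
        using g_int[OF u] c(1) by (intro Bochner_Integration.integrable_add integrable_abs) auto
      show "AE t in M. norm (indicat_real (S m) t * (f t (u t) + c t))
          \<le> norm (((\<Sum>j\<le>m. \<bar>\<alpha> j\<bar>) + \<epsilon>) + (\<bar>g m t \<bullet> u t\<bar> + c t))"
        using minorant[of m] pos AE_space
      proof eventually_elim
        case (elim t)
        have "0 \<le> c t" using c(2) elim(3) by simp
        have "0 \<le> (\<Sum>j\<le>m. \<bar>\<alpha> j\<bar>)" by (simp add: sum_nonneg)
        show ?case
        proof (cases "t \<in> S m")
          case True
          have "0 \<le> f t (u t) + c t" using elim(2) by blast
          moreover have "f t (u t) - \<epsilon> \<le> A m t + g m t \<bullet> u t" using elim(1) True by blast
          moreover have "A m t \<le> (\<Sum>j\<le>m. \<bar>\<alpha> j\<bar>)" using A_bd[of m t] by simp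
          ultimately show ?thesis using True by simp
        next
          case False
          then show ?thesis by simp
        qed
      qed
    qed measurable
    have int2: "integrable M (\<lambda>t. indicat_real (S m) t * \<epsilon>)"
      using integrable_mult_indicator[OF S_sets, of "\<lambda>_. \<epsilon>" m] by simp
    \<comment> \<open>On \<open>S m\<close> one passes from \<open>u\<close> to \<open>v n\<close>
      along the slope \<open>g m\<close>, losing \<open>\<epsilon>\<close>; elsewhere the value is
      0, below the nonnegative integrand. Only the last bracket depends on \<open>n\<close>, and its
      integral tends to 0.\<close>
    define \<kappa> where "\<kappa> = (\<lambda>n t. (indicat_real (S m) t * (f t (u t) + c t) - indicat_real (S m) t * \<epsilon>)
      + (g m t \<bullet> v n t - g m t \<bullet> u t))"
    define I where "I = (LINT t|M. indicat_real (S m) t * (f t (u t) + c t))"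
    define J where "J = (LINT t|M. indicat_real (S m) t * \<epsilon>)"
    have int\<kappa>: "integrable M (\<kappa> n)" for n
      unfolding \<kappa>_def using int1 int2 g_int[OF v] g_int[OF u]
      by (intro Bochner_Integration.integrable_add Bochner_Integration.integrable_diff)
    have LINT\<kappa>: "(LINT t|M. \<kappa> n t) = (I - J) + ((LINT t|M. g m t \<bullet> v n t) - (LINT t|M. g m t \<bullet> u t))" for n
      unfolding \<kappa>_def I_def J_def
      by (simp only: int1 int2 g_int[OF v] g_int[OF u] Bochner_Integration.integral_add
          Bochner_Integration.integral_diff Bochner_Integration.integrable_add Bochner_Integration.integrable_diff)
    have "AE t in M. \<kappa> n t \<le> f t (v n t) + c t" for n
      using minorant[of m] pos
    proof eventually_elim
      case (elim t)
      show ?case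
      proof (cases "t \<in> S m")
        case True
        have "f t (u t) - \<epsilon> \<le> A m t + g m t \<bullet> u t" "A m t + g m t \<bullet> v n t \<le> f t (v n t)"
          using elim(1) True by blast+
        then show ?thesis using True by (simp add: \<kappa>_def)
      next
        case False
        then show ?thesis using elim(2) by (simp add: \<kappa>_def g0)
      qed
    qed
    then have le: "ennreal (LINT t|M. \<kappa> n t) \<le> (\<integral>\<^sup>+ t. ennreal (f t (v n t) + c t) \<partial>M)" for n
      by (rule ennreal_integral_le_nn_integral[OF int\<kappa>])
    have "(\<lambda>n. LINT t|M. \<kappa> n t) \<longlonglongrightarrow> (I - J) + ((LINT t|M. g m t \<bullet> u t) - (LINT t|M. g m t \<bullet> u t))"
      unfolding LINT\<kappa> by (intro tendsto_intros g_lim)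
    then have "(\<lambda>n. ennreal (LINT t|M. \<kappa> n t)) \<longlonglongrightarrow> ennreal (I - J)"
      by (intro tendsto_ennrealI) simp
    then have "ennreal (I - J) = liminf (\<lambda>n. ennreal (LINT t|M. \<kappa> n t))"
      by (rule lim_imp_Liminf[OF trivial_limit_sequentially, symmetric])
    also have "\<dots> \<le> liminf (\<lambda>n. \<integral>\<^sup>+ t. ennreal (f t (v n t) + c t) \<partial>M)"
      by (intro Liminf_mono always_eventually allI le)
    finally have lim: "ennreal (I - J) \<le> liminf (\<lambda>n. \<integral>\<^sup>+ t. ennreal (f t (v n t) + c t) \<partial>M)" .
    have "J \<le> (LINT t|M. \<epsilon>)"
      unfolding J_def using int2 \<open>0 < \<epsilon>\<close> by (intro Bochner_Integration.integral_mono) (auto simp: indicator_def)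
    then have J: "J \<le> e" using T measure_space_M by (simp add: \<epsilon>_def)
    have "(\<integral>\<^sup>+ t. indicator (S m) t * ennreal (f t (u t) + c t) \<partial>M)
        = (\<integral>\<^sup>+ t. ennreal (indicat_real (S m) t * (f t (u t) + c t)) \<partial>M)"
      by (intro nn_integral_cong) (auto simp: indicator_def)
    also have "\<dots> = ennreal I"
      unfolding I_def
    proof (rule nn_integral_eq_integral[OF int1])
      show "AE t in M. 0 \<le> indicat_real (S m) t * (f t (u t) + c t)"
        using pos by eventually_elim simp
    qed
    also have "\<dots> \<le> ennreal (I - J) + ennreal e"
    proof (cases "0 \<le> I - J")
      case True
      then show ?thesis using J \<open>0 < e\<close> by (simp add: ennreal_leI flip: ennreal_plus)
    next
      case False
      then show ?thesis using J by (simp add: ennreal_neg ennreal_leI)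
    qed
    also have "\<dots> \<le> liminf (\<lambda>n. \<integral>\<^sup>+ t. ennreal (f t (v n t) + c t) \<partial>M) + ennreal e"
      using lim by (intro add_right_mono)
    finally show ?thesis .
  qed
  \<comment> \<open>The sets \<open>S m\<close> exhaust almost all times, so monotone convergence
    removes the truncation.\<close>
  have "(\<integral>\<^sup>+ t. ennreal (f t (u t) + c t) \<partial>M)
      = (\<integral>\<^sup>+ t. (SUP m. indicator (S m) t * ennreal (f t (u t) + c t)) \<partial>M)"
  proof (rule nn_integral_cong_AE, use cover in eventually_elim)
    fix t assume "t \<in> (\<Union>j. D j)"
    then obtain j where j: "t \<in> S j" by (auto simp: S_def)
    show "ennreal (f t (u t) + c t) = (SUP m. indicator (S m) t * ennreal (f t (u t) + c t))"
    proof (rule antisym)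
      show "ennreal (f t (u t) + c t) \<le> (SUP m. indicator (S m) t * ennreal (f t (u t) + c t))"
        by (rule SUP_upper2[of j]) (use j in auto)
      show "(SUP m. indicator (S m) t * ennreal (f t (u t) + c t)) \<le> ennreal (f t (u t) + c t)"
        by (rule SUP_least) (auto simp: indicator_def)
    qed
  qed
  also have "\<dots> = (SUP m. \<integral>\<^sup>+ t. indicator (S m) t * ennreal (f t (u t) + c t) \<partial>M)"
  proof (rule nn_integral_monotone_convergence_SUP)
    show "incseq (\<lambda>m t. indicator (S m) t * ennreal (f t (u t) + c t))"
    proof (rule incseq_SucI, rule le_funI)
      fix m t
      have "S m \<subseteq> S (Suc m)" unfolding S_def by (intro UN_mono) auto
      then show "indicator (S m) t * ennreal (f t (u t) + c t) \<le> indicator (S (Suc m)) t * ennreal (f t (u t) + c t)"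
        by (auto simp: indicator_def)
    qed
  qed measurable
  also have "\<dots> \<le> liminf (\<lambda>n. \<integral>\<^sup>+ t. ennreal (f t (v n t) + c t) \<partial>M) + ennreal e"
    by (rule SUP_least) (rule local)
  finally show "(\<integral>\<^sup>+ t. ennreal (f t (u t) + c t) \<partial>M)
      \<le> liminf (\<lambda>n. \<integral>\<^sup>+ t. ennreal (f t (v n t) + c t) \<partial>M) + ennreal e" .
qed

end

section \<open>Stability of trajectories\<close>

lemma norm_matrix_vector_mult_le:
  fixes A :: "real^'k^'d" and w :: "real^'k"
  assumes "\<And>i. norm (column i A) \<le> b"
  shows "norm (A *v w) \<le> CARD('k) * norm w * b"
proof -
  have "A *v w = (\<Sum>i\<in>UNIV. (w $ i) *\<^sub>R column i A)"
    by (simp add: matrix_mult_sum scalar_mult_eq_scaleR)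
  then have "norm (A *v w) \<le> (\<Sum>i\<in>UNIV. norm ((w $ i) *\<^sub>R column i A))"
    by (simp only:) (rule norm_sum)
  also have "\<dots> \<le> (\<Sum>i\<in>(UNIV::'k set). norm w * b)"
    using assms by (intro sum_mono) (simp add: component_le_norm_cart mult_mono')
  finally show ?thesis by simp
qed

lemma column_diff: "column i (A - B) = column i A - column i (B :: real^'k^'d)"
  by (simp add: column_def vec_eq_iff)

text \<open>The exceptional times are negligible, so the fundamental theorem applies; it also
  delivers integrability of the velocity.\<close>

lemma is_trajectory_integral:
  fixes x :: "real \<Rightarrow> real^'d" and F0 :: "real^'d \<Rightarrow> real^'l \<Rightarrow> real^'d" and u :: "real \<Rightarrow> real^'k"
  assumes "is_trajectory T F0 F x0 u \<theta> x" and t: "t \<in> {0..T}"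
  shows "((\<lambda>s. F0 (x s) \<theta> + F (x s) \<theta> *v u s) has_integral (x t - x0 \<theta>)) {0..t}"
proof -
  have ac: "absolutely_continuous_fun 0 t x" and x: "x 0 = x0 \<theta>"
    using assms absolutely_continuous_fun_subinterval[of 0 T x 0 t] by (auto simp: is_trajectory_def)
  have "AE s in lebesgue. s \<in> {0..T} \<longrightarrow>
      (x has_vector_derivative (F0 (x s) \<theta> + F (x s) \<theta> *v u s)) (at s within {0..T})"
    using assms(1) by (auto simp: is_trajectory_def AE_restrict_space_iff)
  then obtain Z where Z: "Z \<in> null_sets lebesgue" "\<And>s. s \<notin> Z \<Longrightarrow> s \<in> {0..T} \<Longrightarrow>
      (x has_vector_derivative (F0 (x s) \<theta> + F (x s) \<theta> *v u s)) (at s within {0..T})"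
    by (auto elim!: AE_E3)
  have "((\<lambda>s. F0 (x s) \<theta> + F (x s) \<theta> *v u s) has_integral (x t - x 0)) {0..t}"
  proof (rule absolutely_continuous_fun_has_integral[OF ac])
    show "negligible Z" using Z(1) by (simp add: negligible_iff_null_sets)
    fix s assume "s \<in> {0..t} - Z"
    then show "(x has_vector_derivative (F0 (x s) \<theta> + F (x s) \<theta> *v u s)) (at s within {0..t})"
      using t by (intro has_vector_derivative_within_subset[OF Z(2)]) auto
  qed (use t in auto)
  then show ?thesis by (simp add: x)
qed

section \<open>Affine control systems and existence of trajectories\<close>

locale control_system = Lp_interval p T for p T +
  fixes L :: real and \<Theta> :: "(real^'l) set"
    and F0 :: "real^'d \<Rightarrow> real^'l \<Rightarrow> real^'d" and F :: "real^'d \<Rightarrow> real^'l \<Rightarrow> real^'k^'d"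
    and x0 :: "real^'l \<Rightarrow> real^'d"
  assumes L: "0 < L"
    and F0_lip: "\<And>x1 x2 \<theta>1 \<theta>2. \<theta>1 \<in> \<Theta> \<Longrightarrow> \<theta>2 \<in> \<Theta> \<Longrightarrow>
      norm (F0 x1 \<theta>1 - F0 x2 \<theta>2) \<le> L * (norm (x1 - x2) + norm (x1 + x2) * norm (\<theta>1 - \<theta>2))"
    and F_lip: "\<And>i x1 x2 \<theta>1 \<theta>2. \<theta>1 \<in> \<Theta> \<Longrightarrow> \<theta>2 \<in> \<Theta> \<Longrightarrow>
      norm (column i (F x1 \<theta>1) - column i (F x2 \<theta>2))
        \<le> L * (norm (x1 - x2) + norm (x1 + x2) * norm (\<theta>1 - \<theta>2))"
    and x0_cont: "continuous_on \<Theta> x0"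
begin

abbreviation G :: "real^'l \<Rightarrow> real^'d \<Rightarrow> real^'k \<Rightarrow> real^'d" where
  "G \<theta> x w \<equiv> F0 x \<theta> + F x \<theta> *v w"

text \<open>The Lipschitz constant of the right-hand side in the state at time \<open>t\<close>,
  integrable because \<open>u\<close> is. Summing the column bounds for \<open>F\<close> produces
  the factor \<open>CARD('k)\<close>.\<close>

abbreviation kernel :: "(real \<Rightarrow> real^'k) \<Rightarrow> real \<Rightarrow> real" where
  "kernel u t \<equiv> L * (1 + CARD('k) * norm (u t))"

lemma G_diff_le:
  assumes "\<theta>1 \<in> \<Theta>" "\<theta>2 \<in> \<Theta>"
  shows "norm (G \<theta>1 x1 w - G \<theta>2 x2 w)
    \<le> L * (1 + CARD('k) * norm w) * (norm (x1 - x2) + norm (x1 + x2) * norm (\<theta>1 - \<theta>2))" (is "_ \<le> _ * ?d")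
proof -
  have "norm (F x1 \<theta>1 *v w - F x2 \<theta>2 *v w) \<le> CARD('k) * norm w * (L * ?d)"
    using F_lip[OF assms]
    by (subst matrix_vector_mult_diff_rdistrib[symmetric]) (intro norm_matrix_vector_mult_le, simp add: column_diff)
  moreover have "norm (F0 x1 \<theta>1 - F0 x2 \<theta>2) \<le> L * ?d" by (rule F0_lip[OF assms])
  moreover have "G \<theta>1 x1 w - G \<theta>2 x2 w = (F0 x1 \<theta>1 - F0 x2 \<theta>2) + (F x1 \<theta>1 *v w - F x2 \<theta>2 *v w)"
    by simp
  ultimately have "norm (G \<theta>1 x1 w - G \<theta>2 x2 w) \<le> L * ?d + CARD('k) * norm w * (L * ?d)"
    by (metis add_mono norm_triangle_le)
  then show ?thesis by (simp add: algebra_simps)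
qed

lemma G_lipschitz:
  assumes "\<theta> \<in> \<Theta>"
  shows "norm (G \<theta> x1 w - G \<theta> x2 w) \<le> L * (1 + CARD('k) * norm w) * norm (x1 - x2)"
  using G_diff_le[OF assms assms, of x1 w x2] by simp

lemma continuous_on_fields:
  assumes "\<theta> \<in> \<Theta>"
  shows "continuous_on S (\<lambda>x. F0 x \<theta>)" and "continuous_on S (\<lambda>x. column i (F x \<theta>))"
proof -
  have "L-lipschitz_on S (\<lambda>x. F0 x \<theta>)" "L-lipschitz_on S (\<lambda>x. column i (F x \<theta>))"
    using F0_lip[OF assms assms] F_lip[OF assms assms] L by (auto simp: lipschitz_on_def dist_norm)
  then show "continuous_on S (\<lambda>x. F0 x \<theta>)" "continuous_on S (\<lambda>x. column i (F x \<theta>))"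
    by (auto intro: lipschitz_on_continuous_on)
qed

lemma kernel_absolutely_integrable:
  assumes "u \<in> Lp_space p T"
  shows "kernel u absolutely_integrable_on {0..T}"
proof -
  have "integrable M (kernel u)" using Lp_integrable[OF assms] by simp
  then show ?thesis by (simp only: integrable_iff_absolutely_integrable)
qed

lemma kernel_nonneg: "0 \<le> kernel u t"
  using L by simp

lemma F_integrable:
  assumes "\<theta> \<in> \<Theta>" "continuous_on {0..T} x" "u \<in> Lp_space p T"
  shows "(\<lambda>t. F (x t) \<theta> *v u t) absolutely_integrable_on {0..T}"
proof -
  have "(\<lambda>t. u t \<bullet> axis i 1) absolutely_integrable_on {0..T}" for i
    using Lp_integrable[OF assms(3)] by (intro absolutely_integrable_component) (simp only: integrable_iff_absolutely_integrable)
  then have "(\<lambda>t. (u t $ i) *\<^sub>R column i (F (x t) \<theta>)) absolutely_integrable_on {0..T}" for i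
    using continuous_on_compose2[OF continuous_on_fields(2)[OF assms(1)] assms(2)]
    by (intro absolutely_integrable_on_mult_continuous) (auto simp: inner_axis)
  then have "(\<lambda>t. \<Sum>i\<in>UNIV. (u t $ i) *\<^sub>R column i (F (x t) \<theta>)) absolutely_integrable_on {0..T}"
    by (intro absolutely_integrable_sum) auto
  then show ?thesis by (simp add: matrix_mult_sum scalar_mult_eq_scaleR)
qed

lemma G_integrable:
  assumes "\<theta> \<in> \<Theta>" "continuous_on {0..T} x" "u \<in> Lp_space p T"
  shows "(\<lambda>t. G \<theta> (x t) (u t)) absolutely_integrable_on {0..T}"
proof (rule set_integral_add(1)[OF absolutely_integrable_continuous_real F_integrable[OF assms]])
  show "continuous_on {0..T} (\<lambda>t. F0 (x t) \<theta>)"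
    by (rule continuous_on_compose2[OF continuous_on_fields(1)[OF assms(1), of UNIV] assms(2)]) auto
qed

lemma is_trajectory_exists:
  assumes "\<theta> \<in> \<Theta>" "u \<in> Lp_space p T"
  shows "\<exists>x. is_trajectory T F0 F x0 u \<theta> x"
proof -
  obtain x where x: "continuous_on {0..T} x"
    "\<And>t. t \<in> {0..T} \<Longrightarrow> x t = x0 \<theta> + integral {0..t} (\<lambda>s. G \<theta> (x s) (u s))"
  proof (rule Caratheodory_existence[of 0 T "kernel u" "\<lambda>t x. G \<theta> x (u t)" "x0 \<theta>"])
    show "kernel u absolutely_integrable_on {0..T}" by (rule kernel_absolutely_integrable[OF assms(2)])
    show "(\<lambda>t. G \<theta> (x t) (u t)) absolutely_integrable_on {0..T}" if "continuous_on {0..T} x" for x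
      by (rule G_integrable[OF assms(1) that assms(2)])
  qed (use T kernel_nonneg G_lipschitz[OF assms(1)] in auto)
  define g where "g = (\<lambda>s. G \<theta> (x s) (u s))"
  have g: "g absolutely_integrable_on {0..T}" unfolding g_def by (rule G_integrable[OF assms(1) x(1) assms(2)])
  \<comment> \<open>The integral form itself is taken as the trajectory, so that absolute continuity
    and the derivative can be read off; it agrees with \<open>x\<close> on the interval.\<close>
  define y where "y = (\<lambda>t. x0 \<theta> + integral {0..t} g)"
  have yx: "y t = x t" if "t \<in> {0..T}" for t using x(2)[OF that] by (simp add: y_def g_def)
  have "absolutely_continuous_fun 0 T y"
    by (rule absolutely_continuous_fun_dominated[OF indefinite_integral_absolutely_continuous_fun[OF g], of 1])
      (auto simp: y_def)
  moreover have "y 0 = x0 \<theta>" by (simp add: y_def)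
  moreover have "AE t in M. (y has_vector_derivative G \<theta> (y t) (u t)) (at t within {0..T})"
  proof -
    obtain Z where Z: "negligible Z" "\<And>t. t \<in> {0..T} - Z \<Longrightarrow>
        ((\<lambda>t. integral {0..t} g) has_vector_derivative g t) (at t within {0..T})"
      using indefinite_integral_has_vector_derivative_ae[OF set_lebesgue_integral_eq_integral(1)[OF g]] by blast
    show ?thesis
    proof (rule AE_lebesgue_on_negligible[OF Z(1)])
      fix t assume t: "t \<in> {0..T} - Z"
      have "(y has_vector_derivative 0 + g t) (at t within {0..T})"
        unfolding y_def by (intro has_vector_derivative_add has_vector_derivative_const Z(2) t)
      then show "(y has_vector_derivative G \<theta> (y t) (u t)) (at t within {0..T})"
        using yx[of t] t by (simp add: g_def)
    qed simp
  qed
  ultimately show ?thesis unfolding is_trajectory_def by blast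
qed

end

section \<open>From weak convergence of controls to uniform convergence in time\<close>

text \<open>The difference is twice the midpoint of \<open>u\<close> and \<open>- v\<close>.\<close>

lemma (in Lp_interval) Lp_pow_diff_le:
  assumes "u \<in> Lp_space p T" "v \<in> Lp_space p T" "Lp_pow u \<le> R" "Lp_pow v \<le> R"
  shows "Lp_pow (\<lambda>t. u t - v t) \<le> 2 powr p * R"
proof -
  define w where "w = (\<lambda>t. - v t)"
  have w: "w \<in> Lp_space p T" "Lp_pow w = Lp_pow v"
    using Lp_scaleR[OF assms(2), of "-1"] by (simp_all add: w_def)
  have "Lp_pow (\<lambda>t. u t - v t) = Lp_pow (\<lambda>t. 2 *\<^sub>R ((1/2) *\<^sub>R (u t + w t)))" by (simp add: w_def)
  also have "\<dots> = \<bar>2\<bar> powr p * Lp_pow (\<lambda>t. (1/2) *\<^sub>R (u t + w t))"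
    by (rule Lp_scaleR(2)[OF Lp_midpoint(1)[OF assms(1) w(1)]])
  also have "\<dots> \<le> 2 powr p * R"
    using Lp_midpoint(2)[OF assms(1) w(1)] w(2) assms(3,4) by simp
  finally show ?thesis .
qed

text \<open>As \<open>p > 1\<close>, a large \<open>\<eta>\<close> makes
  \<open>\<eta> powr (1 - p)\<close> small: the p-th powers contribute at most \<open>e / 2\<close>
  throughout the ball, and the other term is proportional to \<open>t - s\<close>.\<close>

lemma (in Lp_interval) integral_norm_small:
  assumes "0 < e"
  obtains \<delta> where "0 < \<delta>"
    "\<And>(u :: real \<Rightarrow> 'b::euclidean_space) s t. u \<in> Lp_space p T \<Longrightarrow> Lp_pow u \<le> R \<Longrightarrow> 0 \<le> s \<Longrightarrow> s \<le> t \<Longrightarrow> t \<le> T \<Longrightarrow> t - s < \<delta> \<Longrightarrow>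
      integral {s..t} (\<lambda>t. norm (u t)) < e"
proof -
  \<comment> \<open>\<open>R\<close> has no sign; with \<open>R'\<close> and the added 1 below, the
    base of the power is positive.\<close>
  define R' where "R' = max R 0"
  define \<eta> where "\<eta> = (2 * R' / e + 1) powr (1 / (p - 1))"
  have base: "2 * R' / e + 1 > 0" using assms by (simp add: R'_def add_nonneg_pos)
  then have "\<eta> > 0" by (simp add: \<eta>_def)
  have "\<eta> powr (p - 1) = 2 * R' / e + 1" using p base by (simp add: \<eta>_def powr_powr)
  moreover have "\<eta> powr (1 - p) = inverse (\<eta> powr (p - 1))" by (simp flip: powr_minus)
  ultimately have "\<eta> powr (1 - p) = inverse (2 * R' / e + 1)" by simp
  moreover have "inverse (2 * R' / e + 1) * R' \<le> e / 2"
  proof -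
    have "R' \<le> e / 2 * (2 * R' / e + 1)" using assms by (simp add: field_simps)
    then show ?thesis using base by (simp add: field_simps)
  qed
  ultimately have \<eta>: "\<eta> powr (1 - p) * R' \<le> e / 2" by simp
  have "integral {s..t} (\<lambda>t. norm (u t)) < e"
    if u: "u \<in> Lp_space p T" "Lp_pow u \<le> R" and st: "0 \<le> s" "s \<le> t" "t \<le> T" "t - s < e / (2 * \<eta>)"
    for u :: "real \<Rightarrow> 'b" and s t
  proof -
    have sets: "{s..t} \<in> sets M" using st by (auto simp: sets_restrict_space_iff)
    have "integral {s..t} (\<lambda>t. norm (u t)) = (LINT r|M. indicat_real {s..t} r *\<^sub>R norm (u r))"
      using Lp_integrable[OF u(1)] st by (intro LINT_eq_integral[symmetric]) auto
    also have "\<dots> \<le> \<eta> * measure M {s..t} + \<eta> powr (1 - p) * Lp_pow u"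
      using Lp_integral_norm_le[OF u(1) \<open>\<eta> > 0\<close> sets] by simp
    also have "measure M {s..t} = t - s"
      using st by (simp add: measure_restrict_space)
    also have "\<eta> powr (1 - p) * Lp_pow u \<le> \<eta> powr (1 - p) * R'"
      using u(2) by (intro mult_left_mono) (auto simp: R'_def)
    also note \<eta>
    also have "\<eta> * (t - s) < e / 2" using st(4) \<open>\<eta> > 0\<close> by (simp add: field_simps)
    finally show ?thesis by simp
  qed
  then show ?thesis using assms \<open>\<eta> > 0\<close> by (intro that[of "e / (2 * \<eta>)"]) auto
qed

text \<open>A finite \<open>\<delta>\<close>-net reduces uniformity to finitely many points;
  equicontinuity covers the rest with the other half of \<open>e\<close>.\<close>

lemma equicontinuous_tendsto_0_uniform:
  fixes r :: "nat \<Rightarrow> 'a::metric_space \<Rightarrow> 'b::real_normed_vector"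
  assumes "compact S"
    and equi: "\<And>e. 0 < e \<Longrightarrow> \<exists>\<delta>>0. \<forall>n. \<forall>s\<in>S. \<forall>t\<in>S. dist s t < \<delta> \<longrightarrow> norm (r n t - r n s) < e"
    and lim: "\<And>t. t \<in> S \<Longrightarrow> (\<lambda>n. r n t) \<longlonglongrightarrow> 0" and "0 < e"
  shows "\<forall>\<^sub>F n in sequentially. \<forall>t\<in>S. norm (r n t) < e"
proof -
  obtain \<delta> where "\<delta> > 0" and \<delta>: "\<forall>n. \<forall>s\<in>S. \<forall>t\<in>S. dist s t < \<delta> \<longrightarrow> norm (r n t - r n s) < e / 2"
    using equi[of "e / 2"] \<open>0 < e\<close> by auto
  obtain k where k: "finite k" "k \<subseteq> S" "S \<subseteq> (\<Union>x\<in>k. ball x \<delta>)"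
  proof (rule compactE_image[OF \<open>compact S\<close>, of S "\<lambda>x. ball x \<delta>"])
    show "S \<subseteq> (\<Union>x\<in>S. ball x \<delta>)" using \<open>\<delta> > 0\<close> by auto
  qed auto
  have "\<forall>\<^sub>F n in sequentially. norm (r n s) < e / 2" if "s \<in> k" for s
    using tendstoD[OF lim, of s "e / 2"] that k(2) \<open>0 < e\<close> by auto
  then have "\<forall>\<^sub>F n in sequentially. \<forall>s\<in>k. norm (r n s) < e / 2"
    using k(1) by (simp add: eventually_ball_finite_distrib)
  then show ?thesis
  proof eventually_elim
    fix n assume n: "\<forall>s\<in>k. norm (r n s) < e / 2"
    show "\<forall>t\<in>S. norm (r n t) < e"
    proof
      fix t assume t: "t \<in> S"
      then obtain s where s: "s \<in> k" "dist s t < \<delta>" using k(3) by auto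
      then have "norm (r n t - r n s) < e / 2" using \<delta> t k(2) by blast
      moreover have "norm (r n s) < e / 2" using n s by blast
      ultimately show "norm (r n t) < e"
        using norm_triangle_sub[of "r n t" "r n s"] by linarith
    qed
  qed
qed

context control_system
begin

text \<open>Along the fixed curve \<open>x\<close> the coefficient is one continuous matrix, so each
  component of the integral up to \<open>t\<close> is a bounded functional of
  \<open>v n - u\<close>. The common bound on p-th powers gives equicontinuity in
  \<open>t\<close>.\<close>

lemma control_term_tendsto_uniform:
  assumes \<theta>: "\<theta> \<in> \<Theta>" and x: "continuous_on {0..T} x"
    and u: "u \<in> Lp_space p T" and v: "\<And>n. v n \<in> Lp_space p T" and bd: "Lp_pow u \<le> R" "\<And>n. Lp_pow (v n) \<le> R"
    and weak: "\<And>\<phi>. \<phi> \<in> Lp_dual p T \<Longrightarrow> (\<lambda>n. \<phi> (v n)) \<longlonglongrightarrow> \<phi> u" and "0 < e"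
  shows "\<forall>\<^sub>F n in sequentially. \<forall>t\<in>{0..T}. norm (integral {0..t} (\<lambda>s. F (x s) \<theta> *v (v n s - u s))) < e"
proof (rule equicontinuous_tendsto_0_uniform[OF compact_Icc _ _ \<open>0 < e\<close>])
  have cont: "continuous_on {0..T} (\<lambda>s. column i (F (x s) \<theta>))" for i
    by (rule continuous_on_compose2[OF continuous_on_fields(2)[OF \<theta>, of UNIV] x]) auto
  have "\<exists>b. \<forall>s\<in>{0..T}. norm (column i (F (x s) \<theta>)) \<le> b" for i
    using compact_imp_bounded[OF compact_continuous_image[OF cont compact_Icc]] by (auto simp: bounded_iff)
  then obtain b where b: "\<And>i s. s \<in> {0..T} \<Longrightarrow> norm (column i (F (x s) \<theta>)) \<le> b i" by metis
  define B where "B = (\<Sum>i\<in>UNIV. b i)"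
  have b0: "0 \<le> b i" for i using order_trans[OF norm_ge_zero b[of 0 i]] T by simp
  have B: "norm (column i (F (x s) \<theta>)) \<le> B" if "s \<in> {0..T}" for i s
    using b[OF that, of i] member_le_sum[of i UNIV b] b0 by (simp add: B_def)
  have "0 \<le> B" unfolding B_def by (intro sum_nonneg b0)
  define c where "c = CARD('k) * B + 1"
  have "0 < c" using \<open>0 \<le> B\<close> by (simp add: c_def add_nonneg_pos)
  have Fle: "norm (F (x s) \<theta> *v w) \<le> c * norm w" if "s \<in> {0..T}" for s w
  proof -
    have "norm (F (x s) \<theta> *v w) \<le> CARD('k) * norm w * B"
      by (rule norm_matrix_vector_mult_le) (rule B[OF that])
    also have "\<dots> \<le> c * norm w" using norm_ge_zero[of w] by (simp add: c_def algebra_simps)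
    finally show ?thesis .
  qed
  define d where "d = (\<lambda>n s. v n s - u s)"
  have d: "d n \<in> Lp_space p T" "Lp_pow (d n) \<le> 2 powr p * R" for n
    unfolding d_def by (intro Lp_diff v u) (intro Lp_pow_diff_le v u bd)
  have Fint: "(\<lambda>s. F (x s) \<theta> *v d n s) integrable_on {a..t}" if "{a..t} \<subseteq> {0..T}" for n a t
    by (rule set_lebesgue_integral_eq_integral(1)[OF absolutely_integrable_on_subinterval[OF F_integrable[OF \<theta> x d(1)] that]])
  have dint: "(\<lambda>s. norm (d n s)) integrable_on {a..t}" if "{a..t} \<subseteq> {0..T}" for n a t
  proof -
    have "(\<lambda>s. norm (d n s)) absolutely_integrable_on {0..T}"
      using Lp_integrable[OF d(1)] by (simp only: integrable_iff_absolutely_integrable[symmetric]) simp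
    from set_lebesgue_integral_eq_integral(1)[OF absolutely_integrable_on_subinterval[OF this that]] show ?thesis .
  qed
  show "\<exists>\<delta>>0. \<forall>n. \<forall>s\<in>{0..T}. \<forall>t\<in>{0..T}. dist s t < \<delta> \<longrightarrow>
      norm (integral {0..t} (\<lambda>s. F (x s) \<theta> *v (v n s - u s)) - integral {0..s} (\<lambda>s. F (x s) \<theta> *v (v n s - u s))) < \<epsilon>"
    if "0 < \<epsilon>" for \<epsilon>
  proof -
    have "\<epsilon> / c > 0" using \<open>0 < c\<close> that by simp
    obtain \<delta> where "0 < \<delta>" and \<delta>: "\<And>(u :: real \<Rightarrow> real^'k) s t. u \<in> Lp_space p T \<Longrightarrow> Lp_pow u \<le> 2 powr p * R \<Longrightarrow>
        0 \<le> s \<Longrightarrow> s \<le> t \<Longrightarrow> t \<le> T \<Longrightarrow> t - s < \<delta> \<Longrightarrow> integral {s..t} (\<lambda>t. norm (u t)) < \<epsilon> / c"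
      using integral_norm_small[OF \<open>\<epsilon> / c > 0\<close>, where R = "2 powr p * R"] by metis
    have main: "norm (integral {0..t} (\<lambda>s. F (x s) \<theta> *v d n s) - integral {0..s} (\<lambda>s. F (x s) \<theta> *v d n s)) < \<epsilon>"
      if "0 \<le> s" "s \<le> t" "t \<le> T" "t - s < \<delta>" for n s t
    proof -
      have "integral {0..t} (\<lambda>s. F (x s) \<theta> *v d n s)
          = integral {0..s} (\<lambda>s. F (x s) \<theta> *v d n s) + integral {s..t} (\<lambda>s. F (x s) \<theta> *v d n s)"
        using that by (intro Henstock_Kurzweil_Integration.integral_combine[symmetric] Fint) auto
      then have "norm (integral {0..t} (\<lambda>s. F (x s) \<theta> *v d n s) - integral {0..s} (\<lambda>s. F (x s) \<theta> *v d n s))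
          = norm (integral {s..t} (\<lambda>s. F (x s) \<theta> *v d n s))" by simp
      also have "\<dots> \<le> integral {s..t} (\<lambda>s. c * norm (d n s))"
        using that by (intro Henstock_Kurzweil_Integration.integral_norm_bound_integral Fint
            integrable_on_mult_right dint Fle) auto
      also have "\<dots> = c * integral {s..t} (\<lambda>s. norm (d n s))" by simp
      also have "\<dots> < c * (\<epsilon> / c)" using \<delta>[OF d that] \<open>0 < c\<close> by (intro mult_strict_left_mono)
      also have "\<dots> = \<epsilon>" using \<open>0 < c\<close> by simp
      finally show ?thesis .
    qed
    have "norm (integral {0..t} (\<lambda>s. F (x s) \<theta> *v d n s) - integral {0..s} (\<lambda>s. F (x s) \<theta> *v d n s)) < \<epsilon>"
      if "s \<in> {0..T}" "t \<in> {0..T}" "dist s t < \<delta>" for n s t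
      using main[of s t n] main[of t s n] that
      by (cases "s \<le> t") (simp_all add: dist_real_def norm_minus_commute)
    then show ?thesis using \<open>0 < \<delta>\<close> unfolding d_def by blast
  qed
  show "(\<lambda>n. integral {0..t} (\<lambda>s. F (x s) \<theta> *v (v n s - u s))) \<longlonglongrightarrow> 0" if t: "t \<in> {0..T}" for t
  proof (subst tendsto_componentwise_iff, intro ballI)
    fix i :: "real^'d" assume "i \<in> Basis"
    \<comment> \<open>The transposed matrix applied to \<open>i\<close>, cut off at time
      \<open>t\<close>: the density of the functional giving the component along
      \<open>i\<close>.\<close>
    define g where "g = (\<lambda>s. indicat_real {0..t} s *\<^sub>R (\<chi> j. column j (F (x s) \<theta>) \<bullet> i))"
    have g_inner: "g s \<bullet> w = indicat_real {0..t} s *\<^sub>R ((F (x s) \<theta> *v w) \<bullet> i)" for s w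
      by (simp add: g_def inner_vec_def[of "\<chi> j. _ j"] matrix_mult_sum scalar_mult_eq_scaleR inner_sum_left mult.commute)
    have "continuous_on {0..T} (\<lambda>s. \<chi> j. column j (F (x s) \<theta>) \<bullet> i)"
      by (intro continuous_on_vec_lambda continuous_intros cont)
    then have g_meas: "g \<in> borel_measurable M"
      unfolding g_def by (intro borel_measurable_scaleR borel_measurable_indicator_Icc continuous_imp_measurable_on_sets_lebesgue) auto
    have "compact ((\<lambda>s. \<chi> j. column j (F (x s) \<theta>) \<bullet> i) ` {0..T})"
      by (intro compact_continuous_image) (fact, simp)
    then obtain C where C: "\<And>s. s \<in> {0..T} \<Longrightarrow> norm (\<chi> j. column j (F (x s) \<theta>) \<bullet> i) \<le> C"
      by (meson bounded_iff compact_imp_bounded image_eqI)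
    then have "0 \<le> C" using T norm_ge_zero order_trans by (metis atLeastAtMost_iff less_imp_le order_refl)
    have g_bd: "norm (g s) \<le> C" if "s \<in> {0..T}" for s
      using C[OF that] \<open>0 \<le> C\<close> by (simp add: g_def indicator_def)
    have eq: "integral {0..t} (\<lambda>s. F (x s) \<theta> *v (v n s - u s)) \<bullet> i
        = (LINT s|M. g s \<bullet> v n s) - (LINT s|M. g s \<bullet> u s)" for n
    proof -
      have "integrable M (\<lambda>s. F (x s) \<theta> *v d n s)"
        using F_integrable[OF \<theta> x d(1)] by (simp only: integrable_iff_absolutely_integrable)
      then have "integral {0..t} (\<lambda>s. F (x s) \<theta> *v d n s) \<bullet> i
          = (LINT s|M. indicat_real {0..t} s *\<^sub>R (F (x s) \<theta> *v d n s)) \<bullet> i"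
        using t by (subst LINT_eq_integral) auto
      also have "\<dots> = (LINT s|M. (indicat_real {0..t} s *\<^sub>R (F (x s) \<theta> *v d n s)) \<bullet> i)"
        using \<open>integrable M (\<lambda>s. F (x s) \<theta> *v d n s)\<close>
        by (intro integral_inner_left[symmetric] integrable_indicator_Icc)
      also have "\<dots> = (LINT s|M. g s \<bullet> d n s)"
        by (simp only: g_inner inner_scaleR_left real_scaleR_def)
      also have "\<dots> = (LINT s|M. g s \<bullet> v n s - g s \<bullet> u s)"
        by (simp only: d_def inner_diff_right)
      also have "\<dots> = (LINT s|M. g s \<bullet> v n s) - (LINT s|M. g s \<bullet> u s)"
        by (intro Bochner_Integration.integral_diff Lp_dual_integral(2)[OF g_meas g_bd] v u)
      finally show ?thesis by (simp add: d_def)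
    qed
    have "(\<lambda>n. LINT s|M. g s \<bullet> v n s) \<longlonglongrightarrow> (LINT s|M. g s \<bullet> u s)"
      using weak[OF Lp_dual_integral(1)[OF g_meas g_bd]] .
    then show "(\<lambda>n. integral {0..t} (\<lambda>s. F (x s) \<theta> *v (v n s - u s)) \<bullet> i) \<longlonglongrightarrow> 0 \<bullet> i"
      unfolding eq by (simp add: LIM_zero)
  qed
qed

lemma is_trajectory_trajectory:
  assumes "\<theta> \<in> \<Theta>" "u \<in> Lp_space p T"
  shows "is_trajectory T F0 F x0 u \<theta> (\<lambda>t. trajectory T F0 F x0 u t \<theta>)"
  unfolding trajectory_def by (rule someI_ex[OF is_trajectory_exists[OF assms]])

text \<open>The fields are compared under the same control \<open>v n\<close>; the change of control
  is isolated in \<open>r n\<close> along the limit trajectory. No a priori bound on the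
  \<open>X n\<close> is available, so \<open>norm (X n s + x s)\<close> is split into the difference
  and \<open>2 * b\<close>.\<close>

theorem trajectory_stability:
  assumes \<theta>: "\<And>n. \<theta> n \<in> \<Theta>" "\<theta>' \<in> \<Theta>" "\<theta> \<longlonglongrightarrow> \<theta>'"
    and u: "u \<in> Lp_space p T" and v: "\<And>n. v n \<in> Lp_space p T" and bd: "Lp_pow u \<le> R" "\<And>n. Lp_pow (v n) \<le> R"
    and weak: "\<And>\<phi>. \<phi> \<in> Lp_dual p T \<Longrightarrow> (\<lambda>n. \<phi> (v n)) \<longlonglongrightarrow> \<phi> u"
  shows "(\<lambda>n. trajectory T F0 F x0 (v n) T (\<theta> n)) \<longlonglongrightarrow> trajectory T F0 F x0 u T \<theta>'"
proof -
  define X where "X = (\<lambda>n t. trajectory T F0 F x0 (v n) t (\<theta> n))"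
  define x where "x = (\<lambda>t. trajectory T F0 F x0 u t \<theta>')"
  have X: "is_trajectory T F0 F x0 (v n) (\<theta> n) (X n)" for n
    unfolding X_def by (rule is_trajectory_trajectory[OF \<theta>(1) v])
  have x: "is_trajectory T F0 F x0 u \<theta>' x"
    unfolding x_def by (rule is_trajectory_trajectory[OF \<theta>(2) u])
  have contX: "continuous_on {0..T} (X n)" for n
    using X[of n] absolutely_continuous_fun_continuous_on by (auto simp: is_trajectory_def)
  have contx: "continuous_on {0..T} x"
    using x absolutely_continuous_fun_continuous_on by (auto simp: is_trajectory_def)
  obtain b where b: "0 \<le> b" "\<And>t. t \<in> {0..T} \<Longrightarrow> norm (x t) \<le> b"
  proof -
    obtain b where "\<forall>t\<in>{0..T}. norm (x t) \<le> b"
      using compact_imp_bounded[OF compact_continuous_image[OF contx compact_Icc]] by (auto simp: bounded_iff)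
    then show ?thesis by (intro that[of "max b 0"]) (auto simp: max.coboundedI1)
  qed
  \<comment> \<open>A common bound for the integrals of the kernels, from
    \<open>Lp_L1_norm_le\<close> with \<open>s = 1\<close>.\<close>
  define \<kappa> where "\<kappa> = L * (T + CARD('k) * (T + R))"
  have R: "0 \<le> R" using Lp_pow_nonneg[of u] bd(1) by simp
  then have "0 \<le> \<kappa>" using L T by (simp add: \<kappa>_def)
  have kint: "kernel (v n) absolutely_integrable_on {0..T}" for n by (rule kernel_absolutely_integrable[OF v])
  have kint': "kernel (v n) integrable_on {0..t}" if "t \<in> {0..T}" for n t
    using that by (intro set_lebesgue_integral_eq_integral(1) absolutely_integrable_on_subinterval[OF kint]) auto
  have k\<kappa>: "integral {0..t} (kernel (v n)) \<le> \<kappa>" if t: "t \<in> {0..T}" for n t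
  proof -
    have "integral {0..t} (kernel (v n)) \<le> integral {0..T} (kernel (v n))"
      using t T kernel_nonneg by (intro integral_subset_le kint') auto
    also have "\<dots> = (LINT t|M. kernel (v n) t)"
      using kint[of n] by (intro lebesgue_integral_eq_integral[symmetric]) (simp_all only: integrable_iff_absolutely_integrable, simp)
    also have "\<dots> = L * (T + CARD('k) * (LINT t|M. norm (v n t)))"
      using Lp_integrable[OF v[of n]] measure_space_M by simp
    also have "\<dots> \<le> \<kappa>"
      unfolding \<kappa>_def using Lp_L1_norm_le[OF v[of n], of 1] bd(2)[of n] L
      by (intro mult_left_mono add_left_mono) auto
    finally show ?thesis .
  qed
  define r where "r = (\<lambda>n t. integral {0..t} (\<lambda>s. F (x s) \<theta>' *v (v n s - u s)))"
  have est: "norm (X n t - x t) \<le> (norm (x0 (\<theta> n) - x0 \<theta>') + 2 * b * norm (\<theta> n - \<theta>') * \<kappa> + \<delta>)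
      + integral {0..t} (\<lambda>s. 2 * kernel (v n) s * norm (X n s - x s))"
    if t: "t \<in> {0..T}" and small: "norm (\<theta> n - \<theta>') \<le> 1" and r: "norm (r n t) \<le> \<delta>" for n t \<delta>
  proof -
    define D where "D = (\<lambda>s. G (\<theta> n) (X n s) (v n s) - G \<theta>' (x s) (v n s))"
    have sub: "{0..t} \<subseteq> {0..T}" using t by auto
    have Xi: "((\<lambda>s. G (\<theta> n) (X n s) (v n s)) has_integral (X n t - x0 (\<theta> n))) {0..t}"
      by (rule is_trajectory_integral[OF X t])
    have xi: "((\<lambda>s. G \<theta>' (x s) (u s)) has_integral (x t - x0 \<theta>')) {0..t}"
      by (rule is_trajectory_integral[OF x t])
    have xv: "(\<lambda>s. G \<theta>' (x s) (v n s)) integrable_on {0..t}"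
      by (rule set_lebesgue_integral_eq_integral(1)[OF absolutely_integrable_on_subinterval[OF G_integrable[OF \<theta>(2) contx v] sub]])
    have Dint: "D integrable_on {0..t}"
      unfolding D_def by (rule integrable_diff[OF has_integral_integrable[OF Xi] xv])
    have rint: "(\<lambda>s. F (x s) \<theta>' *v (v n s - u s)) integrable_on {0..t}"
      by (rule set_lebesgue_integral_eq_integral(1)[OF absolutely_integrable_on_subinterval[OF F_integrable[OF \<theta>(2) contx Lp_diff[OF v u]] sub]])
    have "((\<lambda>s. G (\<theta> n) (X n s) (v n s) - G \<theta>' (x s) (u s)) has_integral
        ((X n t - x0 (\<theta> n)) - (x t - x0 \<theta>'))) {0..t}"
      by (rule has_integral_diff[OF Xi xi])
    moreover have "G (\<theta> n) (X n s) (v n s) - G \<theta>' (x s) (u s) = D s + F (x s) \<theta>' *v (v n s - u s)" for s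
      by (simp add: D_def matrix_vector_mult_diff_distrib)
    ultimately have "((\<lambda>s. D s + F (x s) \<theta>' *v (v n s - u s)) has_integral
        ((X n t - x0 (\<theta> n)) - (x t - x0 \<theta>'))) {0..t}" by simp
    moreover have "((\<lambda>s. D s + F (x s) \<theta>' *v (v n s - u s)) has_integral (integral {0..t} D + r n t)) {0..t}"
      unfolding r_def by (intro has_integral_add integrable_integral Dint rint)
    ultimately have "(X n t - x0 (\<theta> n)) - (x t - x0 \<theta>') = integral {0..t} D + r n t"
      by (rule has_integral_unique)
    then have eq: "X n t - x t = (x0 (\<theta> n) - x0 \<theta>') + (integral {0..t} D + r n t)"
      by (simp add: algebra_simps)
    have k2: "(\<lambda>s. 2 * kernel (v n) s * norm (X n s - x s)) integrable_on {0..t}"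
    proof -
      have "(\<lambda>s. 2 * kernel (v n) s) absolutely_integrable_on {0..t}"
        by (rule absolutely_integrable_on_subinterval[OF set_integrable_mult_right[OF kint] sub])
      moreover have "continuous_on {0..t} (\<lambda>s. norm (X n s - x s))"
        by (intro continuous_intros continuous_on_subset[OF contX sub] continuous_on_subset[OF contx sub])
      ultimately have "(\<lambda>s. (2 * kernel (v n) s) *\<^sub>R norm (X n s - x s)) absolutely_integrable_on {0..t}"
        by (rule absolutely_integrable_on_mult_continuous)
      from set_lebesgue_integral_eq_integral(1)[OF this] show ?thesis by simp
    qed
    have "norm (integral {0..t} D) \<le> integral {0..t} (\<lambda>s. 2 * kernel (v n) s * norm (X n s - x s)
        + 2 * b * norm (\<theta> n - \<theta>') * kernel (v n) s)"
    proof (rule Henstock_Kurzweil_Integration.integral_norm_bound_integral[OF Dint])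
      show "(\<lambda>s. 2 * kernel (v n) s * norm (X n s - x s) + 2 * b * norm (\<theta> n - \<theta>') * kernel (v n) s)
          integrable_on {0..t}"
        by (intro integrable_add k2 integrable_on_mult_right kint' t)
      fix s assume s: "s \<in> {0..t}"
      define k where "k = kernel (v n) s"
      define e where "e = norm (X n s - x s)"
      have "0 \<le> k" "0 \<le> e" unfolding k_def e_def using kernel_nonneg by auto
      have "norm (X n s + x s) \<le> e + 2 * b"
      proof -
        have "X n s + x s = (X n s - x s) + (x s + x s)" by simp
        then have "norm (X n s + x s) \<le> e + norm (x s + x s)"
          unfolding e_def by (metis norm_triangle_ineq)
        moreover have "norm (x s + x s) \<le> 2 * b"
          using norm_triangle_ineq[of "x s" "x s"] b(2)[of s] s t by simp
        ultimately show ?thesis by simp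
      qed
      then have "norm (X n s + x s) * norm (\<theta> n - \<theta>') \<le> (e + 2 * b) * norm (\<theta> n - \<theta>')"
        by (intro mult_right_mono) auto
      \<comment> \<open>As \<open>norm (\<theta> n - \<theta>')\<close> is at most 1, its product
        with \<open>e\<close> is at most another \<open>e\<close>; this doubles the kernel.\<close>
      also have "\<dots> \<le> e + 2 * b * norm (\<theta> n - \<theta>')"
        using mult_left_mono[OF small \<open>0 \<le> e\<close>] by (simp add: algebra_simps)
      finally have "e + norm (X n s + x s) * norm (\<theta> n - \<theta>') \<le> 2 * e + 2 * b * norm (\<theta> n - \<theta>')" by simp
      then have "k * (e + norm (X n s + x s) * norm (\<theta> n - \<theta>')) \<le> k * (2 * e + 2 * b * norm (\<theta> n - \<theta>'))"
        using \<open>0 \<le> k\<close> by (rule mult_left_mono)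
      moreover have "norm (D s) \<le> k * (e + norm (X n s + x s) * norm (\<theta> n - \<theta>'))"
        unfolding D_def k_def e_def by (rule G_diff_le[OF \<theta>(1,2)])
      ultimately have "norm (D s) \<le> 2 * k * e + 2 * b * norm (\<theta> n - \<theta>') * k" by (simp add: algebra_simps)
      then show "norm (D s) \<le> 2 * kernel (v n) s * norm (X n s - x s) + 2 * b * norm (\<theta> n - \<theta>') * kernel (v n) s"
        by (simp only: k_def e_def)
    qed
    also have "\<dots> = integral {0..t} (\<lambda>s. 2 * kernel (v n) s * norm (X n s - x s))
        + 2 * b * norm (\<theta> n - \<theta>') * integral {0..t} (kernel (v n))"
      by (subst Henstock_Kurzweil_Integration.integral_add[OF k2 integrable_on_mult_right[OF kint'[OF t]]])
        (simp only: Henstock_Kurzweil_Integration.integral_mult_right)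
    also have "\<dots> \<le> integral {0..t} (\<lambda>s. 2 * kernel (v n) s * norm (X n s - x s)) + 2 * b * norm (\<theta> n - \<theta>') * \<kappa>"
      using b(1) by (intro add_left_mono mult_left_mono k\<kappa> t) auto
    finally have "norm (integral {0..t} D) \<le> integral {0..t} (\<lambda>s. 2 * kernel (v n) s * norm (X n s - x s))
        + 2 * b * norm (\<theta> n - \<theta>') * \<kappa>" .
    moreover have "norm (X n t - x t) \<le> norm (x0 (\<theta> n) - x0 \<theta>') + (norm (integral {0..t} D) + norm (r n t))"
      unfolding eq using norm_triangle_ineq[of "integral {0..t} D" "r n t"]
        norm_triangle_ineq[of "x0 (\<theta> n) - x0 \<theta>'" "integral {0..t} D + r n t"] by linarith
    ultimately show ?thesis using r by linarith
  qed
  have "(\<lambda>n. X n T) \<longlonglongrightarrow> x T"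
  proof (rule tendstoI)
    fix \<eta> :: real assume "0 < \<eta>"
    \<comment> \<open>Gronwall contributes \<open>exp (4 * \<kappa>)\<close>, with one 2 from its
      exponent and one from the doubled kernel; the three small terms of \<open>K\<close> use up at
      most three quarters of \<open>\<eta>\<close>.\<close>
    define \<delta> where "\<delta> = \<eta> / (4 * exp (4 * \<kappa>))"
    have "0 < \<delta>" using \<open>0 < \<eta>\<close> by (simp add: \<delta>_def)
    have \<theta>0: "(\<lambda>n. norm (\<theta> n - \<theta>')) \<longlonglongrightarrow> 0"
      using \<theta>(3) by (simp add: LIM_zero tendsto_norm_zero)
    have "(\<lambda>n. x0 (\<theta> n)) \<longlonglongrightarrow> x0 \<theta>'"
      by (rule continuous_on_tendsto_compose[OF x0_cont \<theta>(3,2)]) (simp add: \<theta>)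
    then have "(\<lambda>n. norm (x0 (\<theta> n) - x0 \<theta>')) \<longlonglongrightarrow> 0"
      by (simp add: LIM_zero tendsto_norm_zero)
    then have e1: "\<forall>\<^sub>F n in sequentially. norm (x0 (\<theta> n) - x0 \<theta>') < \<delta>"
      using \<open>0 < \<delta>\<close> by (rule order_tendstoD(2))
    have "(\<lambda>n. 2 * b * norm (\<theta> n - \<theta>') * \<kappa>) \<longlonglongrightarrow> 2 * b * 0 * \<kappa>"
      by (intro tendsto_intros \<theta>0)
    then have e2: "\<forall>\<^sub>F n in sequentially. 2 * b * norm (\<theta> n - \<theta>') * \<kappa> < \<delta>"
      using \<open>0 < \<delta>\<close> by (intro order_tendstoD(2)) auto
    have e3: "\<forall>\<^sub>F n in sequentially. norm (\<theta> n - \<theta>') < 1"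
      using \<theta>0 by (rule order_tendstoD(2)) simp
    have e4: "\<forall>\<^sub>F n in sequentially. \<forall>t\<in>{0..T}. norm (r n t) < \<delta>"
      unfolding r_def by (rule control_term_tendsto_uniform[OF \<theta>(2) contx u v bd weak \<open>0 < \<delta>\<close>])
    show "\<forall>\<^sub>F n in sequentially. dist (X n T) (x T) < \<eta>"
      using e1 e2 e3 e4
    proof eventually_elim
      fix n assume n: "norm (x0 (\<theta> n) - x0 \<theta>') < \<delta>" "2 * b * norm (\<theta> n - \<theta>') * \<kappa> < \<delta>"
        "norm (\<theta> n - \<theta>') < 1" "\<forall>t\<in>{0..T}. norm (r n t) < \<delta>"
      define K where "K = norm (x0 (\<theta> n) - x0 \<theta>') + 2 * b * norm (\<theta> n - \<theta>') * \<kappa> + \<delta>"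
      have "0 \<le> K" unfolding K_def using b(1) \<open>0 \<le> \<kappa>\<close> \<open>0 < \<delta>\<close> by (intro add_nonneg_nonneg mult_nonneg_nonneg) auto
      have "K \<le> 3 * \<delta>" unfolding K_def using n(1,2) by linarith
      have "norm (X n T - x T) \<le> K * exp (2 * integral {0..T} (\<lambda>s. 2 * kernel (v n) s))"
      proof (rule Gronwall_integrable_kernel[where a = 0 and b = T and e = "\<lambda>t. norm (X n t - x t)"])
        show "(\<lambda>s. 2 * kernel (v n) s) absolutely_integrable_on {0..T}"
          by (rule set_integrable_mult_right[OF kint])
        show "0 \<le> 2 * kernel (v n) t" for t using kernel_nonneg[of "v n" t] by simp
        show "continuous_on {0..T} (\<lambda>t. norm (X n t - x t))"
          by (intro continuous_intros contX contx)
        show "norm (X n t - x t) \<le> K + integral {0..t} (\<lambda>s. 2 * kernel (v n) s * norm (X n s - x s))"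
          if "t \<in> {0..T}" for t
          unfolding K_def by (rule est[OF that]) (use n that in \<open>auto simp: less_imp_le\<close>)
      qed (use T \<open>0 \<le> K\<close> in auto)
      also have "integral {0..T} (\<lambda>s. 2 * kernel (v n) s) = 2 * integral {0..T} (kernel (v n))"
        by (rule Henstock_Kurzweil_Integration.integral_mult_right)
      also have "K * exp (2 * (2 * integral {0..T} (kernel (v n)))) \<le> K * exp (4 * \<kappa>)"
        using k\<kappa>[of T n] T \<open>0 \<le> K\<close> by (intro mult_left_mono) auto
      also have "\<dots> \<le> 3 * \<delta> * exp (4 * \<kappa>)" using \<open>K \<le> 3 * \<delta>\<close> by simp
      also have "\<dots> < \<eta>" using \<open>0 < \<eta>\<close> by (simp add: \<delta>_def)
      finally show "dist (X n T) (x T) < \<eta>" by (simp add: dist_norm)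
    qed
  qed
  then show ?thesis by (simp add: X_def x_def)
qed

end

section \<open>Gamma-convergence\<close>

lemma hausdorff_dist_commute: "hausdorff_dist A B = hausdorff_dist B A"
  by (simp add: hausdorff_dist_def max.commute)

text \<open>The inner infimum is attained by compactness. Boundedness of \<open>B\<close> bounds the
  outer supremum, without which a real supremum carries no information.\<close>

lemma hausdorff_dist_nearest:
  fixes A B :: "'a::metric_space set"
  assumes "compact A" "A \<noteq> {}" "bounded B" "b \<in> B"
  obtains a where "a \<in> A" "dist b a \<le> hausdorff_dist A B"
proof -
  obtain a where a: "a \<in> A" "\<And>a'. a' \<in> A \<Longrightarrow> dist b a \<le> dist b a'"
  proof -
    have "continuous_on A (dist b)" by (intro continuous_intros)
    from continuous_attains_inf[OF assms(1,2) this] show ?thesis using that by blast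
  qed
  obtain e where e: "\<And>b'. b' \<in> B \<Longrightarrow> dist a b' \<le> e"
    using assms(3) bounded_any_center[of B a] by auto
  have "(INF a\<in>A. dist b' a) \<le> dist b' a" for b'
    using a(1) by (intro cINF_lower bdd_belowI[of _ 0]) auto
  then have "bdd_above ((\<lambda>b. INF a\<in>A. dist b a) ` B)"
    using e by (intro bdd_aboveI[of _ e]) (auto simp: dist_commute intro: order_trans)
  then have "(INF a\<in>A. dist b a) \<le> (SUP b\<in>B. INF a\<in>A. dist b a)"
    using assms(4) by (intro cSUP_upper)
  moreover have "dist b a \<le> (INF a\<in>A. dist b a)"
    using a assms(2) by (intro cINF_greatest) auto
  ultimately show ?thesis using a(1) by (intro that[of a]) (auto simp: hausdorff_dist_def)
qed

locale minimax_problem = control_system p T L \<Theta> F0 F x0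
  for p T L and \<Theta> :: "(real^'l) set" and F0 :: "real^'d \<Rightarrow> real^'l \<Rightarrow> real^'d"
    and F :: "real^'d \<Rightarrow> real^'l \<Rightarrow> real^'k^'d" and x0 +
  fixes a :: "real^'d \<Rightarrow> real^'l \<Rightarrow> real" and f :: "real \<Rightarrow> real^'k \<Rightarrow> real"
    and c :: "real \<Rightarrow> real" and C :: real
  assumes \<Theta>: "compact \<Theta>"
    and a_cont: "continuous_on (UNIV \<times> \<Theta>) (\<lambda>(x, \<theta>). a x \<theta>)"
    and a_nonneg: "\<And>x \<theta>. \<theta> \<in> \<Theta> \<Longrightarrow> 0 \<le> a x \<theta>"
    and f_meas: "\<And>v. (\<lambda>t. f t v) \<in> borel_measurable (lebesgue_on {0..T})"
    and f_conv: "AE t in lebesgue_on {0..T}. continuous_on UNIV (f t) \<and> convex_on UNIV (f t)"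
    and c: "integrable (lebesgue_on {0..T}) c" "\<And>t. t \<in> {0..T} \<Longrightarrow> 0 \<le> c t"
    and C: "0 < C"
    and f_coercive: "AE t in lebesgue_on {0..T}. \<forall>v. C * norm v powr p - c t \<le> f t v"
begin

section \<open>Terminal and running parts of the cost\<close>

definition endpoint_cost :: "(real \<Rightarrow> real^'k) \<Rightarrow> real^'l \<Rightarrow> real" where
  "endpoint_cost u \<theta> = a (trajectory T F0 F x0 u T \<theta>) \<theta>"

definition terminal :: "(real^'l) set \<Rightarrow> (real \<Rightarrow> real^'k) \<Rightarrow> ereal" where
  "terminal A u = (SUP \<theta>\<in>A. ereal (endpoint_cost u \<theta>))"

definition running :: "(real \<Rightarrow> real^'k) \<Rightarrow> ereal" where
  "running u = ext_integral M (\<lambda>t. f t (u t))"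

abbreviation cost :: "(real^'l) set \<Rightarrow> (real \<Rightarrow> real^'k) \<Rightarrow> ereal" where
  "cost A u \<equiv> minimax_cost T F0 F x0 a f A u"

lemma cost_eq: "cost A u = terminal A u + running u"
  by (simp add: minimax_cost_def terminal_def running_def endpoint_cost_def)

lemma running_eq:
  assumes "u \<in> Lp_space p T"
  shows "running u = enn2ereal (\<integral>\<^sup>+ t. ennreal (f t (u t) + c t) \<partial>M) - ereal (LINT t|M. c t)"
  unfolding running_def
proof (rule ext_integral_add)
  show "(\<lambda>t. f t (u t)) \<in> borel_measurable M"
    by (rule Caratheodory_borel_measurable[OF _ f_meas _ Lp_measurable[OF assms]])
      (use f_conv in \<open>auto elim: eventually_mono\<close>)
  show "AE t in M. - c t \<le> f t (u t)"
    using f_coercive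
  proof eventually_elim
    fix t assume *: "\<forall>v. C * norm v powr p - c t \<le> f t v"
    have "0 \<le> C * norm (u t) powr p" using C by simp
    then show "- c t \<le> f t (u t)" using *[rule_format, of "u t"] by linarith
  qed
qed (use c in auto)

lemma running_lower_bound:
  assumes "u \<in> Lp_space p T"
  shows "- ereal (LINT t|M. c t) \<le> running u"
  unfolding running_eq[OF assms]
  by (cases "enn2ereal (\<integral>\<^sup>+ t. ennreal (f t (u t) + c t) \<partial>M)") (auto simp: enn2ereal_nonneg dest: arg_cong[of _ _ "\<lambda>x. 0 \<le> x"])

text \<open>Semicontinuity is known for the shifted integral in \<open>ennreal\<close>; comparison
  with each level \<open>y\<close> carries it across the subtraction of a finite constant.\<close>

lemma running_liminf:
  assumes u: "u \<in> Lp_space p T" and v: "\<And>n. v n \<in> Lp_space p T"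
    and weak: "\<And>\<phi>. \<phi> \<in> Lp_dual p T \<Longrightarrow> (\<lambda>n. \<phi> (v n)) \<longlonglongrightarrow> \<phi> u"
  shows "running u \<le> liminf (\<lambda>n. running (v n))"
  unfolding le_Liminf_iff
proof (intro allI impI)
  fix y assume y: "y < running u"
  define r where "r = (LINT t|M. c t)"
  define A where "A = (\<lambda>w. \<integral>\<^sup>+ t. ennreal (f t (w t) + c t) \<partial>M)"
  have run: "running w = enn2ereal (A w) - ereal r" if "w \<in> Lp_space p T" for w
    unfolding A_def r_def by (rule running_eq[OF that])
  have less_iff: "y < running w \<longleftrightarrow> y + ereal r < enn2ereal (A w)" if "w \<in> Lp_space p T" for w
    unfolding run[OF that] by (cases y; cases "enn2ereal (A w)") auto
  show "\<forall>\<^sub>F n in sequentially. y < running (v n)"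
  \<comment> \<open>A negative shifted level is exceeded for every \<open>n\<close> and has no
    faithful image under \<open>e2ennreal\<close>.\<close>
  proof (cases "0 \<le> y + ereal r")
    case False
    then have "y + ereal r < enn2ereal (A w)" for w
      using enn2ereal_nonneg[of "A w"] by (meson not_le order_less_le_trans)
    then show ?thesis using less_iff[OF v] by simp
  next
    case True
    have "A u \<le> liminf (\<lambda>n. A (v n))"
      unfolding A_def by (rule convex_integral_weak_lsc[OF f_meas f_conv c C f_coercive u v weak])
    moreover have eq: "e2ennreal (y + ereal r) < A w \<longleftrightarrow> y + ereal r < enn2ereal (A w)" for w
      using True by (simp add: less_ennreal.rep_eq enn2ereal_e2ennreal)
    moreover have "e2ennreal (y + ereal r) < A u" using y less_iff[OF u] eq by blast
    ultimately have "\<forall>\<^sub>F n in sequentially. e2ennreal (y + ereal r) < A (v n)"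
      unfolding le_Liminf_iff by blast
    then show ?thesis unfolding eq less_iff[OF v] .
  qed
qed

lemma endpoint_cost_tendsto:
  assumes \<theta>: "\<And>n. \<theta> n \<in> \<Theta>" "\<theta>' \<in> \<Theta>" "\<theta> \<longlonglongrightarrow> \<theta>'"
    and u: "u \<in> Lp_pow_ball R" and v: "\<And>n. v n \<in> Lp_pow_ball R"
    and weak: "\<And>\<phi>. \<phi> \<in> Lp_dual p T \<Longrightarrow> (\<lambda>n. \<phi> (v n)) \<longlonglongrightarrow> \<phi> u"
  shows "(\<lambda>n. endpoint_cost (v n) (\<theta> n)) \<longlonglongrightarrow> endpoint_cost u \<theta>'"
proof -
  have "(\<lambda>n. trajectory T F0 F x0 (v n) T (\<theta> n)) \<longlonglongrightarrow> trajectory T F0 F x0 u T \<theta>'"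
    by (rule trajectory_stability[OF \<theta> _ _ _ _ weak, where R = R]) (use u v in \<open>auto simp: Lp_pow_ball_def\<close>)
  then have "(\<lambda>n. (trajectory T F0 F x0 (v n) T (\<theta> n), \<theta> n)) \<longlonglongrightarrow> (trajectory T F0 F x0 u T \<theta>', \<theta>')"
    using \<theta>(3) by (rule tendsto_Pair)
  from continuous_on_tendsto_compose[OF a_cont this] show ?thesis
    using \<theta>(1,2) by (simp add: endpoint_cost_def)
qed

text \<open>Stability of trajectories for a constant sequence of controls.\<close>

lemma endpoint_cost_continuous:
  assumes "u \<in> Lp_space p T"
  shows "continuous_on \<Theta> (endpoint_cost u)"
  unfolding continuous_on_sequentially
proof (intro allI ballI impI; elim conjE)
  fix \<theta> \<theta>' assume "\<theta>' \<in> \<Theta>" "\<forall>n. \<theta> n \<in> \<Theta>" "\<theta> \<longlonglongrightarrow> \<theta>'"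
  then show "(endpoint_cost u \<circ> \<theta>) \<longlonglongrightarrow> endpoint_cost u \<theta>'"
    using endpoint_cost_tendsto[of \<theta> \<theta>' u "Lp_pow u" "\<lambda>_. u"] assms by (simp add: o_def Lp_pow_ball_def)
qed

lemma terminal_nonneg:
  assumes "A \<noteq> {}" "A \<subseteq> \<Theta>"
  shows "0 \<le> terminal A u"
proof -
  obtain \<theta> where "\<theta> \<in> A" using assms(1) by auto
  then show ?thesis
    unfolding terminal_def using assms(2) a_nonneg by (intro SUP_upper2[of \<theta>]) (auto simp: endpoint_cost_def)
qed

context
  fixes A :: "nat \<Rightarrow> (real^'l) set" and A' :: "(real^'l) set"
  assumes A: "\<And>n. A n \<noteq> {}" "\<And>n. compact (A n)" "\<And>n. A n \<subseteq> \<Theta>"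
    and A': "A' \<noteq> {}" "compact A'" "A' \<subseteq> \<Theta>"
    and A_lim: "(\<lambda>n. hausdorff_dist (A n) A') \<longlonglongrightarrow> 0"
begin

text \<open>Each parameter in \<open>A'\<close> is the limit of nearest points in the sets
  \<open>A n\<close>; their endpoint costs converge and lie below the suprema.\<close>

lemma terminal_liminf:
  assumes u: "u \<in> Lp_pow_ball R" and v: "\<And>n. v n \<in> Lp_pow_ball R"
    and weak: "\<And>\<phi>. \<phi> \<in> Lp_dual p T \<Longrightarrow> (\<lambda>n. \<phi> (v n)) \<longlonglongrightarrow> \<phi> u"
  shows "terminal A' u \<le> liminf (\<lambda>n. terminal (A n) (v n))"
  unfolding terminal_def[of A']
proof (rule SUP_least)
  fix \<theta>' assume \<theta>': "\<theta>' \<in> A'"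
  have "\<exists>\<theta>. \<theta> \<in> A n \<and> dist \<theta>' \<theta> \<le> hausdorff_dist (A n) A'" for n
    using hausdorff_dist_nearest[OF A(2) A(1) compact_imp_bounded[OF A'(2)] \<theta>'] by metis
  then obtain \<theta> where \<theta>: "\<And>n. \<theta> n \<in> A n" "\<And>n. dist \<theta>' (\<theta> n) \<le> hausdorff_dist (A n) A'" by metis
  have "(\<lambda>n. dist (\<theta> n) \<theta>') \<longlonglongrightarrow> 0"
  proof (rule Lim_null_comparison[OF _ A_lim])
    show "\<forall>\<^sub>F n in sequentially. norm (dist (\<theta> n) \<theta>') \<le> hausdorff_dist (A n) A'"
      using \<theta>(2) by (intro always_eventually) (simp add: dist_commute)
  qed
  then have "\<theta> \<longlonglongrightarrow> \<theta>'" by (rule tendsto_dist_iff[THEN iffD2])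
  then have "(\<lambda>n. endpoint_cost (v n) (\<theta> n)) \<longlonglongrightarrow> endpoint_cost u \<theta>'"
    using \<theta>(1) A(3) \<theta>' A'(3) by (intro endpoint_cost_tendsto[OF _ _ _ u v weak]) auto
  then have "(\<lambda>n. ereal (endpoint_cost (v n) (\<theta> n))) \<longlonglongrightarrow> ereal (endpoint_cost u \<theta>')" by simp
  then have "ereal (endpoint_cost u \<theta>') = liminf (\<lambda>n. ereal (endpoint_cost (v n) (\<theta> n)))"
    by (rule lim_imp_Liminf[OF trivial_limit_sequentially, symmetric])
  also have "\<dots> \<le> liminf (\<lambda>n. terminal (A n) (v n))"
    unfolding terminal_def using \<theta>(1) by (intro Liminf_mono always_eventually allI SUP_upper)
  finally show "ereal (endpoint_cost u \<theta>') \<le> liminf (\<lambda>n. terminal (A n) (v n))" .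
qed

text \<open>Both parts are bounded below, which rules out opposite infinities in the superadditivity
  of \<open>liminf\<close>.\<close>

lemma cost_liminf:
  assumes u: "u \<in> Lp_pow_ball R" and v: "\<And>n. v n \<in> Lp_pow_ball R"
    and weak: "\<And>\<phi>. \<phi> \<in> Lp_dual p T \<Longrightarrow> (\<lambda>n. \<phi> (v n)) \<longlonglongrightarrow> \<phi> u"
  shows "cost A' u \<le> liminf (\<lambda>n. cost (A n) (v n))"
proof -
  have L: "u \<in> Lp_space p T" "v n \<in> Lp_space p T" for n using u v by (auto simp: Lp_pow_ball_def)
  have 0: "0 \<le> liminf (\<lambda>n. terminal (A n) (v n))"
    by (intro Liminf_bounded always_eventually allI terminal_nonneg A)
  have 1: "- ereal (LINT t|M. c t) \<le> liminf (\<lambda>n. running (v n))"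
    by (intro Liminf_bounded always_eventually allI running_lower_bound L)
  have "cost A' u \<le> liminf (\<lambda>n. terminal (A n) (v n)) + liminf (\<lambda>n. running (v n))"
    unfolding cost_eq by (intro add_mono terminal_liminf[OF u v weak] running_liminf L weak)
  also have "\<dots> \<le> liminf (\<lambda>n. terminal (A n) (v n) + running (v n))"
    by (rule ereal_liminf_add_mono) (use 0 1 in auto)
  finally show ?thesis by (simp add: cost_eq)
qed

text \<open>With the control fixed only the terminal part varies; uniform continuity on
  \<open>\<Theta>\<close> trades a parameter in \<open>A n\<close> for a near one in
  \<open>A'\<close>.\<close>

lemma cost_limsup:
  assumes u: "u \<in> Lp_space p T"
  shows "limsup (\<lambda>n. cost (A n) u) \<le> cost A' u"
proof (rule ereal_le_epsilon)
  fix e :: ereal assume "0 < e"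
  show "limsup (\<lambda>n. cost (A n) u) \<le> cost A' u + e"
  proof (cases e)
    case (real \<epsilon>)
    then have "0 < \<epsilon>" using \<open>0 < e\<close> by simp
    have "uniformly_continuous_on \<Theta> (endpoint_cost u)"
      by (rule compact_uniformly_continuous[OF endpoint_cost_continuous[OF u] \<Theta>])
    then obtain \<delta> where "0 < \<delta>" and \<delta>: "\<And>\<theta> \<theta>'. \<theta> \<in> \<Theta> \<Longrightarrow> \<theta>' \<in> \<Theta> \<Longrightarrow> dist \<theta>' \<theta> < \<delta> \<Longrightarrow>
        dist (endpoint_cost u \<theta>') (endpoint_cost u \<theta>) < \<epsilon>"
      using \<open>0 < \<epsilon>\<close> unfolding uniformly_continuous_on_def by metis
    have "\<forall>\<^sub>F n in sequentially. hausdorff_dist (A n) A' < \<delta>"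
      using A_lim \<open>0 < \<delta>\<close> by (rule order_tendstoD(2))
    then have "\<forall>\<^sub>F n in sequentially. cost (A n) u \<le> cost A' u + e"
    proof eventually_elim
      fix n assume n: "hausdorff_dist (A n) A' < \<delta>"
      have "terminal (A n) u \<le> terminal A' u + e"
        unfolding terminal_def[of "A n"]
      proof (rule SUP_least)
        fix \<theta> assume \<theta>: "\<theta> \<in> A n"
        obtain \<theta>' where \<theta>': "\<theta>' \<in> A'" "dist \<theta> \<theta>' \<le> hausdorff_dist A' (A n)"
          by (rule hausdorff_dist_nearest[OF A'(2,1) compact_imp_bounded[OF A(2)] \<theta>])
        have "dist (endpoint_cost u \<theta>) (endpoint_cost u \<theta>') < \<epsilon>"
          using \<theta> \<theta>' A(3) A'(3) n by (intro \<delta>) (auto simp: hausdorff_dist_commute)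
        then have "ereal (endpoint_cost u \<theta>) \<le> ereal (endpoint_cost u \<theta>') + e"
          by (simp add: real dist_real_def)
        also have "\<dots> \<le> terminal A' u + e"
          unfolding terminal_def using \<theta>'(1) by (intro add_right_mono SUP_upper)
        finally show "ereal (endpoint_cost u \<theta>) \<le> terminal A' u + e" .
      qed
      then have "terminal (A n) u + running u \<le> (terminal A' u + e) + running u" by (rule add_right_mono)
      then show "cost (A n) u \<le> cost A' u + e" by (simp add: cost_eq ac_simps)
    qed
    then show ?thesis by (rule Limsup_bounded)
  next
    case PInf
    have "cost A' u \<noteq> -\<infinity>"
      using terminal_nonneg[OF A'(1,3), of u] running_lower_bound[OF u] by (auto simp: cost_eq)
    then show ?thesis using PInf by simp
  qed (use \<open>0 < e\<close> in auto)
qed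

end

section \<open>Subsequences, infima and minimizers\<close>

context
  fixes A :: "nat \<Rightarrow> (real^'l) set" and A' :: "(real^'l) set" and R :: real
  assumes A: "\<And>n. A n \<noteq> {}" "\<And>n. compact (A n)" "\<And>n. A n \<subseteq> \<Theta>"
    and A': "A' \<noteq> {}" "compact A'" "A' \<subseteq> \<Theta>"
    and A_lim: "(\<lambda>n. hausdorff_dist (A n) A') \<longlonglongrightarrow> 0"
begin

text \<open>Formulated along subsequences for the compactness arguments on infima and minimizers.
  The limit stays in the ball because the ball is weakly closed.\<close>

lemma cost_liminf_weak:
  assumes "strict_mono r" "\<And>n. v n \<in> Lp_pow_ball R" "limitin (weak_Lp p T) v u sequentially"
  shows "u \<in> Lp_pow_ball R" and "cost A' u \<le> liminf (\<lambda>n. cost (A (r n)) (v n))"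
proof -
  show u: "u \<in> Lp_pow_ball R"
    by (rule limitin_closedin[OF assms(3) closedin_weak_ball]) (use assms(2) in auto)
  have "v n \<in> Lp_space p T" for n using assms(2)[of n] by (simp add: Lp_pow_ball_def)
  then have weak: "\<And>\<phi>. \<phi> \<in> Lp_dual p T \<Longrightarrow> (\<lambda>n. \<phi> (v n)) \<longlonglongrightarrow> \<phi> u"
    using assms(3) limitin_weak_Lp_iff by blast
  have "(\<lambda>n. hausdorff_dist (A (r n)) A') \<longlonglongrightarrow> 0"
    using LIMSEQ_subseq_LIMSEQ[OF A_lim assms(1)] by (simp add: o_def)
  then show "cost A' u \<le> liminf (\<lambda>n. cost (A (r n)) (v n))"
    using A A' assms(2) u weak
    by (intro cost_liminf[where A = "\<lambda>n. A (r n)" and A' = A' and u = u and v = v and R = R]) auto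
qed

lemma cost_Gamma_converges:
  "Gamma_converges (subtopology (weak_Lp p T) (Lp_pow_ball R)) (\<lambda>n. cost (A n)) (cost A')"
proof -
  have top: "topspace (subtopology (weak_Lp p T) (Lp_pow_ball R)) = (Lp_pow_ball R :: (real \<Rightarrow> real^'k) set)"
    by (auto simp: Lp_pow_ball_def)
  show ?thesis
    unfolding Gamma_converges_def top
  proof (intro conjI ballI allI impI; (elim conjE)?)
    fix u :: "real \<Rightarrow> real^'k" and v assume "\<forall>n. v n \<in> Lp_pow_ball R" "limitin (subtopology (weak_Lp p T) (Lp_pow_ball R)) v u sequentially"
    then show "cost A' u \<le> liminf (\<lambda>n. cost (A n) (v n))"
      using cost_liminf_weak(2)[of "\<lambda>n. n" v u] by (simp add: limitin_subtopology strict_mono_def)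
  next
    fix u :: "real \<Rightarrow> real^'k" assume u: "u \<in> Lp_pow_ball R"
    then have L: "u \<in> Lp_space p T" by (simp add: Lp_pow_ball_def)
    show "\<exists>v. (\<forall>n. v n \<in> Lp_pow_ball R) \<and> limitin (subtopology (weak_Lp p T) (Lp_pow_ball R)) v u sequentially \<and>
        limsup (\<lambda>n. cost (A n) (v n)) \<le> cost A' u"
      using u L cost_limsup[OF A A' A_lim L]
      by (intro exI[of _ "\<lambda>_. u"]) (simp add: limitin_subtopology limitin_const_iff)
  qed
qed

text \<open>Fixed controls give the upper bound. If the lower bound failed, near-minimizers along a
  subsequence would have a weak limit with cost below \<open>m'\<close>.\<close>

lemma cost_Inf_tendsto:
  "(\<lambda>n. INF u\<in>Lp_pow_ball R. cost (A n) u) \<longlonglongrightarrow> (INF u\<in>Lp_pow_ball R. cost A' u)"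
proof -
  define m where "m = (\<lambda>n. INF u\<in>Lp_pow_ball R. cost (A n) u)"
  define m' where "m' = (INF u\<in>Lp_pow_ball R. cost A' u)"
  have "limsup m \<le> m'"
    unfolding m'_def
  proof (rule INF_greatest)
    fix u :: "real \<Rightarrow> real^'k" assume u: "u \<in> Lp_pow_ball R"
    have "limsup m \<le> limsup (\<lambda>n. cost (A n) u)"
      unfolding m_def using u by (intro Limsup_mono always_eventually allI INF_lower)
    also have "\<dots> \<le> cost A' u"
      using u by (intro cost_limsup A A' A_lim) (simp add: Lp_pow_ball_def)
    finally show "limsup m \<le> cost A' u" .
  qed
  moreover have "m' \<le> liminf m"
    unfolding le_Liminf_iff
  proof (intro allI impI, rule ccontr)
    fix y assume "y < m'" and "\<not> (\<forall>\<^sub>F n in sequentially. y < m n)"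
    \<comment> \<open>Room above \<open>y\<close> is needed because the infima are not known to be
      attained.\<close>
    obtain z where z: "y < z" "z < m'" using dense[OF \<open>y < m'\<close>] by blast
    have "\<exists>\<^sub>F n in sequentially. m n \<le> y"
      using \<open>\<not> (\<forall>\<^sub>F n in sequentially. y < m n)\<close> by (simp add: frequently_def not_le)
    then have "infinite {n. m n \<le> y}"
      by (simp add: frequently_cofinite[symmetric] cofinite_eq_sequentially)
    then obtain r :: "nat \<Rightarrow> nat" where r: "strict_mono r" "\<And>n. m (r n) \<le> y"
      using infinite_enumerate by blast
    have "\<exists>v\<in>Lp_pow_ball R. cost (A (r n)) v < z" for n
      using order_le_less_trans[OF r(2) z(1), of n] by (simp add: m_def INF_less_iff)
    then obtain v where v: "\<And>n. v n \<in> Lp_pow_ball R" "\<And>n. cost (A (r n)) (v n) < z" by metis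
    obtain w s where ws: "w \<in> Lp_pow_ball R" "strict_mono s" "limitin (weak_Lp p T) (v \<circ> s) w sequentially"
      by (rule weak_ball_sequentially_compact[OF v(1)])
    have "m' \<le> cost A' w" unfolding m'_def by (rule INF_lower[OF ws(1)])
    also have "\<dots> \<le> liminf (\<lambda>n. cost (A ((r \<circ> s) n)) ((v \<circ> s) n))"
      using v(1) by (intro cost_liminf_weak(2) strict_mono_o r(1) ws) auto
    also have "\<dots> \<le> liminf (\<lambda>n. z)"
      using v(2) by (intro Liminf_mono always_eventually) (auto intro: less_imp_le)
    also have "\<dots> = z" by (simp add: Liminf_const)
    finally show False using z(2) by simp
  qed
  moreover have "liminf m \<le> limsup m" by (rule Liminf_le_Limsup) simp
  ultimately have "liminf m = m'" "limsup m = m'" by (auto intro: antisym order_trans)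
  then have "m \<longlonglongrightarrow> m'" by (simp add: tendsto_iff_Liminf_eq_Limsup)
  then show ?thesis by (simp add: m_def m'_def)
qed

text \<open>The minimal costs converge to the infimum of the limit cost, and the liminf inequality
  bounds the cost of \<open>v\<close> by their limit.\<close>

lemma cost_minimizer_limit:
  assumes us: "\<And>n. us n \<in> Lp_pow_ball R" "\<And>n u. u \<in> Lp_pow_ball R \<Longrightarrow> cost (A n) (us n) \<le> cost (A n) u"
    and r: "strict_mono r" and lim: "limitin (weak_Lp p T) (us \<circ> r) v sequentially"
  shows "is_arg_min (cost A') (\<lambda>u. u \<in> Lp_pow_ball R) v"
proof -
  define m where "m = (\<lambda>n. INF u\<in>Lp_pow_ball R. cost (A n) u)"
  have "(us \<circ> r) n \<in> Lp_pow_ball R" for n using us(1) by simp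
  note v = cost_liminf_weak[OF r this lim]
  have "cost (A n) (us n) \<le> m n" for n unfolding m_def using us(2) by (intro INF_greatest)
  then have "liminf (\<lambda>n. cost (A (r n)) ((us \<circ> r) n)) \<le> liminf (\<lambda>n. m (r n))"
    by (intro Liminf_mono always_eventually) simp
  also have "\<dots> = (INF u\<in>Lp_pow_ball R. cost A' u)"
    using LIMSEQ_subseq_LIMSEQ[OF cost_Inf_tendsto r]
    by (intro lim_imp_Liminf) (simp_all add: m_def o_def)
  finally have "cost A' v \<le> (INF u\<in>Lp_pow_ball R. cost A' u)" using v(2) by simp
  then have "cost A' v \<le> cost A' u" if "u \<in> Lp_pow_ball R" for u
    using INF_lower[OF that, of "cost A'"] by (rule order_trans)
  then show ?thesis using v(1) by (auto simp: is_arg_min_def not_less)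
qed

end

end

theorem theorem3p3:
  fixes p T L \<rho> :: real
    and \<Theta> :: "(real^'l) set"
    and F0 :: "real^'d \<Rightarrow> real^'l \<Rightarrow> real^'d"
    and F :: "real^'d \<Rightarrow> real^'l \<Rightarrow> real^'k^'d"
    and x0 :: "real^'l \<Rightarrow> real^'d"
    and a :: "real^'d \<Rightarrow> real^'l \<Rightarrow> real"
    and f :: "real \<Rightarrow> real^'k \<Rightarrow> real"
    and \<Theta>N :: "enat \<Rightarrow> (real^'l) set"
  defines "J \<equiv> \<lambda>N::enat. minimax_cost T F0 F x0 a f (\<Theta>N N)"
    and "\<X> \<equiv> Lp_ball p T \<rho> :: (real \<Rightarrow> real^'k) set"
    and "W \<equiv> weak_Lp p T :: (real \<Rightarrow> real^'k) topology"
  assumes "1 < p" and "0 < T" and "compact \<Theta>"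
    and "0 < L"
    and F0_lip: "\<And>x1 x2 \<theta>1 \<theta>2. \<theta>1 \<in> \<Theta> \<Longrightarrow> \<theta>2 \<in> \<Theta> \<Longrightarrow>
      norm (F0 x1 \<theta>1 - F0 x2 \<theta>2) \<le> L * (norm (x1 - x2) + norm (x1 + x2) * norm (\<theta>1 - \<theta>2))"
    and F_lip: "\<And>i x1 x2 \<theta>1 \<theta>2. \<theta>1 \<in> \<Theta> \<Longrightarrow> \<theta>2 \<in> \<Theta> \<Longrightarrow>
      norm (column i (F x1 \<theta>1) - column i (F x2 \<theta>2))
        \<le> L * (norm (x1 - x2) + norm (x1 + x2) * norm (\<theta>1 - \<theta>2))"
    and x0_cont: "continuous_on \<Theta> x0"
    and a_cont: "continuous_on (UNIV \<times> \<Theta>) (\<lambda>(x, \<theta>). a x \<theta>)"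
    and a_nonneg: "\<And>x \<theta>. \<theta> \<in> \<Theta> \<Longrightarrow> 0 \<le> a x \<theta>"
    and f_meas: "\<And>v. (\<lambda>t. f t v) \<in> borel_measurable (lebesgue_on {0..T})"
    and f_conv: "AE t in lebesgue_on {0..T}. continuous_on UNIV (f t) \<and> convex_on UNIV (f t)"
    and f_coercive: "\<exists>c C. integrable (lebesgue_on {0..T}) c \<and> (\<forall>t\<in>{0..T}. 0 \<le> c t) \<and> 0 < C \<and>
      (AE t in lebesgue_on {0..T}. \<forall>v. C * norm v powr p - c t \<le> f t v)"
    and f_bound: "\<exists>v' c'. integrable (lebesgue_on {0..T}) c' \<and> (\<forall>t\<in>{0..T}. 0 \<le> c' t) \<and>
      (AE t in lebesgue_on {0..T}. \<bar>f t v'\<bar> \<le> c' t)"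
    and \<Theta>N: "\<And>N. 1 \<le> N \<Longrightarrow> \<Theta>N N \<noteq> {} \<and> compact (\<Theta>N N) \<and> \<Theta>N N \<subseteq> \<Theta>"
    and \<Theta>N_lim: "(\<lambda>N. hausdorff_dist (\<Theta>N (enat N)) (\<Theta>N \<infinity>)) \<longlonglongrightarrow> 0"
    and "0 < \<rho>"
    and \<rho>: "\<And>N u. 1 \<le> N \<Longrightarrow> is_arg_min (J N) (\<lambda>u. u \<in> Lp_space p T) u \<Longrightarrow> Lp_norm p T u \<le> \<rho>"
  shows "Gamma_converges (subtopology W \<X>) (\<lambda>N. J (enat N)) (J \<infinity>) \<and>
    (\<lambda>N. INF u\<in>\<X>. J (enat N) u) \<longlonglongrightarrow> (INF u\<in>\<X>. J \<infinity> u) \<and>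
    (\<forall>us. (\<forall>N\<ge>1. is_arg_min (J (enat N)) (\<lambda>u. u \<in> \<X>) (us N)) \<longrightarrow>
       compactin W (W closure_of (us ` {1..})) \<and>
       (\<forall>r v. strict_mono r \<and> limitin W (us \<circ> r) v sequentially \<longrightarrow>
          is_arg_min (J \<infinity>) (\<lambda>u. u \<in> \<X>) v))"
proof -
  obtain c C where c: "integrable (lebesgue_on {0..T}) c" "\<forall>t\<in>{0..T}. 0 \<le> c t" "0 < C"
    "AE t in lebesgue_on {0..T}. \<forall>v. C * norm v powr p - c t \<le> f t v"
    using f_coercive by blast
  interpret minimax_problem p T L \<Theta> F0 F x0 a f c C
    by unfold_locales (use assms(4-7) F0_lip F_lip x0_cont a_cont a_nonneg f_meas f_conv c in auto)
  define R where "R = \<rho> powr p"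
  have X: "\<X> = Lp_pow_ball R" using Lp_ball_eq[of \<rho>] \<open>0 < \<rho>\<close> by (simp add: \<X>_def R_def)
  \<comment> \<open>The set \<open>\<Theta>N 0\<close> is unconstrained; it is replaced by an admissible one.\<close>
  define A where "A = (\<lambda>n. if n = 0 then \<Theta>N \<infinity> else \<Theta>N (enat n))"
  have one: "1 \<le> enat n" if "n \<noteq> 0" for n
    using that by (simp add: one_enat_def)
  have A: "A n \<noteq> {}" "compact (A n)" "A n \<subseteq> \<Theta>" for n
    using \<Theta>N[of \<infinity>] \<Theta>N[OF one, of n] by (auto simp: A_def)
  have A': "\<Theta>N \<infinity> \<noteq> {}" "compact (\<Theta>N \<infinity>)" "\<Theta>N \<infinity> \<subseteq> \<Theta>" using \<Theta>N[of \<infinity>] by auto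
  have ev: "\<forall>\<^sub>F n in sequentially. A n = \<Theta>N (enat n)"
    by (intro eventually_sequentiallyI[of 1]) (simp add: A_def)
  have A_lim: "(\<lambda>n. hausdorff_dist (A n) (\<Theta>N \<infinity>)) \<longlonglongrightarrow> 0"
    by (rule Lim_transform_eventually[OF \<Theta>N_lim]) (use ev in \<open>auto elim: eventually_mono\<close>)
  have JA: "\<forall>\<^sub>F n in sequentially. J (enat n) = cost (A n)"
    using ev by eventually_elim (simp add: J_def)
  have "Gamma_converges (subtopology W \<X>) (\<lambda>N. cost (A N)) (J \<infinity>)"
    unfolding X W_def J_def by (rule cost_Gamma_converges[OF A A' A_lim])
  \<comment> \<open>Gamma-limits see only the tail, so the change at index 0 has no effect.\<close>
  moreover have "liminf (\<lambda>N. J (enat N) (v N)) = liminf (\<lambda>N. cost (A N) (v N))"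
    "limsup (\<lambda>N. J (enat N) (v N)) = limsup (\<lambda>N. cost (A N) (v N))" for v
    using JA by (intro Liminf_eq Limsup_eq; force elim: eventually_mono)+
  ultimately have Gamma: "Gamma_converges (subtopology W \<X>) (\<lambda>N. J (enat N)) (J \<infinity>)"
    unfolding Gamma_converges_def by (simp only:)
  have "(\<lambda>N. INF u\<in>\<X>. cost (A N) u) \<longlonglongrightarrow> (INF u\<in>\<X>. J \<infinity> u)"
    unfolding X J_def by (rule cost_Inf_tendsto[OF A A' A_lim])
  then have Inf: "(\<lambda>N. INF u\<in>\<X>. J (enat N) u) \<longlonglongrightarrow> (INF u\<in>\<X>. J \<infinity> u)"
    by (rule Lim_transform_eventually) (use JA in \<open>auto elim: eventually_mono\<close>)
  have "compactin W (W closure_of (us ` {1..})) \<and>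
       (\<forall>r v. strict_mono r \<and> limitin W (us \<circ> r) v sequentially \<longrightarrow> is_arg_min (J \<infinity>) (\<lambda>u. u \<in> \<X>) v)"
    if us: "\<forall>N\<ge>1. is_arg_min (J (enat N)) (\<lambda>u. u \<in> \<X>) (us N)" for us
  proof (intro conjI allI impI; (elim conjE)?)
    have usX: "us n \<in> Lp_pow_ball R" if "n \<ge> 1" for n
      using us that by (simp add: is_arg_min_def X)
    have "W closure_of (us ` {1..}) \<subseteq> Lp_pow_ball R"
      unfolding W_def by (intro closure_of_minimal closedin_weak_ball) (use usX in auto)
    then show "compactin W (W closure_of (us ` {1..}))"
      unfolding W_def by (intro closed_compactin[OF compactin_weak_ball] closedin_closure_of)
    fix r v assume r: "strict_mono r" and lim: "limitin W (us \<circ> r) v sequentially"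
    \<comment> \<open>Minimality is given from index 1 on, so everything is shifted by one. As
      \<open>r (Suc n) \<ge> 1\<close>, the subtraction in \<open>r1\<close> is exact and
      \<open>us (Suc (r1 n))\<close> is \<open>us (r (Suc n))\<close>.\<close>
    define A1 where "A1 = (\<lambda>n. A (Suc n))"
    define r1 where "r1 = (\<lambda>n. r (Suc n) - 1)"
    have rpos: "r (Suc n) \<ge> 1" for n
      using strict_mono_imp_increasing[OF r, of "Suc n"] by simp
    have "strict_mono r1"
      unfolding strict_mono_Suc_iff r1_def using rpos strict_monoD[OF r, of "Suc n" "Suc (Suc n)" for n]
      by (metis diff_less_mono lessI)
    have lim1: "limitin (weak_Lp p T) ((\<lambda>n. us (Suc n)) \<circ> r1) v sequentially"
    proof -
      have "limitin W (\<lambda>n. (us \<circ> r) (n + 1)) v sequentially"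
        using lim by (rule limitin_sequentially_offset)
      moreover have "Suc (r (Suc n) - 1) = r (Suc n)" for n using rpos[of n] by simp
      ultimately show ?thesis by (simp add: W_def r1_def o_def)
    qed
    have "is_arg_min (cost (\<Theta>N \<infinity>)) (\<lambda>u. u \<in> Lp_pow_ball R) v"
    proof (rule cost_minimizer_limit[where A = A1 and us = "\<lambda>n. us (Suc n)" and r = r1])
      show "(\<lambda>n. hausdorff_dist (A1 n) (\<Theta>N \<infinity>)) \<longlonglongrightarrow> 0"
        unfolding A1_def using A_lim by (rule LIMSEQ_Suc)
      show "cost (A1 n) (us (Suc n)) \<le> cost (A1 n) u" if "u \<in> Lp_pow_ball R" for n u
        using us[rule_format, of "Suc n"] that by (simp add: is_arg_min_def X J_def A1_def A_def not_less)
    qed (use A A' usX \<open>strict_mono r1\<close> lim1 in \<open>auto simp: A1_def\<close>)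
    then show "is_arg_min (J \<infinity>) (\<lambda>u. u \<in> \<X>) v" by (simp add: J_def X)
  qed
  then show ?thesis using Gamma Inf by blast
qed

end
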